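(* Suppose $X$ is an $n$-dimensional smooth manifold and $G$ is a finite group that acts smoothly on $X$. Let $\xi$ be a trivial $d$-dimensional $G$-equivariant complex vector bundle over $X$ such that whenever $x\in X$ and $H\subset G$ is the isotropy group of $x$, the action of $H$ on the fibre $\xi|_x$ is trivial. Let $\theta=X\times\mathbb{C}^r$ be the $r$-dimensional trivial bundle over $X$ with the $G$-action defined by $g:(x,v)\mapsto(gx,v)$ for $g\in G$. If $u_0,u_1:\theta\to\xi$ are injective and equivariant bundle maps and $d\ge n/2+r$, then there exists an equivariant bundle automorphism $s:\xi\to\xi$ such that $u_0=s\,u_1$.
   Context: A $G$-equivariant vector bundle over a $G$-space $X$ is a vector bundle $\rho:\xi\to X$ with a (continuous) $G$-action on $\xi$ such that $g\rho=\rho g$ and $g|_{\xi_x}$ is a linear map onto $\xi_{gx}$ for every $g\in G$, $x\in X$. "Trivial $d$-dimensional" for $\xi$ means that the underlying (non-equivariant) complex vector bundle is isomorphic to $X\times\mathbb{C}^d$. Bundle maps and bundle automorphisms are continuous, fibrewise linear and cover the identity of $X$; "equivariant" means commuting with the $G$-actions. The isotropy group of $x$ is $\{g\in G: gx=x\}$. *)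

theory Defs
  imports "HOL-Analysis.Analysis" "HOL-Algebra.Group_Action" "HOL-Algebra.Module"
begin

section \<open>Smooth manifolds and smooth maps\<close>

text \<open>
  Dimensions are natural numbers (dimension 0 included), so \<open>\<real>\<^sup>n\<close> is the library's
  \<^const>\<open>Euclidean_space\<close>: real sequences vanishing from index \<open>n\<close> on.
  A real function on an open subset \<open>U\<close> of it is \<open>C\<^sup>k\<close> if all its iterated partial
  derivatives of order at most \<open>k\<close> exist and are continuous on \<open>U\<close>.
\<close>

fun Ck_on :: "nat \<Rightarrow> nat \<Rightarrow> (nat \<Rightarrow> real) set \<Rightarrow> ((nat \<Rightarrow> real) \<Rightarrow> real) \<Rightarrow> bool" where
  "Ck_on n 0 U f \<longleftrightarrow> continuous_map (subtopology (Euclidean_space n) U) euclideanreal f"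
| "Ck_on n (Suc k) U f \<longleftrightarrow>
     continuous_map (subtopology (Euclidean_space n) U) euclideanreal f \<and>
     (\<exists>f'. \<forall>i<n. (\<forall>x\<in>U. ((\<lambda>t. f (x(i := t))) has_real_derivative f' i x) (at (x i))) \<and>
                Ck_on n k U (f' i))"

definition smooth_on ::
    "nat \<Rightarrow> nat \<Rightarrow> (nat \<Rightarrow> real) set \<Rightarrow> ((nat \<Rightarrow> real) \<Rightarrow> (nat \<Rightarrow> real)) \<Rightarrow> bool" where
  "smooth_on n m U F \<longleftrightarrow> (\<forall>j<m. \<forall>k. Ck_on n k U (\<lambda>x. F x j))"

text \<open>A chart is a pair of an open domain and a coordinate map defined there.\<close>

type_synonym 'x chart = "'x set \<times> ('x \<Rightarrow> nat \<Rightarrow> real)"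

definition is_chart :: "nat \<Rightarrow> 'x topology \<Rightarrow> 'x chart \<Rightarrow> bool" where
  "is_chart n X = (\<lambda>(U, c). openin X U \<and> openin (Euclidean_space n) (c ` U) \<and>
     homeomorphic_map (subtopology X U) (subtopology (Euclidean_space n) (c ` U)) c)"

text \<open>
  The coordinate representation of \<open>f\<close> in the charts \<open>(U, c)\<close> and \<open>(V, d)\<close> is
  \<open>d \<circ> f \<circ> c\<^sup>-\<^sup>1\<close>, defined on \<open>c (U \<inter> f\<^sup>-\<^sup>1 V)\<close>; transition maps are
  the case where \<open>f\<close> is the identity.
\<close>

definition smooth_in_charts ::
    "nat \<Rightarrow> nat \<Rightarrow> 'x chart \<Rightarrow> 'y chart \<Rightarrow> ('x \<Rightarrow> 'y) \<Rightarrow> bool" where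
  "smooth_in_charts n m = (\<lambda>(U, c) (V, d) f.
     smooth_on n m (c ` (U \<inter> f -` V)) (\<lambda>z. d (f (inv_into U c z))))"

definition smooth_atlas :: "nat \<Rightarrow> 'x topology \<Rightarrow> 'x chart set \<Rightarrow> bool" where
  "smooth_atlas n X A \<longleftrightarrow>
     (\<forall>C\<in>A. is_chart n X C) \<and> (\<Union>C\<in>A. fst C) = topspace X \<and>
     (\<forall>C\<in>A. \<forall>D\<in>A. smooth_in_charts n n C D (\<lambda>x. x))"

text \<open>
  Manifolds are Hausdorff, second countable and without boundary. The atlas need not be
  maximal; it represents the smooth structure that it generates.
\<close>

definition smooth_manifold :: "nat \<Rightarrow> 'x topology \<Rightarrow> 'x chart set \<Rightarrow> bool" where
  "smooth_manifold n X A \<longleftrightarrow> Hausdorff_space X \<and> second_countable X \<and> smooth_atlas n X A"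

definition smooth_map ::
    "nat \<Rightarrow> 'x topology \<Rightarrow> 'x chart set \<Rightarrow> nat \<Rightarrow> 'y topology \<Rightarrow> 'y chart set \<Rightarrow> ('x \<Rightarrow> 'y) \<Rightarrow> bool" where
  "smooth_map n X A m Y B f \<longleftrightarrow>
     continuous_map X Y f \<and> (\<forall>C\<in>A. \<forall>D\<in>B. smooth_in_charts n m C D f)"

text \<open>
  The group is finite, hence discrete, so an action is continuous or smooth if and only if
  each group element acts by a continuous or smooth map.
\<close>

definition smooth_action ::
    "('g, 'z) monoid_scheme \<Rightarrow> nat \<Rightarrow> 'x topology \<Rightarrow> 'x chart set \<Rightarrow> ('g \<Rightarrow> 'x \<Rightarrow> 'x) \<Rightarrow> bool" where
  "smooth_action G n X A \<phi> \<longleftrightarrow>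
     group_action G (topspace X) \<phi> \<and> (\<forall>g\<in>carrier G. smooth_map n X A n X A (\<phi> g))"

definition continuous_action ::
    "('g, 'z) monoid_scheme \<Rightarrow> 'x topology \<Rightarrow> ('g \<Rightarrow> 'x \<Rightarrow> 'x) \<Rightarrow> bool" where
  "continuous_action G X \<phi> \<longleftrightarrow>
     group_action G (topspace X) \<phi> \<and> (\<forall>g\<in>carrier G. continuous_map X X (\<phi> g))"


section \<open>Complex vector bundles\<close>

definition complex_ring :: "complex ring" where
  "complex_ring = \<lparr>carrier = UNIV, mult = (*), one = 1, zero = 0, add = (+)\<rparr>"

definition linear_between :: "(complex, 'a) module \<Rightarrow> (complex, 'b) module \<Rightarrow> ('a \<Rightarrow> 'b) \<Rightarrow> bool" where
  "linear_between M N f \<longleftrightarrow>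
     f \<in> carrier M \<rightarrow> carrier N \<and>
     (\<forall>v\<in>carrier M. \<forall>w\<in>carrier M. f (v \<oplus>\<^bsub>M\<^esub> w) = f v \<oplus>\<^bsub>N\<^esub> f w) \<and>
     (\<forall>a. \<forall>v\<in>carrier M. f (a \<odot>\<^bsub>M\<^esub> v) = a \<odot>\<^bsub>N\<^esub> f v)"

text \<open>
  The field \<open>fibre\<close> carries the vector space structure of the fibres. It is a module record,
  whose fields \<open>mult\<close> and \<open>one\<close> are irrelevant.
\<close>

record ('x, 'e) vbundle =
  total_space :: "'e topology"
  proj :: "'e \<Rightarrow> 'x"
  fibre :: "'x \<Rightarrow> (complex, 'e) module"

definition bundle_map ::
    "'x topology \<Rightarrow> ('x, 'a) vbundle \<Rightarrow> ('x, 'b) vbundle \<Rightarrow> ('a \<Rightarrow> 'b) \<Rightarrow> bool" where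
  "bundle_map X \<xi> \<eta> u \<longleftrightarrow>
     continuous_map (total_space \<xi>) (total_space \<eta>) u \<and>
     (\<forall>e\<in>topspace (total_space \<xi>). proj \<eta> (u e) = proj \<xi> e) \<and>
     (\<forall>x\<in>topspace X. linear_between (fibre \<xi> x) (fibre \<eta> x) u)"

definition bundle_iso ::
    "'x topology \<Rightarrow> ('x, 'a) vbundle \<Rightarrow> ('x, 'b) vbundle \<Rightarrow> ('a \<Rightarrow> 'b) \<Rightarrow> bool" where
  "bundle_iso X \<xi> \<eta> u \<longleftrightarrow>
     bundle_map X \<xi> \<eta> u \<and>
     (\<exists>v. bundle_map X \<eta> \<xi> v \<and> homeomorphic_maps (total_space \<xi>) (total_space \<eta>) u v)"

abbreviation bundle_automorphism :: "'x topology \<Rightarrow> ('x, 'e) vbundle \<Rightarrow> ('e \<Rightarrow> 'e) \<Rightarrow> bool" where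
  "bundle_automorphism X \<xi> \<equiv> bundle_iso X \<xi> \<xi>"

text \<open>\<open>\<complex>\<^sup>d\<close>, encoded like \<^const>\<open>Euclidean_space\<close>.\<close>

definition complex_space :: "nat \<Rightarrow> (nat \<Rightarrow> complex) topology" where
  "complex_space d =
     subtopology (product_topology (\<lambda>i. euclidean) UNIV) {v. \<forall>i\<ge>d. v i = 0}"

definition product_bundle :: "'x topology \<Rightarrow> nat \<Rightarrow> ('x, 'x \<times> (nat \<Rightarrow> complex)) vbundle" where
  "product_bundle X d =
     \<lparr>total_space = prod_topology X (complex_space d),
      proj = fst,
      fibre = (\<lambda>x. \<lparr>carrier = {x} \<times> topspace (complex_space d),
                    mult = undefined, one = undefined,
                    zero = (x, \<lambda>i. 0),
                    add = (\<lambda>(y, v) (z, w). (x, \<lambda>i. v i + w i)),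
                    smult = (\<lambda>a (y, v). (x, \<lambda>i. a * v i))\<rparr>)\<rparr>"

definition restrict_bundle :: "('x, 'e) vbundle \<Rightarrow> 'x set \<Rightarrow> ('x, 'e) vbundle" where
  "restrict_bundle \<xi> U = \<xi>\<lparr>total_space := subtopology (total_space \<xi>) (proj \<xi> -` U)\<rparr>"

definition vector_bundle :: "'x topology \<Rightarrow> ('x, 'e) vbundle \<Rightarrow> bool" where
  "vector_bundle X \<xi> \<longleftrightarrow>
     continuous_map (total_space \<xi>) X (proj \<xi>) \<and>
     (\<forall>x\<in>topspace X.
        Module.module complex_ring (fibre \<xi> x) \<and>
        carrier (fibre \<xi> x) = {e \<in> topspace (total_space \<xi>). proj \<xi> e = x}) \<and>
     (\<forall>x\<in>topspace X. \<exists>U k h. openin X U \<and> x \<in> U \<and>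
        bundle_iso (subtopology X U) (restrict_bundle \<xi> U)
          (product_bundle (subtopology X U) k) h)"

definition trivial_bundle :: "'x topology \<Rightarrow> nat \<Rightarrow> ('x, 'e) vbundle \<Rightarrow> bool" where
  "trivial_bundle X d \<xi> \<longleftrightarrow> vector_bundle X \<xi> \<and> (\<exists>h. bundle_iso X \<xi> (product_bundle X d) h)"


section \<open>Equivariant bundles\<close>

definition equivariant_vector_bundle ::
    "('g, 'z) monoid_scheme \<Rightarrow> 'x topology \<Rightarrow> ('g \<Rightarrow> 'x \<Rightarrow> 'x) \<Rightarrow>
     ('x, 'e) vbundle \<Rightarrow> ('g \<Rightarrow> 'e \<Rightarrow> 'e) \<Rightarrow> bool" where
  "equivariant_vector_bundle G X \<phi> \<xi> \<psi> \<longleftrightarrow>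
     vector_bundle X \<xi> \<and> continuous_action G (total_space \<xi>) \<psi> \<and>
     (\<forall>g\<in>carrier G. \<forall>e\<in>topspace (total_space \<xi>). proj \<xi> (\<psi> g e) = \<phi> g (proj \<xi> e)) \<and>
     (\<forall>g\<in>carrier G. \<forall>x\<in>topspace X.
        linear_between (fibre \<xi> x) (fibre \<xi> (\<phi> g x)) (\<psi> g) \<and>
        \<psi> g ` carrier (fibre \<xi> x) = carrier (fibre \<xi> (\<phi> g x)))"

definition equivariant ::
    "('g, 'z) monoid_scheme \<Rightarrow> 'a topology \<Rightarrow> ('g \<Rightarrow> 'a \<Rightarrow> 'a) \<Rightarrow> ('g \<Rightarrow> 'b \<Rightarrow> 'b) \<Rightarrow>
     ('a \<Rightarrow> 'b) \<Rightarrow> bool" where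
  "equivariant G T \<alpha> \<beta> u \<longleftrightarrow> (\<forall>g\<in>carrier G. \<forall>e\<in>topspace T. u (\<alpha> g e) = \<beta> g (u e))"

text \<open>
  The action \<open>g (x, v) = (g x, v)\<close>. It is restricted to the total space because
  \<^const>\<open>group_action\<close> requires maps that are extensional.
\<close>

definition product_action ::
    "'x topology \<Rightarrow> nat \<Rightarrow> ('g \<Rightarrow> 'x \<Rightarrow> 'x) \<Rightarrow>
     'g \<Rightarrow> 'x \<times> (nat \<Rightarrow> complex) \<Rightarrow> 'x \<times> (nat \<Rightarrow> complex)" where
  "product_action X r \<phi> g =
     restrict (\<lambda>(x, v). (\<phi> g x, v)) (topspace (total_space (product_bundle X r)))"

end

theory Submission
  imports Defs
begin

text \<open>
  A trivialization turns \<open>\<xi>\<close> into a family of linear maps \<open>a g x\<close> of \<open>\<complex>\<^sup>d\<close>, and \<open>u\<^sub>0\<close>, \<open>u\<^sub>1\<close> into pointwise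
  independent \<open>r\<close>-tuples of equivariant sections. The columns are treated one at a time. When all
  columns but the last agree and span \<open>F\<close>, the last ones, \<open>b\<^sub>0\<close> and \<open>b\<^sub>1\<close>, are compared with an equivariant
  section \<open>w\<close> such that \<open>w(x)\<close> lies neither in \<open>F\<^sub>x + \<real> b\<^sub>0(x)\<close> nor in \<open>F\<^sub>x + \<real> b\<^sub>1(x)\<close>. These real
  subspaces have codimension \<open>2 (d - r) + 1 > n\<close>, so \<open>w\<close> exists by general position: since isotropy
  groups act trivially on fibres, there are local equivariant frames, in which the coordinates of a
  section transverse to such a subspace are invariant functions; these can be approximated by
  invariant locally Lipschitz functions, and a locally Lipschitz map from an \<open>n\<close>-manifold to more
  than \<open>n\<close> coordinates misses values close to \<open>0\<close>.
  A Baire category argument passes from small compact sets to \<open>X\<close>. Since \<open>w\<close> is not in \<open>F + \<real> b\<^sub>i\<close>, there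
  are equivariant functionals \<open>l\<close> that vanish on \<open>F\<close> with \<open>Re l(b\<^sub>i) > 0\<close> and \<open>Re l(w) > 0\<close>, and
  \<open>v \<mapsto> v + l(v) / l(b\<^sub>i) (w - b\<^sub>i)\<close> is an equivariant automorphism that fixes \<open>F\<close> and maps \<open>b\<^sub>i\<close> to \<open>w\<close>.
\<close>

section \<open>Locally Lipschitz functions on a manifold with a finite group action\<close>

text \<open>The transvection from \<open>b\<close> to \<open>w\<close> needs a functional that
  vanishes on \<open>F\<close> and has positive real part on both. Modulo \<open>F\<close> this is
  impossible exactly when \<open>w\<close> is a nonpositive real multiple of \<open>b\<close>. That
  may happen for \<open>b\<^sub>0\<close> and \<open>b\<^sub>1\<close> themselves, so the
  construction cannot in general connect them directly and a third section comes in between.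
  Avoiding the whole real line instead of the half-line makes the obstruction linear, with the same
  codimension. Over \<open>r - 1\<close> columns, \<open>F + \<real> b\<close> has real dimension
  \<open>2 (r - 1) + 1\<close> in a fibre of real dimension \<open>2 d\<close>;
  \<open>d \<ge> n/2 + r\<close> says that the remaining coordinates outnumber the dimension of
  \<open>X\<close>. The obstacle is equivariance: the orbit space need not be a manifold, and
  perturbed sections must stay equivariant. Trivial isotropy actions resolve this: changing the
  coordinates in an equivariant frame by invariant functions preserves equivariance, so the
  dimension count takes place on \<open>X\<close> itself. Lipschitz regularity survives averaging
  over \<open>G\<close> and reduces the count to a pigeonhole argument.\<close>

lemma openin_Euclidean_space_box:
  assumes "openin (Euclidean_space n) S" "x \<in> S"
  obtains \<rho> where "\<rho> > 0"
    "\<And>y. \<lbrakk>y \<in> topspace (Euclidean_space n); \<And>i. i < n \<Longrightarrow> \<bar>y i - x i\<bar> < \<rho>\<rbrakk> \<Longrightarrow> y \<in> S"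
proof -
  obtain T where T: "openin (powertop_real UNIV) T" "S = T \<inter> {x. \<forall>i\<ge>n. x i = 0}"
    using assms(1) unfolding Euclidean_space_def openin_subtopology by blast
  then obtain U where U: "\<And>i. open (U i)" "x \<in> Pi\<^sub>E UNIV U" "Pi\<^sub>E UNIV U \<subseteq> T"
  proof -
    have "x \<in> T" using assms(2) T(2) by blast
    then obtain U where "\<forall>i\<in>UNIV. openin euclideanreal (U i)" "x \<in> Pi\<^sub>E UNIV U" "Pi\<^sub>E UNIV U \<subseteq> T"
      using T(1) unfolding openin_product_topology_alt by blast
    then show ?thesis using that[of U] by simp
  qed
  have "\<exists>e>0. \<forall>t. \<bar>t - x i\<bar> < e \<longrightarrow> t \<in> U i" for i
    using U(1)[of i] U(2) by (auto simp: open_real PiE_iff)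
  then obtain e where e: "\<And>i. e i > 0" "\<And>i t. \<bar>t - x i\<bar> < e i \<Longrightarrow> t \<in> U i"
    by metis
  \<comment> \<open>Coordinates from \<open>n\<close> on are 0 for both points, so only finitely
    many radii count. \<open>insert 1\<close> keeps the minimum defined for
    \<open>n = 0\<close>.\<close>
  define \<rho> where "\<rho> = Min (insert 1 (e ` {..<n}))"
  have "\<rho> > 0" "\<And>i. i < n \<Longrightarrow> \<rho> \<le> e i"
    unfolding \<rho>_def using e(1) by auto
  moreover have "y \<in> S"
    if y: "y \<in> topspace (Euclidean_space n)" "\<And>i. i < n \<Longrightarrow> \<bar>y i - x i\<bar> < \<rho>" for y
  proof -
    have "y i \<in> U i" for i
    proof (cases "i < n")
      case True
      then show ?thesis using y(2)[of i] e(2)[of "y i" i] \<open>\<And>i. i < n \<Longrightarrow> \<rho> \<le> e i\<close>[of i] by linarith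
    next
      case False
      then have "y i = x i"
        using y(1) assms(2) T(2) by (auto simp: topspace_Euclidean_space)
      then show ?thesis using e(2)[of "y i" i] e(1) by simp
    qed
    then have "y \<in> T" using U(3) by (auto simp: PiE_iff)
    then show ?thesis using y(1) T(2) by (auto simp: topspace_Euclidean_space)
  qed
  ultimately show ?thesis using that by blast
qed

text \<open>The l1 distance is what the mean value theorem yields when one coordinate changes at a
  time.\<close>

abbreviation coord_dist :: "nat \<Rightarrow> (nat \<Rightarrow> real) \<Rightarrow> (nat \<Rightarrow> real) \<Rightarrow> real" where
  "coord_dist n y z \<equiv> \<Sum>i<n. \<bar>y i - z i\<bar>"

text \<open>The mean value theorem is applied along a staircase from \<open>y\<close> to
  \<open>z\<close>; its corners stay in the box because a box is a product of intervals.\<close>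

lemma bounded_derivs_Lipschitz_box:
  assumes xE: "x \<in> topspace (Euclidean_space n)"
    and box: "\<And>y. \<lbrakk>y \<in> topspace (Euclidean_space n); \<And>i. i < n \<Longrightarrow> \<bar>y i - x i\<bar> < \<rho>\<rbrakk> \<Longrightarrow> y \<in> U"
    and der: "\<And>i y. \<lbrakk>i < n; y \<in> U\<rbrakk> \<Longrightarrow>
      ((\<lambda>t. f (y(i := t))) has_real_derivative f' i y) (at (y i))"
    and bd: "\<And>i y. \<lbrakk>i < n; y \<in> topspace (Euclidean_space n); \<And>i. i < n \<Longrightarrow> \<bar>y i - x i\<bar> < \<rho>\<rbrakk> \<Longrightarrow> \<bar>f' i y\<bar> \<le> B"
    and y: "y \<in> topspace (Euclidean_space n)" "\<And>i. i < n \<Longrightarrow> \<bar>y i - x i\<bar> < \<rho>"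
    and z: "z \<in> topspace (Euclidean_space n)" "\<And>i. i < n \<Longrightarrow> \<bar>z i - x i\<bar> < \<rho>"
  shows "\<bar>f y - f z\<bar> \<le> B * coord_dist n y z"
proof -
  define h where "h k = (\<lambda>i. if i < k then z i else y i)" for k
  have step: "\<bar>f (h k) - f (h (Suc k))\<bar> \<le> B * \<bar>y k - z k\<bar>" if k: "k < n" for k
  proof -
    define S where "S = {t. \<bar>t - x k\<bar> < \<rho>}"
    have S: "S = ball (x k) \<rho>" by (auto simp: S_def dist_real_def)
    define F where "F = (\<lambda>t. f ((h k)(k := t)))"
    have hk: "(h k)(k := t) \<in> topspace (Euclidean_space n)"
      "\<And>i. i < n \<Longrightarrow> \<bar>((h k)(k := t)) i - x i\<bar> < \<rho>" if "t \<in> S" for t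
      using that y z k by (auto simp: h_def topspace_Euclidean_space S_def)
    have "(F has_real_derivative f' k ((h k)(k := t))) (at t within S)" if "t \<in> S" for t
    proof -
      have "(h k)(k := t) \<in> U" using box hk[OF that] by blast
      from der[OF k this] show ?thesis
        by (simp add: F_def has_field_derivative_at_within)
    qed
    moreover have "\<bar>f' k ((h k)(k := t))\<bar> \<le> B" if "t \<in> S" for t
      using bd[OF k hk(1) hk(2)] that by blast
    ultimately have "norm (F (y k) - F (z k)) \<le> B * norm (y k - z k)"
      by (intro field_differentiable_bound[where S = S and f' = "\<lambda>t. f' k ((h k)(k := t))"])
        (use y z k in \<open>auto simp: S dist_real_def abs_minus_commute\<close>)
    moreover have "(h k)(k := y k) = h k" "(h k)(k := z k) = h (Suc k)"
      by (auto simp: h_def fun_eq_iff less_Suc_eq)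
    ultimately show ?thesis by (simp add: F_def)
  qed
  have "\<bar>f (h 0) - f (h k)\<bar> \<le> B * (\<Sum>i<k. \<bar>y i - z i\<bar>)" if "k \<le> n" for k
    using that
  proof (induction k)
    case (Suc k)
    then show ?case using step[of k] by (auto simp: distrib_left)
  qed simp
  moreover have "h 0 = y" "h n = z"
    using y z by (auto simp: h_def topspace_Euclidean_space fun_eq_iff)
  ultimately show ?thesis by (metis le_refl)
qed

text \<open>Continuous partial derivatives stay within 1 of their values at \<open>x\<close> on a
  neighbourhood, and this contains a box on which the mean value estimate applies.\<close>

lemma Ck_on_locally_Lipschitz:
  assumes U: "openin (Euclidean_space n) U" and x: "x \<in> U" and f: "Ck_on n (Suc 0) U f"
  obtains \<rho> L where "\<rho> > 0" "L \<ge> 0"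
    "\<And>y z. \<lbrakk>y \<in> topspace (Euclidean_space n); \<And>i. i < n \<Longrightarrow> \<bar>y i - x i\<bar> < \<rho>;
      z \<in> topspace (Euclidean_space n); \<And>i. i < n \<Longrightarrow> \<bar>z i - x i\<bar> < \<rho>\<rbrakk>
     \<Longrightarrow> \<bar>f y - f z\<bar> \<le> L * coord_dist n y z"
proof -
  obtain f' where f': "\<And>i y. \<lbrakk>i < n; y \<in> U\<rbrakk> \<Longrightarrow>
      ((\<lambda>t. f (y(i := t))) has_real_derivative f' i y) (at (y i))"
    and cont: "\<And>i. i < n \<Longrightarrow> continuous_map (subtopology (Euclidean_space n) U) euclideanreal (f' i)"
    using f by auto
  have UE: "U \<subseteq> topspace (Euclidean_space n)" using U openin_subset by blast
  define V where "V = {y \<in> U. \<forall>i<n. \<bar>f' i y - f' i x\<bar> < 1}"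
  have "openin (subtopology (Euclidean_space n) U)
      {y \<in> topspace (subtopology (Euclidean_space n) U). f' i y \<in> ball (f' i x) 1}" if "i < n" for i
    by (rule openin_continuous_map_preimage[OF cont[OF that]]) auto
  moreover have "{y \<in> topspace (subtopology (Euclidean_space n) U). f' i y \<in> ball (f' i x) 1}
     = {y \<in> U. \<bar>f' i y - f' i x\<bar> < 1}" for i
    using UE by (auto simp: dist_real_def abs_minus_commute)
  ultimately have "openin (Euclidean_space n) {y \<in> U. \<bar>f' i y - f' i x\<bar> < 1}" if "i < n" for i
    using that U by (metis (no_types, lifting) openin_trans_full)
  then have "openin (Euclidean_space n) (U \<inter> (\<Inter>i\<in>{..<n}. {y \<in> U. \<bar>f' i y - f' i x\<bar> < 1}))"
    using U by (cases "n = 0") (auto intro!: openin_Int openin_INT2)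
  moreover have "U \<inter> (\<Inter>i\<in>{..<n}. {y \<in> U. \<bar>f' i y - f' i x\<bar> < 1}) = V"
    by (auto simp: V_def)
  ultimately have "openin (Euclidean_space n) V" by simp
  moreover have "x \<in> V" using x by (simp add: V_def)
  ultimately obtain \<rho> where \<rho>: "\<rho> > 0"
    "\<And>y. \<lbrakk>y \<in> topspace (Euclidean_space n); \<And>i. i < n \<Longrightarrow> \<bar>y i - x i\<bar> < \<rho>\<rbrakk> \<Longrightarrow> y \<in> V"
    using openin_Euclidean_space_box by blast
  define B where "B = (\<Sum>i<n. \<bar>f' i x\<bar>) + 1"
  have B: "\<bar>f' i y\<bar> \<le> B" if "i < n" "y \<in> V" for i y
  proof -
    have "\<bar>f' i x\<bar> \<le> (\<Sum>i<n. \<bar>f' i x\<bar>)" using that by (intro member_le_sum) auto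
    moreover have "\<bar>f' i y - f' i x\<bar> < 1" using that by (auto simp: V_def)
    ultimately show ?thesis unfolding B_def by linarith
  qed
  have "B \<ge> 0" unfolding B_def by (simp add: add_nonneg_nonneg sum_nonneg)
  have "\<bar>f y - f z\<bar> \<le> B * coord_dist n y z"
    if "y \<in> topspace (Euclidean_space n)" "\<And>i. i < n \<Longrightarrow> \<bar>y i - x i\<bar> < \<rho>"
      "z \<in> topspace (Euclidean_space n)" "\<And>i. i < n \<Longrightarrow> \<bar>z i - x i\<bar> < \<rho>" for y z
  proof (rule bounded_derivs_Lipschitz_box[where U = U and f' = f' and \<rho> = \<rho> and x = x])
    show "x \<in> topspace (Euclidean_space n)" using x UE by blast
    show "y \<in> U" if "y \<in> topspace (Euclidean_space n)" "\<And>i. i < n \<Longrightarrow> \<bar>y i - x i\<bar> < \<rho>" for y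
      using \<rho>(2)[of y] that by (auto simp: V_def)
    show "\<bar>f' i y\<bar> \<le> B" if "i < n" "y \<in> topspace (Euclidean_space n)" "\<And>i. i < n \<Longrightarrow> \<bar>y i - x i\<bar> < \<rho>" for i y
      using B[of i y] \<rho>(2)[of y] that by blast
  qed (fact that f')+
  with \<open>\<rho> > 0\<close> \<open>B \<ge> 0\<close> show ?thesis using that by blast
qed

section \<open>Charts, coordinate boxes and the coordinate estimate for smooth maps\<close>

locale smooth_G_manifold =
  fixes G :: "('g, 'z) monoid_scheme" (structure)
    and n :: nat and X :: "'x topology" and A :: "'x chart set" and \<phi> :: "'g \<Rightarrow> 'x \<Rightarrow> 'x"
  assumes manifold: "smooth_manifold n X A"
    and grp: "group G" and fin: "finite (carrier G)"
    and smooth_act: "smooth_action G n X A \<phi>"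
begin

sublocale group G by (rule grp)

sublocale group_action G "topspace X" \<phi>
  using smooth_act by (simp add: smooth_action_def)

lemma Hausdorff: "Hausdorff_space X" and second_countable_X: "second_countable X"
  and atlas: "smooth_atlas n X A"
  using manifold by (auto simp: smooth_manifold_def)

lemma chart_at:
  assumes "x \<in> topspace X"
  obtains U c where "(U, c) \<in> A" "x \<in> U"
proof -
  have "x \<in> (\<Union>C\<in>A. fst C)" using assms atlas unfolding smooth_atlas_def by blast
  then obtain C where "C \<in> A" "x \<in> fst C" by blast
  then show ?thesis using that[of "fst C" "snd C"] by simp
qed

lemma chartD:
  assumes "(U, c) \<in> A"
  shows chart_open: "openin X U" and chart_image_open: "openin (Euclidean_space n) (c ` U)"
    and chart_homeo: "homeomorphic_map (subtopology X U) (subtopology (Euclidean_space n) (c ` U)) c"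
  using assms atlas unfolding smooth_atlas_def is_chart_def by auto

lemma chart_in_topspace: "\<lbrakk>(U, c) \<in> A; y \<in> U\<rbrakk> \<Longrightarrow> y \<in> topspace X"
  using chart_open openin_subset by blast

lemma chart_image: "\<lbrakk>(U, c) \<in> A; y \<in> U\<rbrakk> \<Longrightarrow> c y \<in> topspace (Euclidean_space n)"
  using chart_image_open openin_subset by blast

lemma chart_inj: "(U, c) \<in> A \<Longrightarrow> inj_on c U"
  using homeomorphic_imp_injective_map[OF chart_homeo] chart_open
  by (metis openin_subset topspace_subtopology_subset)

lemma chart_open_image:
  assumes "(U, c) \<in> A" "openin X W" "W \<subseteq> U"
  shows "openin (Euclidean_space n) (c ` W)"
proof -
  have "openin (subtopology X U) W"
    using assms by (simp add: chart_open openin_open_subtopology)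
  then have "openin (subtopology (Euclidean_space n) (c ` U)) (c ` W)"
    using homeomorphic_imp_open_map[OF chart_homeo[OF assms(1)]] by (auto simp: open_map_def)
  then show ?thesis
    using chart_image_open[OF assms(1)] openin_trans_full by blast
qed

lemma chart_coordinate_continuous:
  assumes "(U, c) \<in> A"
  shows "continuous_map (subtopology X U) euclideanreal (\<lambda>y. c y i)"
proof -
  have "continuous_map (subtopology X U) (subtopology (Euclidean_space n) (c ` U)) c"
    using homeomorphic_imp_continuous_map[OF chart_homeo[OF assms]] .
  then have "continuous_map (subtopology X U) (powertop_real UNIV) c"
    by (auto simp: Euclidean_space_def continuous_map_in_subtopology)
  then show ?thesis by (simp add: continuous_map_componentwise_UNIV)
qed

lemma chart_box_subset:
  assumes "(U, c) \<in> A" "x \<in> U" "openin X W" "x \<in> W"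
  obtains \<rho> where "\<rho> > 0" "\<And>y. \<lbrakk>y \<in> U; \<And>i. i < n \<Longrightarrow> \<bar>c y i - c x i\<bar> < \<rho>\<rbrakk> \<Longrightarrow> y \<in> W"
proof -
  have "openin X (W \<inter> U)" using assms chart_open by blast
  then have "openin (Euclidean_space n) (c ` (W \<inter> U))"
    using chart_open_image[OF assms(1)] by blast
  moreover have "c x \<in> c ` (W \<inter> U)" using assms by blast
  ultimately obtain \<rho> where \<rho>: "\<rho> > 0" "\<And>y. \<lbrakk>y \<in> topspace (Euclidean_space n);
      \<And>i. i < n \<Longrightarrow> \<bar>y i - c x i\<bar> < \<rho>\<rbrakk> \<Longrightarrow> y \<in> c ` (W \<inter> U)"
    using openin_Euclidean_space_box by blast
  have "y \<in> W" if y: "y \<in> U" "\<And>i. i < n \<Longrightarrow> \<bar>c y i - c x i\<bar> < \<rho>" for y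
  proof -
    have "c y \<in> c ` (W \<inter> U)"
      using \<rho>(2)[of "c y"] y chart_image[OF assms(1)] by blast
    then show ?thesis using chart_inj[OF assms(1)] y(1) by (auto dest: inj_onD)
  qed
  with \<rho>(1) show ?thesis using that by blast
qed

lemma chart_box_open:
  assumes "(U, c) \<in> A"
  shows "openin X {y \<in> U. \<forall>i<n. \<bar>c y i - a i\<bar> < \<rho>}"
proof -
  have "openin (subtopology X U) {y \<in> topspace (subtopology X U). c y i \<in> ball (a i) \<rho>}" for i
    by (rule openin_continuous_map_preimage[OF chart_coordinate_continuous[OF assms]]) simp
  then have *: "openin X {y \<in> topspace (subtopology X U). c y i \<in> ball (a i) \<rho>}" for i
    using chart_open[OF assms] openin_trans_full by blast
  have "openin X (U \<inter> (\<Inter>i\<in>{..<n}. {y \<in> topspace (subtopology X U). c y i \<in> ball (a i) \<rho>}))"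
    using chart_open[OF assms] * by (cases "n = 0") (auto intro!: openin_Int openin_INT2)
  also have "U \<inter> (\<Inter>i\<in>{..<n}. {y \<in> topspace (subtopology X U). c y i \<in> ball (a i) \<rho>})
     = {y \<in> U. \<forall>i<n. \<bar>c y i - a i\<bar> < \<rho>}"
    using chart_in_topspace[OF assms] by (auto simp: dist_real_def abs_minus_commute)
  finally show ?thesis .
qed

text \<open>Tychonoff: the box is a product of compact intervals for the indices below
  \<open>n\<close> and of \<open>{0}\<close> for the others.\<close>

lemma compactin_closed_box:
  assumes "a \<in> topspace (Euclidean_space n)"
  shows "compactin (Euclidean_space n) {y \<in> topspace (Euclidean_space n). \<forall>i<n. \<bar>y i - a i\<bar> \<le> \<rho>}"
proof -
  have "compactin (powertop_real UNIV) (Pi\<^sub>E UNIV (\<lambda>i. if i < n then cball (a i) \<rho> else {0}))"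
    by (subst compactin_PiE) (auto)
  moreover have "Pi\<^sub>E UNIV (\<lambda>i. if i < n then cball (a i) \<rho> else {0})
     = {y \<in> topspace (Euclidean_space n). \<forall>i<n. \<bar>y i - a i\<bar> \<le> \<rho>}"
    by (auto simp: topspace_Euclidean_space PiE_iff dist_real_def abs_minus_commute split: if_splits)
  ultimately show ?thesis
    by (auto simp: Euclidean_space_def compactin_subtopology topspace_Euclidean_space)
qed

lemma chart_compact_box:
  assumes A: "(U, c) \<in> A" and "x \<in> U" "openin X W" "x \<in> W"
  obtains \<rho> where "\<rho> > 0" "compactin X {y \<in> U. \<forall>i<n. \<bar>c y i - c x i\<bar> \<le> \<rho>}"
    "{y \<in> U. \<forall>i<n. \<bar>c y i - c x i\<bar> \<le> \<rho>} \<subseteq> W"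
proof -
  obtain \<rho> where \<rho>: "\<rho> > 0" "\<And>y. \<lbrakk>y \<in> U; \<And>i. i < n \<Longrightarrow> \<bar>c y i - c x i\<bar> < \<rho>\<rbrakk> \<Longrightarrow> y \<in> W"
    using chart_box_subset assms by blast
  obtain \<sigma> where \<sigma>: "\<sigma> > 0" "\<And>y. \<lbrakk>y \<in> topspace (Euclidean_space n);
      \<And>i. i < n \<Longrightarrow> \<bar>y i - c x i\<bar> < \<sigma>\<rbrakk> \<Longrightarrow> y \<in> c ` U"
    using openin_Euclidean_space_box[OF chart_image_open[OF A], of "c x"] assms(2) by blast
  \<comment> \<open>Halving puts the closed box inside both open boxes: inside the image of the
    chart, so that the compact box in coordinates is hit completely, and over
    \<open>W\<close>.\<close>
  define \<tau> where "\<tau> = min \<rho> \<sigma> / 2"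
  have \<tau>: "\<tau> > 0" "\<tau> < \<rho>" "\<tau> < \<sigma>" using \<rho>(1) \<sigma>(1) by (auto simp: \<tau>_def)
  define B where "B = {y \<in> U. \<forall>i<n. \<bar>c y i - c x i\<bar> \<le> \<tau>}"
  have "y \<in> c ` U" if "y \<in> topspace (Euclidean_space n)" "\<forall>i<n. \<bar>y i - c x i\<bar> \<le> \<tau>" for y
    by (rule \<sigma>(2)) (use that \<tau> in \<open>fastforce\<close>)+
  then have cB: "c ` B = {y \<in> topspace (Euclidean_space n). \<forall>i<n. \<bar>y i - c x i\<bar> \<le> \<tau>}"
    using chart_image[OF A] by (auto simp: B_def)
  have "compactin (Euclidean_space n) (c ` B)"
    unfolding cB by (rule compactin_closed_box) (use chart_image[OF A] assms(2) in blast)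
  then have "compactin (subtopology (Euclidean_space n) (c ` U)) (c ` B)"
    by (auto simp: compactin_subtopology B_def)
  then have "compactin (subtopology X U) B"
    using homeomorphic_map_compactness[OF chart_homeo[OF A], of B] chart_in_topspace[OF A]
    by (auto simp: B_def)
  then have "compactin X B" by (simp add: compactin_subtopology)
  moreover have "B \<subseteq> W" using \<rho>(2) \<tau> unfolding B_def by force
  ultimately show ?thesis using that[OF \<tau>(1)] by (simp add: B_def)
qed

text \<open>Each of the \<open>n\<close> coordinates of the representation of \<open>f\<close> is
  Lipschitz on a box of its own; the smallest box and the sum of the constants serve all of
  them.\<close>

lemma smooth_map_locally_Lipschitz:
  assumes C: "(U, c) \<in> A" and D: "(V, e) \<in> A"
    and cont: "continuous_map X X f" and sm: "smooth_in_charts n n (U, c) (V, e) f"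
    and x: "x \<in> U" "f x \<in> V"
  obtains W L where "openin X W" "x \<in> W" "W \<subseteq> U" "f ` W \<subseteq> V" "L \<ge> 0"
    "\<And>y z j. \<lbrakk>y \<in> W; z \<in> W; j < n\<rbrakk> \<Longrightarrow> \<bar>e (f y) j - e (f z) j\<bar> \<le> L * coord_dist n (c y) (c z)"
proof -
  define S where "S = U \<inter> f -` V"
  have "openin X {y \<in> topspace X. f y \<in> V}"
    using openin_continuous_map_preimage[OF cont chart_open[OF D]] .
  moreover have "S = U \<inter> {y \<in> topspace X. f y \<in> V}"
    using chart_in_topspace[OF C] by (auto simp: S_def)
  ultimately have S: "openin X S" using chart_open[OF C] by auto
  have cS: "openin (Euclidean_space n) (c ` S)"
    using chart_open_image[OF C S] by (auto simp: S_def)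
  have xS: "x \<in> S" using x by (simp add: S_def)
  define F where "F j z = e (f (inv_into U c z)) j" for j z
  have F: "F j (c y) = e (f y) j" if "y \<in> S" for j y
    using that chart_inj[OF C] by (simp add: F_def S_def)
  have "\<forall>j. \<exists>\<rho> L. j < n \<longrightarrow> \<rho> > 0 \<and> L \<ge> 0 \<and>
    (\<forall>y z. y \<in> topspace (Euclidean_space n) \<and> (\<forall>i<n. \<bar>y i - c x i\<bar> < \<rho>) \<and>
      z \<in> topspace (Euclidean_space n) \<and> (\<forall>i<n. \<bar>z i - c x i\<bar> < \<rho>)
     \<longrightarrow> \<bar>F j y - F j z\<bar> \<le> L * coord_dist n y z)" (is "\<forall>j. ?P j")
  proof
    fix j
    show "?P j"
    proof (cases "j < n")
      case True
      have "smooth_on n n (c ` S) (\<lambda>z. e (f (inv_into U c z)))"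
        using sm unfolding smooth_in_charts_def S_def by simp
      then have "Ck_on n (Suc 0) (c ` S) (F j)"
        using True unfolding smooth_on_def F_def[abs_def] by blast
      then obtain \<rho> L where "\<rho> > 0" "L \<ge> 0"
        "\<And>y z. \<lbrakk>y \<in> topspace (Euclidean_space n); \<And>i. i < n \<Longrightarrow> \<bar>y i - c x i\<bar> < \<rho>;
          z \<in> topspace (Euclidean_space n); \<And>i. i < n \<Longrightarrow> \<bar>z i - c x i\<bar> < \<rho>\<rbrakk>
         \<Longrightarrow> \<bar>F j y - F j z\<bar> \<le> L * coord_dist n y z"
        using Ck_on_locally_Lipschitz[OF cS imageI[OF xS]] by blast
      then show ?thesis by (intro exI[of _ \<rho>] exI[of _ L]) simp
    qed auto
  qed
  then obtain \<rho> L where "\<forall>j. j < n \<longrightarrow> \<rho> j > 0 \<and> L j \<ge> 0 \<and>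
    (\<forall>y z. y \<in> topspace (Euclidean_space n) \<and> (\<forall>i<n. \<bar>y i - c x i\<bar> < \<rho> j) \<and>
      z \<in> topspace (Euclidean_space n) \<and> (\<forall>i<n. \<bar>z i - c x i\<bar> < \<rho> j)
     \<longrightarrow> \<bar>F j y - F j z\<bar> \<le> L j * coord_dist n y z)"
    unfolding choice_iff by blast
  then have \<rho>: "\<And>j. j < n \<Longrightarrow> \<rho> j > 0" and L: "\<And>j. j < n \<Longrightarrow> L j \<ge> 0" and
    est: "\<And>j y z. \<lbrakk>j < n; y \<in> topspace (Euclidean_space n); \<forall>i<n. \<bar>y i - c x i\<bar> < \<rho> j;
      z \<in> topspace (Euclidean_space n); \<forall>i<n. \<bar>z i - c x i\<bar> < \<rho> j\<rbrakk>
     \<Longrightarrow> \<bar>F j y - F j z\<bar> \<le> L j * coord_dist n y z"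
    by blast+
  define \<sigma> where "\<sigma> = Min (insert 1 (\<rho> ` {..<n}))"
  have \<sigma>: "\<sigma> > 0" "\<And>i. i < n \<Longrightarrow> \<sigma> \<le> \<rho> i"
    unfolding \<sigma>_def using \<rho> by auto
  define W where "W = S \<inter> {y \<in> U. \<forall>i<n. \<bar>c y i - c x i\<bar> < \<sigma>}"
  define M where "M = (\<Sum>j<n. L j)"
  have M: "L j \<le> M" if "j < n" for j
    unfolding M_def using that L by (intro member_le_sum) auto
  show ?thesis
  proof (rule that[of W M])
    show "openin X W" unfolding W_def using S chart_box_open[OF C] by blast
    show "x \<in> W" using xS x \<sigma>(1) by (simp add: W_def)
    show "W \<subseteq> U" "f ` W \<subseteq> V" by (auto simp: W_def S_def)
    show "0 \<le> M" unfolding M_def using L by (auto intro: sum_nonneg)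
    fix y z j assume yz: "y \<in> W" "z \<in> W" and j: "j < n"
    have "\<bar>F j (c y) - F j (c z)\<bar> \<le> L j * coord_dist n (c y) (c z)"
      by (rule est[OF j]) (use yz chart_image[OF C] \<sigma>(2)[OF j] in \<open>force simp: W_def\<close>)+
    also have "\<dots> \<le> M * coord_dist n (c y) (c z)"
      by (intro mult_right_mono M j) (auto intro: sum_nonneg)
    finally show "\<bar>e (f y) j - e (f z) j\<bar> \<le> M * coord_dist n (c y) (c z)"
      using F yz by (simp add: W_def)
  qed
qed

lemma act_continuous: "g \<in> carrier G \<Longrightarrow> continuous_map X X (\<phi> g)"
  using smooth_act by (auto simp: smooth_action_def smooth_map_def)

lemma act_in: "\<lbrakk>g \<in> carrier G; x \<in> topspace X\<rbrakk> \<Longrightarrow> \<phi> g x \<in> topspace X"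
  using act_continuous continuous_map_image_subset_topspace by (metis element_image)

end

section \<open>Calculus of locally Lipschitz functions and bump functions\<close>

lemma max_diff_le: "\<bar>max a u - max a v\<bar> \<le> \<bar>u - v\<bar>" for u v :: real
  by (auto simp: max_def)

context smooth_G_manifold
begin

text \<open>The estimate concerns all pairs of points near \<open>x\<close>, not only pairs that
  contain \<open>x\<close>. It is required in every chart around \<open>x\<close>, so that a proof
  may pick any chart; a function built in one chart has to be transported by transition
  maps.\<close>

definition Lipschitz_at :: "('x \<Rightarrow> real) \<Rightarrow> 'x \<Rightarrow> bool" where
  "Lipschitz_at p x \<longleftrightarrow> (\<forall>(U, c)\<in>A. x \<in> U \<longrightarrow>
     (\<exists>W L. openin X W \<and> x \<in> W \<and> W \<subseteq> U \<and>
       (\<forall>y\<in>W. \<forall>z\<in>W. \<bar>p y - p z\<bar> \<le> L * coord_dist n (c y) (c z))))"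

lemma Lipschitz_atI:
  assumes "\<And>U c. \<lbrakk>(U, c) \<in> A; x \<in> U\<rbrakk> \<Longrightarrow> \<exists>W L. openin X W \<and> x \<in> W \<and> W \<subseteq> U \<and>
       (\<forall>y\<in>W. \<forall>z\<in>W. \<bar>p y - p z\<bar> \<le> L * coord_dist n (c y) (c z))"
  shows "Lipschitz_at p x"
  using assms unfolding Lipschitz_at_def by auto

lemma Lipschitz_atE:
  assumes "Lipschitz_at p x" "(U, c) \<in> A" "x \<in> U"
  obtains W L where "openin X W" "x \<in> W" "W \<subseteq> U" "L \<ge> 0"
    "\<And>y z. \<lbrakk>y \<in> W; z \<in> W\<rbrakk> \<Longrightarrow> \<bar>p y - p z\<bar> \<le> L * coord_dist n (c y) (c z)"
proof -
  have "\<exists>W L. openin X W \<and> x \<in> W \<and> W \<subseteq> U \<and>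
       (\<forall>y\<in>W. \<forall>z\<in>W. \<bar>p y - p z\<bar> \<le> L * coord_dist n (c y) (c z))"
    using assms(1)[unfolded Lipschitz_at_def, THEN bspec, OF assms(2)] assms(3) by simp
  then obtain W L where W: "openin X W" "x \<in> W" "W \<subseteq> U"
    and L': "\<forall>y\<in>W. \<forall>z\<in>W. \<bar>p y - p z\<bar> \<le> L * coord_dist n (c y) (c z)"
    by (elim exE conjE)
  have L: "\<bar>p y - p z\<bar> \<le> L * coord_dist n (c y) (c z)" if "y \<in> W" "z \<in> W" for y z
    using L' that by blast
  have "\<bar>p y - p z\<bar> \<le> max 0 L * coord_dist n (c y) (c z)" if "y \<in> W" "z \<in> W" for y z
    by (rule order_trans[OF L[OF that]]) (auto intro!: mult_right_mono sum_nonneg)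
  with W show ?thesis using that[of W "max 0 L"] by simp
qed

lemma Lipschitz_at_nbhd:
  assumes "Lipschitz_at p x" "x \<in> topspace X" "\<epsilon> > 0"
  obtains W where "openin X W" "x \<in> W" "\<And>y. y \<in> W \<Longrightarrow> \<bar>p y - p x\<bar> < \<epsilon>"
proof -
  obtain U c where C: "(U, c) \<in> A" "x \<in> U" using chart_at assms(2) by blast
  obtain W L where W: "openin X W" "x \<in> W" "W \<subseteq> U" "L \<ge> 0" and
    L: "\<And>y z. \<lbrakk>y \<in> W; z \<in> W\<rbrakk> \<Longrightarrow> \<bar>p y - p z\<bar> \<le> L * coord_dist n (c y) (c z)"
    using Lipschitz_atE[OF assms(1) C] by blast
  \<comment> \<open>In a box of this radius the increment is at most
    \<open>L * real n * \<rho>\<close>; the added 1 makes the bound strict and the quotient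
    meaningful when \<open>L\<close> or \<open>n\<close> is 0.\<close>
  define \<rho> where "\<rho> = \<epsilon> / (L * real n + 1)"
  have pos: "L * real n + 1 > 0" using W(4) by (simp add: add_nonneg_pos)
  then have "\<rho> > 0" using assms(3) by (simp add: \<rho>_def)
  show ?thesis
  proof (rule that[of "W \<inter> {y \<in> U. \<forall>i<n. \<bar>c y i - c x i\<bar> < \<rho>}"])
    show "openin X (W \<inter> {y \<in> U. \<forall>i<n. \<bar>c y i - c x i\<bar> < \<rho>})"
      using W(1) chart_box_open[OF C(1)] by blast
    show "x \<in> W \<inter> {y \<in> U. \<forall>i<n. \<bar>c y i - c x i\<bar> < \<rho>}"
      using W C \<open>\<rho> > 0\<close> by simp
    fix y assume y: "y \<in> W \<inter> {y \<in> U. \<forall>i<n. \<bar>c y i - c x i\<bar> < \<rho>}"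
    have "coord_dist n (c y) (c x) \<le> (\<Sum>i<n. \<rho>)"
      by (intro sum_mono less_imp_le) (use y in auto)
    then have "\<bar>p y - p x\<bar> \<le> L * (real n * \<rho>)"
      using L[of y x] y W(2,4) by (fastforce intro: order_trans mult_left_mono)
    also have "\<dots> < (L * real n + 1) * \<rho>" using \<open>\<rho> > 0\<close> by (simp add: algebra_simps)
    also have "\<dots> = \<epsilon>" using pos by (simp add: \<rho>_def)
    finally show "\<bar>p y - p x\<bar> < \<epsilon>" .
  qed
qed

lemma Lipschitz_imp_continuous_map:
  assumes "\<And>x. x \<in> topspace X \<Longrightarrow> Lipschitz_at p x"
  shows "continuous_map X euclideanreal p"
proof -
  have "\<exists>U. openin X U \<and> x \<in> U \<and> (\<forall>y\<in>U. p y \<in> ball (p x) \<epsilon>)"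
    if "x \<in> topspace X" "\<epsilon> > 0" for x \<epsilon>
    using Lipschitz_at_nbhd[OF assms[OF that(1)] that]
    by (metis abs_minus_commute dist_real_def mem_ball)
  then show ?thesis
    using Metric_space.continuous_map_to_metric[OF Met_TC.Metric_space_axioms, of X p]
    by (simp add: Met_TC.mball_def[symmetric])
qed

lemma Lipschitz_at_const [simp]: "Lipschitz_at (\<lambda>y. a) x"
proof (rule Lipschitz_atI)
  fix U c assume "(U, c) \<in> A" "x \<in> U"
  then show "\<exists>W L. openin X W \<and> x \<in> W \<and> W \<subseteq> U \<and>
       (\<forall>y\<in>W. \<forall>z\<in>W. \<bar>a - a\<bar> \<le> L * coord_dist n (c y) (c z))"
    using chart_open by (intro exI[of _ U] exI[of _ 0]) auto
qed

text \<open>Common source of the closure rules below: for each operation it remains to bound the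
  increment of \<open>h\<close> locally by those of \<open>p\<close> and \<open>q\<close>.\<close>

lemma Lipschitz_at_combine:
  assumes p: "Lipschitz_at p x" and q: "Lipschitz_at q x"
    and W: "openin X W" "x \<in> W"
    and est: "\<And>y z. \<lbrakk>y \<in> W; z \<in> W\<rbrakk> \<Longrightarrow> \<bar>h y - h z\<bar> \<le> M * \<bar>p y - p z\<bar> + N * \<bar>q y - q z\<bar>"
    and MN: "M \<ge> 0" "N \<ge> 0"
  shows "Lipschitz_at h x"
proof (rule Lipschitz_atI)
  fix U c assume C: "(U, c) \<in> A" "x \<in> U"
  obtain W1 L1 where 1: "openin X W1" "x \<in> W1" "W1 \<subseteq> U" "L1 \<ge> 0"
    and L1: "\<And>y z. \<lbrakk>y \<in> W1; z \<in> W1\<rbrakk> \<Longrightarrow> \<bar>p y - p z\<bar> \<le> L1 * coord_dist n (c y) (c z)"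
    using Lipschitz_atE[OF p C] by blast
  obtain W2 L2 where 2: "openin X W2" "x \<in> W2" "W2 \<subseteq> U" "L2 \<ge> 0"
    and L2: "\<And>y z. \<lbrakk>y \<in> W2; z \<in> W2\<rbrakk> \<Longrightarrow> \<bar>q y - q z\<bar> \<le> L2 * coord_dist n (c y) (c z)"
    using Lipschitz_atE[OF q C] by blast
  have "\<bar>h y - h z\<bar> \<le> (M * L1 + N * L2) * coord_dist n (c y) (c z)"
    if "y \<in> W \<inter> W1 \<inter> W2" "z \<in> W \<inter> W1 \<inter> W2" for y z
  proof -
    let ?s = "\<Sum>i<n. \<bar>c y i - c z i\<bar>"
    have "M * \<bar>p y - p z\<bar> \<le> M * (L1 * ?s)" "N * \<bar>q y - q z\<bar> \<le> N * (L2 * ?s)"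
      using that L1 L2 MN by (auto intro!: mult_left_mono)
    then show ?thesis using est[of y z] that by (simp add: algebra_simps)
  qed
  then show "\<exists>W L. openin X W \<and> x \<in> W \<and> W \<subseteq> U \<and>
       (\<forall>y\<in>W. \<forall>z\<in>W. \<bar>h y - h z\<bar> \<le> L * coord_dist n (c y) (c z))"
    using 1 2 W by (intro exI[of _ "W \<inter> W1 \<inter> W2"] exI[of _ "M * L1 + N * L2"]) auto
qed

lemma Lipschitz_at_add:
  assumes "Lipschitz_at p x" "Lipschitz_at q x" "x \<in> topspace X"
  shows "Lipschitz_at (\<lambda>y. p y + q y) x"
  by (rule Lipschitz_at_combine[OF assms(1,2) openin_topspace assms(3), of _ 1 1]) auto

lemma Lipschitz_at_sum:
  assumes "\<And>k. k \<in> I \<Longrightarrow> Lipschitz_at (p k) x" "x \<in> topspace X"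
  shows "Lipschitz_at (\<lambda>y. \<Sum>k\<in>I. p k y) x"
  using assms by (induction I rule: infinite_finite_induct) (auto intro: Lipschitz_at_add)

lemma Lipschitz_at_max:
  assumes "Lipschitz_at p x" "x \<in> topspace X"
  shows "Lipschitz_at (\<lambda>y. max a (p y)) x"
  by (rule Lipschitz_at_combine[OF assms(1,1) openin_topspace assms(2), of _ 1 0])
    (use max_diff_le in auto)

lemma Lipschitz_at_mult:
  assumes "Lipschitz_at p x" "Lipschitz_at q x" "x \<in> topspace X"
  shows "Lipschitz_at (\<lambda>y. p y * q y) x"
proof -
  obtain W1 where 1: "openin X W1" "x \<in> W1" "\<And>y. y \<in> W1 \<Longrightarrow> \<bar>p y - p x\<bar> < 1"
    using Lipschitz_at_nbhd[OF assms(1,3), of 1] by auto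
  obtain W2 where 2: "openin X W2" "x \<in> W2" "\<And>y. y \<in> W2 \<Longrightarrow> \<bar>q y - q x\<bar> < 1"
    using Lipschitz_at_nbhd[OF assms(2,3), of 1] by auto
  have "\<bar>p y * q y - p z * q z\<bar> \<le> (\<bar>q x\<bar> + 1) * \<bar>p y - p z\<bar> + (\<bar>p x\<bar> + 1) * \<bar>q y - q z\<bar>"
    if "y \<in> W1 \<inter> W2" "z \<in> W1 \<inter> W2" for y z
  proof -
    have "p y * q y - p z * q z = q y * (p y - p z) + p z * (q y - q z)"
      by (simp add: algebra_simps)
    then have "\<bar>p y * q y - p z * q z\<bar> \<le> \<bar>q y\<bar> * \<bar>p y - p z\<bar> + \<bar>p z\<bar> * \<bar>q y - q z\<bar>"
      by (metis abs_mult abs_triangle_ineq)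
    moreover have "\<bar>q y\<bar> \<le> \<bar>q x\<bar> + 1" "\<bar>p z\<bar> \<le> \<bar>p x\<bar> + 1"
      using 1(3)[of z] 2(3)[of y] that by auto
    ultimately show ?thesis
      by (smt (verit) mult_right_mono abs_ge_zero)
  qed
  then show ?thesis
    using 1 2 by (intro Lipschitz_at_combine[OF assms(1,2), of "W1 \<inter> W2"]) auto
qed

lemma Lipschitz_at_inverse:
  assumes "Lipschitz_at p x" "x \<in> topspace X" "p x > 0"
  shows "Lipschitz_at (\<lambda>y. inverse (p y)) x"
proof -
  obtain W where W: "openin X W" "x \<in> W" "\<And>y. y \<in> W \<Longrightarrow> \<bar>p y - p x\<bar> < p x / 2"
    using Lipschitz_at_nbhd[OF assms(1,2), of "p x / 2"] assms(3) by auto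
  \<comment> \<open>The constant \<open>4 / (p x)\<^sup>2\<close> bounds
    \<open>1 / (p y * p z)\<close>, since both values exceed \<open>p x / 2\<close> on
    \<open>W\<close>.\<close>
  have "\<bar>inverse (p y) - inverse (p z)\<bar> \<le> (4 / (p x)\<^sup>2) * \<bar>p y - p z\<bar> + 0 * \<bar>p y - p z\<bar>"
    if "y \<in> W" "z \<in> W" for y z
  proof -
    have big: "p y > p x / 2" "p z > p x / 2"
      using W(3)[OF that(1)] W(3)[OF that(2)] by linarith+
    then have pos: "p y > 0" "p z > 0" using assms(3) by auto
    have "(p x / 2) * (p x / 2) \<le> p y * p z"
      using big assms(3) by (intro mult_mono) auto
    then have le: "inverse (p y * p z) \<le> 4 / (p x)\<^sup>2"
      using assms(3) pos by (simp add: field_simps power2_eq_square)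
    have "inverse (p y) - inverse (p z) = inverse (p y * p z) * (p z - p y)"
      using pos by (simp add: field_simps)
    then have "\<bar>inverse (p y) - inverse (p z)\<bar> = inverse (p y * p z) * \<bar>p y - p z\<bar>"
      using pos by (simp add: abs_mult abs_minus_commute)
    then show ?thesis using mult_right_mono[OF le abs_ge_zero[of "p y - p z"]] by simp
  qed
  then show ?thesis
    using W by (intro Lipschitz_at_combine[OF assms(1,1), of W _ "4 / (p x)\<^sup>2" 0]) auto
qed

text \<open>Differentiability of the action enters here; it is the reason why averages of locally
  Lipschitz functions over \<open>G\<close> are again locally Lipschitz.\<close>

lemma Lipschitz_at_act:
  assumes p: "Lipschitz_at p (\<phi> g x)" and g: "g \<in> carrier G"
  shows "Lipschitz_at (\<lambda>y. p (\<phi> g y)) x"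
proof (rule Lipschitz_atI)
  fix U c assume C: "(U, c) \<in> A" "x \<in> U"
  have gx: "\<phi> g x \<in> topspace X" using act_in g chart_in_topspace C by blast
  obtain V e where D: "(V, e) \<in> A" "\<phi> g x \<in> V" using chart_at[OF gx] by blast
  have "smooth_in_charts n n (U, c) (V, e) (\<phi> g)"
    using smooth_act g C(1) D(1) by (auto simp: smooth_action_def smooth_map_def)
  then obtain W L where W: "openin X W" "x \<in> W" "W \<subseteq> U" "\<phi> g ` W \<subseteq> V" "L \<ge> 0" and
    L: "\<And>y z j. \<lbrakk>y \<in> W; z \<in> W; j < n\<rbrakk> \<Longrightarrow>
      \<bar>e (\<phi> g y) j - e (\<phi> g z) j\<bar> \<le> L * coord_dist n (c y) (c z)"
    using smooth_map_locally_Lipschitz[OF C(1) D(1) act_continuous[OF g] _ C(2) D(2)] by blast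
  obtain W' M where W': "openin X W'" "\<phi> g x \<in> W'" "W' \<subseteq> V" "M \<ge> 0"
    and M: "\<And>y z. \<lbrakk>y \<in> W'; z \<in> W'\<rbrakk> \<Longrightarrow> \<bar>p y - p z\<bar> \<le> M * coord_dist n (e y) (e z)"
    using Lipschitz_atE[OF p D] by blast
  define W'' where "W'' = W \<inter> {y \<in> topspace X. \<phi> g y \<in> W'}"
  have "openin X W''"
    unfolding W''_def
    using W(1) openin_continuous_map_preimage[OF act_continuous[OF g] W'(1)] by blast
  moreover have "\<bar>p (\<phi> g y) - p (\<phi> g z)\<bar> \<le> (M * (real n * L)) * coord_dist n (c y) (c z)"
    if "y \<in> W''" "z \<in> W''" for y z
  proof -
    have "\<bar>p (\<phi> g y) - p (\<phi> g z)\<bar> \<le> M * (\<Sum>j<n. \<bar>e (\<phi> g y) j - e (\<phi> g z) j\<bar>)"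
      using M that by (auto simp: W''_def)
    also have "\<dots> \<le> M * (\<Sum>j<n. L * coord_dist n (c y) (c z))"
      using L that W'(4) by (intro mult_left_mono sum_mono) (auto simp: W''_def)
    finally show ?thesis by (simp add: algebra_simps)
  qed
  ultimately show "\<exists>W L. openin X W \<and> x \<in> W \<and> W \<subseteq> U \<and>
       (\<forall>y\<in>W. \<forall>z\<in>W. \<bar>p (\<phi> g y) - p (\<phi> g z)\<bar> \<le> L * coord_dist n (c y) (c z))"
    using W(2,3) W'(2) chart_in_topspace[OF C]
    by (intro exI[of _ W''] exI[of _ "M * (real n * L)"]) (auto simp: W''_def)
qed

text \<open>A tent function of the l1 distance to \<open>x\<close> in a chart, set to 0 off the
  chart. It vanishes outside a compact box, which is closed because \<open>X\<close> is Hausdorff,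
  so there is no jump at the edge of the chart.\<close>

lemma Lipschitz_bump:
  assumes x: "x \<in> topspace X" and N: "openin X N" "x \<in> N"
  obtains \<beta> K where "\<And>y. y \<in> topspace X \<Longrightarrow> Lipschitz_at \<beta> y" "\<And>y. \<beta> y \<ge> 0" "\<beta> x = 1"
    "compactin X K" "K \<subseteq> N" "\<And>y. y \<notin> K \<Longrightarrow> \<beta> y = 0"
proof -
  obtain U c where C: "(U, c) \<in> A" "x \<in> U" using chart_at[OF x] by blast
  obtain \<rho> where \<rho>: "\<rho> > 0" and
    K: "compactin X {y \<in> U. \<forall>i<n. \<bar>c y i - c x i\<bar> \<le> \<rho>}" "{y \<in> U. \<forall>i<n. \<bar>c y i - c x i\<bar> \<le> \<rho>} \<subseteq> N"
    using chart_compact_box[OF C N] by blast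
  define K where "K = {y \<in> U. \<forall>i<n. \<bar>c y i - c x i\<bar> \<le> \<rho>}"
  define s where "s y = coord_dist n (c y) (c x)" for y
  define \<beta> where "\<beta> y = (if y \<in> U then max 0 (1 - s y / \<rho>) else 0)" for y
  have off: "\<beta> y = 0" if "y \<notin> K" for y
  proof (cases "y \<in> U")
    case True
    have "\<not> (\<forall>i<n. \<bar>c y i - c x i\<bar> \<le> \<rho>)" using that True by (simp add: K_def)
    then obtain i where i: "i < n" "\<bar>c y i - c x i\<bar> > \<rho>" by (metis not_le)
    have "\<bar>c y i - c x i\<bar> \<le> s y" unfolding s_def using i by (intro member_le_sum) auto
    then show ?thesis using i \<rho> by (simp add: \<beta>_def)
  qed (simp add: \<beta>_def)
  have lip: "Lipschitz_at \<beta> y" if y: "y \<in> topspace X" for y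
  proof (rule Lipschitz_atI)
    fix V e assume D: "(V, e) \<in> A" "y \<in> V"
    show "\<exists>W L. openin X W \<and> y \<in> W \<and> W \<subseteq> V \<and>
       (\<forall>u\<in>W. \<forall>z\<in>W. \<bar>\<beta> u - \<beta> z\<bar> \<le> L * coord_dist n (e u) (e z))"
    proof (cases "y \<in> U")
      case True
      \<comment> \<open>The tent is Lipschitz in the coordinates \<open>c\<close>; the transition
        map carries the estimate over to the coordinates \<open>e\<close>.\<close>
      have "smooth_in_charts n n (V, e) (U, c) (\<lambda>x. x)"
        using atlas C(1) D(1) by (auto simp: smooth_atlas_def)
      then obtain W L where W: "openin X W" "y \<in> W" "W \<subseteq> V" "(\<lambda>x. x) ` W \<subseteq> U" "L \<ge> 0" and
        L: "\<And>u z j. \<lbrakk>u \<in> W; z \<in> W; j < n\<rbrakk> \<Longrightarrow> \<bar>c u j - c z j\<bar> \<le> L * coord_dist n (e u) (e z)"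
        using smooth_map_locally_Lipschitz[OF D(1) C(1) _ _ D(2), of "\<lambda>x. x"] True by auto
      have "\<bar>\<beta> u - \<beta> z\<bar> \<le> (real n * L / \<rho>) * coord_dist n (e u) (e z)" if "u \<in> W" "z \<in> W" for u z
      proof -
        have "\<bar>s u - s z\<bar> \<le> (\<Sum>i<n. \<bar>\<bar>c u i - c x i\<bar> - \<bar>c z i - c x i\<bar>\<bar>)"
          unfolding s_def sum_subtractf[symmetric] by (rule sum_abs)
        also have "\<dots> \<le> (\<Sum>i<n. L * coord_dist n (e u) (e z))"
          by (intro sum_mono order_trans[OF _ L[OF that]]) auto
        finally have s: "\<bar>s u - s z\<bar> \<le> real n * (L * coord_dist n (e u) (e z))" by simp
        have "\<bar>\<beta> u - \<beta> z\<bar> \<le> \<bar>(1 - s u / \<rho>) - (1 - s z / \<rho>)\<bar>"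
          using that W(4) by (simp add: \<beta>_def image_subset_iff subset_iff max_diff_le)
        also have "\<dots> = \<bar>s u - s z\<bar> / \<rho>"
          using \<rho> by (simp add: abs_minus_commute flip: diff_divide_distrib)
        also have "\<dots> \<le> real n * (L * coord_dist n (e u) (e z)) / \<rho>"
          using s \<rho> by (simp add: divide_right_mono)
        finally show ?thesis by simp
      qed
      then show ?thesis using W by blast
    next
      case False
      have "closedin X K" using K(1) Hausdorff compactin_imp_closedin by (auto simp: K_def)
      then have "openin X (V - K)" using chart_open[OF D(1)] openin_diff by blast
      moreover have "y \<notin> K" using False by (simp add: K_def)
      ultimately show ?thesis
        using off D(2) by (intro exI[of _ "V - K"] exI[of _ 0]) auto
    qed
  qed
  show ?thesis
  proof (rule that[of \<beta> K])
    show "\<beta> x = 1" using C \<rho> by (simp add: \<beta>_def s_def)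
  qed (use lip off K \<rho> in \<open>auto simp: K_def \<beta>_def\<close>)
qed

end

section \<open>Counting cells: a Lipschitz map into more than \<open>n\<close> coordinates misses
  small values\<close>

text \<open>Pigeonhole. If every node of a grid of mesh \<open>D / k\<close> were a value of
  \<open>p\<close> on \<open>K\<close>, distinct nodes would come from distinct cells, as values
  within a cell differ by less than the mesh. But the \<open>M ^ card J \<ge> M ^ Suc n\<close>
  nodes outnumber the cells.\<close>

lemma grid_avoids_cells:
  fixes p :: "'j \<Rightarrow> 'x \<Rightarrow> real" and J :: "'j set"
  assumes J: "finite J" "card J > n" and \<epsilon>: "\<epsilon> > 0" and D: "D > 0"
    and cells: "\<And>k. k > 0 \<Longrightarrow> \<exists>cell::'x \<Rightarrow> 'a. finite (cell ` K) \<and> card (cell ` K) \<le> Q * k ^ n \<and>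
      (\<forall>x\<in>K. \<forall>y\<in>K. cell x = cell y \<longrightarrow> (\<forall>j\<in>J. \<bar>p j x - p j y\<bar> < D / real k))"
  obtains c where "\<And>j. j \<in> J \<Longrightarrow> \<bar>c j\<bar> \<le> \<epsilon>" "\<And>x. x \<in> K \<Longrightarrow> \<exists>j\<in>J. p j x \<noteq> c j"
proof -
  obtain T :: nat where T: "D / \<epsilon> < real T" using reals_Archimedean2 by blast
  then have "T > 0" using D \<epsilon> by (metis divide_pos_pos gr0I less_asym of_nat_0)
  \<comment> \<open>With \<open>k = M * T\<close> there are at most
    \<open>(Q * T ^ n) * M ^ n\<close> cells, so \<open>M\<close> has to exceed
    \<open>Q * T ^ n\<close>. The side of the grid is below \<open>M * (D / k) = D / T\<close>,
    which \<open>T\<close> makes smaller than \<open>\<epsilon>\<close>.\<close>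
  define M where "M = Q * T ^ n + 1"
  define k where "k = M * T"
  have "k > 0" using \<open>T > 0\<close> by (simp add: k_def M_def)
  obtain cell :: "'x \<Rightarrow> 'a" where cell: "finite (cell ` K)" "card (cell ` K) \<le> Q * k ^ n"
    "\<And>x y j. \<lbrakk>x \<in> K; y \<in> K; cell x = cell y; j \<in> J\<rbrakk> \<Longrightarrow> \<bar>p j x - p j y\<bar> < D / real k"
    using cells[OF \<open>k > 0\<close>] by blast
  define grid where "grid = (J \<rightarrow>\<^sub>E {..<M})"
  define val where "val \<gamma> j = real (\<gamma> j) * (D / real k)" for \<gamma> :: "'j \<Rightarrow> nat" and j
  have fin: "finite grid" unfolding grid_def using J by (intro finite_PiE) auto
  have cgrid: "card grid = M ^ card J" unfolding grid_def using J by (simp add: card_PiE)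
  have "\<exists>\<gamma>\<in>grid. \<forall>x\<in>K. \<exists>j\<in>J. p j x \<noteq> val \<gamma> j"
  proof (rule ccontr)
    assume "\<not> ?thesis"
    then have "\<forall>\<gamma>\<in>grid. \<exists>x\<in>K. \<forall>j\<in>J. p j x = val \<gamma> j" by blast
    then obtain pt where pt: "\<And>\<gamma>. \<gamma> \<in> grid \<Longrightarrow> pt \<gamma> \<in> K"
      "\<And>\<gamma> j. \<lbrakk>\<gamma> \<in> grid; j \<in> J\<rbrakk> \<Longrightarrow> p j (pt \<gamma>) = val \<gamma> j" by metis
    have "inj_on (cell \<circ> pt) grid"
    proof (rule inj_onI)
      fix \<gamma> \<gamma>' assume \<gamma>: "\<gamma> \<in> grid" "\<gamma>' \<in> grid" and eq: "(cell \<circ> pt) \<gamma> = (cell \<circ> pt) \<gamma>'"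
      have "\<gamma> j = \<gamma>' j" if j: "j \<in> J" for j
      proof -
        have "\<bar>p j (pt \<gamma>) - p j (pt \<gamma>')\<bar> < D / real k"
          using cell(3)[OF pt(1)[OF \<gamma>(1)] pt(1)[OF \<gamma>(2)] _ j] eq by simp
        then have "\<bar>real (\<gamma> j) - real (\<gamma>' j)\<bar> * (D / real k) < 1 * (D / real k)"
          using pt(2)[OF \<gamma>(1) j] pt(2)[OF \<gamma>(2) j] D \<open>k > 0\<close>
          by (simp add: val_def abs_mult flip: left_diff_distrib diff_divide_distrib)
        moreover have "D / real k > 0" using D \<open>k > 0\<close> by simp
        ultimately have "\<bar>real (\<gamma> j) - real (\<gamma>' j)\<bar> < 1"
          using mult_less_cancel_right_pos by blast
        then show ?thesis by linarith
      qed
      then show "\<gamma> = \<gamma>'" using \<gamma> unfolding grid_def by (auto intro: PiE_ext)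
    qed
    moreover have "(cell \<circ> pt) ` grid \<subseteq> cell ` K" using pt(1) by auto
    ultimately have "card grid \<le> card (cell ` K)" using cell(1) card_inj_on_le by blast
    then have "M ^ card J \<le> Q * k ^ n" using cgrid cell(2) by linarith
    moreover have "M ^ card J \<ge> M ^ Suc n"
      using J(2) by (intro power_increasing) (auto simp: M_def)
    moreover have "Q * k ^ n = (Q * T ^ n) * M ^ n" by (simp add: k_def power_mult_distrib)
    moreover have "(Q * T ^ n) * M ^ n < M ^ Suc n" by (simp add: M_def)
    ultimately show False by linarith
  qed
  then obtain \<gamma> where \<gamma>: "\<gamma> \<in> grid" "\<And>x. x \<in> K \<Longrightarrow> \<exists>j\<in>J. p j x \<noteq> val \<gamma> j" by blast
  have "\<bar>val \<gamma> j\<bar> \<le> \<epsilon>" if "j \<in> J" for j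
  proof -
    have "\<gamma> j < M" using \<gamma>(1) that by (auto simp: grid_def)
    then have "val \<gamma> j \<le> real M * (D / real k)"
      unfolding val_def using D by (intro mult_right_mono) auto
    also have "\<dots> = D / real T" using \<open>T > 0\<close> \<open>k > 0\<close> by (simp add: k_def field_simps)
    also have "\<dots> \<le> \<epsilon>" using T \<epsilon> \<open>T > 0\<close> by (simp add: field_simps)
    finally show ?thesis using D by (simp add: val_def)
  qed
  with \<gamma>(2) that show ?thesis by blast
qed

text \<open>The formula numbers, from 0, the \<open>k\<close> equal subintervals of length
  \<open>2 * a / k\<close> into which the interval from \<open>- a\<close> to \<open>a\<close> is
  cut.\<close>

lemma floor_cell:
  fixes a b t u :: real
  assumes "a > 0" "k > (0::nat)" "\<bar>t\<bar> < a"
  shows "nat \<lfloor>(t + a) * real k / (2 * a)\<rfloor> < k"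
    and "nat \<lfloor>(t + a) * real k / (2 * a)\<rfloor> = nat \<lfloor>(u + a) * real k / (2 * a)\<rfloor> \<Longrightarrow> \<bar>u\<bar> < a \<Longrightarrow>
      \<bar>t - u\<bar> \<le> 2 * a / real k"
proof -
  let ?f = "\<lambda>t. (t + a) * real k / (2 * a)"
  have f0: "?f t \<ge> 0" if "\<bar>t\<bar> < a" for t using that assms by simp
  have "(t + a) * real k < (2 * a) * real k" using assms by (intro mult_strict_right_mono) auto
  then have "?f t < real k" using assms(1) by (simp add: field_simps)
  then show "nat \<lfloor>?f t\<rfloor> < k" using f0[OF assms(3)] by linarith
  assume eq: "nat \<lfloor>?f t\<rfloor> = nat \<lfloor>?f u\<rfloor>" and u: "\<bar>u\<bar> < a"
  have "\<lfloor>?f t\<rfloor> = \<lfloor>?f u\<rfloor>"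
    using eq f0[OF assms(3)] f0[OF u] by linarith
  then have "\<bar>?f t - ?f u\<bar> \<le> 1" by linarith
  moreover have "?f t - ?f u = (t - u) * (real k / (2 * a))"
    by (simp add: left_diff_distrib distrib_right add_divide_distrib diff_divide_distrib)
  ultimately have "\<bar>t - u\<bar> * (real k / (2 * a)) \<le> 1" using assms by (simp add: abs_mult)
  then show "\<bar>t - u\<bar> \<le> 2 * a / real k" using assms by (simp add: field_simps)
qed

context smooth_G_manifold
begin

lemma Lipschitz_family_box:
  assumes J: "finite J" and p: "\<And>j. j \<in> J \<Longrightarrow> Lipschitz_at (p j) x" and x: "x \<in> topspace X"
  obtains U c \<rho> L where "(U, c) \<in> A" "x \<in> U" "\<rho> > 0" "L \<ge> 0"
    "\<And>j y z. \<lbrakk>j \<in> J; y \<in> U; z \<in> U; \<forall>i<n. \<bar>c y i - c x i\<bar> < \<rho>; \<forall>i<n. \<bar>c z i - c x i\<bar> < \<rho>\<rbrakk>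
      \<Longrightarrow> \<bar>p j y - p j z\<bar> \<le> L * coord_dist n (c y) (c z)"
proof -
  obtain U c where C: "(U, c) \<in> A" "x \<in> U" using chart_at[OF x] by blast
  have "\<forall>j. \<exists>W L. j \<in> J \<longrightarrow> openin X W \<and> x \<in> W \<and> L \<ge> 0 \<and>
     (\<forall>y\<in>W. \<forall>z\<in>W. \<bar>p j y - p j z\<bar> \<le> L * coord_dist n (c y) (c z))" (is "\<forall>j. ?P j")
  proof
    fix j
    show "?P j"
    proof (cases "j \<in> J")
      case True
      obtain W L where "openin X W" "x \<in> W" "W \<subseteq> U" "L \<ge> 0" and
        "\<And>y z. \<lbrakk>y \<in> W; z \<in> W\<rbrakk> \<Longrightarrow> \<bar>p j y - p j z\<bar> \<le> L * coord_dist n (c y) (c z)"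
        using Lipschitz_atE[OF p[OF True] C] by blast
      then show ?thesis by (intro exI[of _ W] exI[of _ L]) auto
    qed auto
  qed
  then obtain W L where W: "\<forall>j. j \<in> J \<longrightarrow> openin X (W j) \<and> x \<in> W j \<and> L j \<ge> 0 \<and>
     (\<forall>y\<in>W j. \<forall>z\<in>W j. \<bar>p j y - p j z\<bar> \<le> L j * coord_dist n (c y) (c z))"
    unfolding choice_iff by blast
  have "openin X (topspace X \<inter> (\<Inter>j\<in>J. W j))"
    using W J by (cases "J = {}") (auto intro!: openin_Int openin_INT2)
  moreover have "x \<in> topspace X \<inter> (\<Inter>j\<in>J. W j)" using W x by auto
  ultimately obtain \<rho> where \<rho>: "\<rho> > 0" "\<And>y. \<lbrakk>y \<in> U; \<And>i. i < n \<Longrightarrow> \<bar>c y i - c x i\<bar> < \<rho>\<rbrakk>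
      \<Longrightarrow> y \<in> topspace X \<inter> (\<Inter>j\<in>J. W j)"
    using chart_box_subset[OF C] by blast
  show ?thesis
  proof (rule that[OF C \<rho>(1), of "\<Sum>j\<in>J. L j"])
    show "0 \<le> (\<Sum>j\<in>J. L j)" using W by (auto intro: sum_nonneg)
    fix j y z assume j: "j \<in> J" and yz: "y \<in> U" "z \<in> U"
      "\<forall>i<n. \<bar>c y i - c x i\<bar> < \<rho>" "\<forall>i<n. \<bar>c z i - c x i\<bar> < \<rho>"
    have "y \<in> W j" "z \<in> W j" using \<rho>(2)[of y] \<rho>(2)[of z] yz j by auto
    then have "\<bar>p j y - p j z\<bar> \<le> L j * coord_dist n (c y) (c z)" using W j by blast
    also have "\<dots> \<le> (\<Sum>j\<in>J. L j) * coord_dist n (c y) (c z)"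
      using J W j by (intro mult_right_mono sum_nonneg member_le_sum) auto
    finally show "\<bar>p j y - p j z\<bar> \<le> (\<Sum>j\<in>J. L j) * coord_dist n (c y) (c z)" .
  qed
qed

text \<open>The image of \<open>K\<close> is covered by \<open>O(k\<^sup>n)\<close> cells of size \<open>O(1/k)\<close>, too few to meet all points of a
  grid of mesh \<open>O(1/k)\<close>.\<close>

lemma Lipschitz_avoids_value:
  assumes J: "finite J" "card J > n" and K: "compactin X K"
    and p: "\<And>j x. \<lbrakk>j \<in> J; x \<in> K\<rbrakk> \<Longrightarrow> Lipschitz_at (p j) x" and \<epsilon>: "\<epsilon> > 0"
  obtains b where "\<And>j. j \<in> J \<Longrightarrow> \<bar>b j\<bar> \<le> \<epsilon>" "\<And>x. x \<in> K \<Longrightarrow> \<exists>j\<in>J. p j x \<noteq> b j"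
proof -
  have KX: "K \<subseteq> topspace X" using K compactin_subset_topspace by blast
  have "\<forall>x. \<exists>U c \<rho> L. x \<in> K \<longrightarrow> (U, c) \<in> A \<and> x \<in> U \<and> \<rho> > 0 \<and> L \<ge> 0 \<and>
    (\<forall>j y z. j \<in> J \<and> y \<in> U \<and> z \<in> U \<and> (\<forall>i<n. \<bar>c y i - c x i\<bar> < \<rho>) \<and> (\<forall>i<n. \<bar>c z i - c x i\<bar> < \<rho>)
      \<longrightarrow> \<bar>p j y - p j z\<bar> \<le> L * coord_dist n (c y) (c z))" (is "\<forall>x. ?P x")
  proof
    fix x
    show "?P x"
    proof (cases "x \<in> K")
      case True
      then have "x \<in> topspace X" using KX by blast
      with J(1) p[OF _ True] obtain U c \<rho> L where "(U, c) \<in> A" "x \<in> U" "\<rho> > 0" "L \<ge> 0"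
    "\<And>j y z. \<lbrakk>j \<in> J; y \<in> U; z \<in> U; \<forall>i<n. \<bar>c y i - c x i\<bar> < \<rho>; \<forall>i<n. \<bar>c z i - c x i\<bar> < \<rho>\<rbrakk>
      \<Longrightarrow> \<bar>p j y - p j z\<bar> \<le> L * coord_dist n (c y) (c z)"
        using Lipschitz_family_box[of J p x] by blast
      then show ?thesis by (intro exI[of _ U] exI[of _ c] exI[of _ \<rho>] exI[of _ L]) auto
    qed auto
  qed
  then obtain U c \<rho> L where *: "\<forall>x. x \<in> K \<longrightarrow> (U x, c x) \<in> A \<and> x \<in> U x \<and> \<rho> x > 0 \<and> L x \<ge> 0 \<and>
    (\<forall>j y z. j \<in> J \<and> y \<in> U x \<and> z \<in> U x \<and> (\<forall>i<n. \<bar>c x y i - c x x i\<bar> < \<rho> x) \<and>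
       (\<forall>i<n. \<bar>c x z i - c x x i\<bar> < \<rho> x)
      \<longrightarrow> \<bar>p j y - p j z\<bar> \<le> L x * coord_dist n (c x y) (c x z))"
    unfolding choice_iff by blast
  have pos: "L x * (real n * (2 * \<rho> x)) \<ge> 0" if "x \<in> K" for x
    using *[THEN spec[of _ x]] that by auto
  define B where "B x = {y \<in> U x. \<forall>i<n. \<bar>c x y i - c x x i\<bar> < \<rho> x}" for x
  have "openin X (B x)" "x \<in> B x" if "x \<in> K" for x
    unfolding B_def using * that chart_box_open by auto
  then have "\<exists>F\<subseteq>K. finite F \<and> K \<subseteq> (\<Union>x\<in>F. B x)"
  proof -
    assume B: "\<And>x. x \<in> K \<Longrightarrow> openin X (B x)" "\<And>x. x \<in> K \<Longrightarrow> x \<in> B x"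
    have "\<exists>\<F>. finite \<F> \<and> \<F> \<subseteq> B ` K \<and> K \<subseteq> \<Union>\<F>"
      by (rule compactinD[OF K]) (use B in auto)
    then obtain \<F> where \<F>: "finite \<F>" "\<F> \<subseteq> B ` K" "K \<subseteq> \<Union>\<F>" by blast
    then show ?thesis using finite_subset_image[OF \<F>(1,2)] by blast
  qed
  then obtain F where F: "F \<subseteq> K" "finite F" "K \<subseteq> (\<Union>x\<in>F. B x)" by blast
  \<comment> \<open>A summand bounds the variation of every \<open>p j\<close> over one box of side
    \<open>2 * \<rho> x\<close>; cutting the sides into \<open>k\<close> pieces divides it by
    \<open>k\<close>. The added 1 gives strict inequalities and \<open>D > 0\<close>.\<close>
  define D where "D = (\<Sum>x\<in>F. L x * (real n * (2 * \<rho> x))) + 1"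
  have D: "L x * (real n * (2 * \<rho> x)) < D" if "x \<in> F" for x
  proof -
    have "L x * (real n * (2 * \<rho> x)) \<le> (\<Sum>x\<in>F. L x * (real n * (2 * \<rho> x)))"
      using that F(1,2) pos by (intro member_le_sum) auto
    then show ?thesis by (simp add: D_def)
  qed
  have Dpos: "D > 0"
    unfolding D_def using F(1) pos by (intro add_nonneg_pos sum_nonneg) auto
  define ctr where "ctr y = (SOME x. x \<in> F \<and> y \<in> B x)" for y
  have ctr: "ctr y \<in> F \<and> y \<in> B (ctr y)" if "y \<in> K" for y
    unfolding ctr_def by (rule someI_ex) (use that F in blast)
  show ?thesis
  proof (rule grid_avoids_cells[where D = D and K = K and p = p and Q = "card F", OF J \<epsilon> Dpos])
    fix k :: nat assume k: "k > 0"
    define idx where "idx x y = restrict (\<lambda>i. nat \<lfloor>(c x y i - c x x i + \<rho> x) * real k / (2 * \<rho> x)\<rfloor>) {..<n}"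
      for x y
    \<comment> \<open>The centre is part of the label because coordinates in different charts cannot
      be compared; this is where the factor \<open>card F\<close> comes from.\<close>
    define cell where "cell y = (ctr y, idx (ctr y) y)" for y
    have sub: "cell ` K \<subseteq> F \<times> ({..<n} \<rightarrow>\<^sub>E {..<k})"
    proof
      fix q assume "q \<in> cell ` K"
      then obtain y where y: "y \<in> K" "q = cell y" by blast
      have "ctr y \<in> F" "y \<in> B (ctr y)" using ctr y by auto
      moreover have "\<rho> (ctr y) > 0" using * F \<open>ctr y \<in> F\<close> by blast
      ultimately show "q \<in> F \<times> ({..<n} \<rightarrow>\<^sub>E {..<k})"
        using k by (auto simp: y cell_def idx_def B_def intro!: floor_cell(1))
    qed
    have "finite (cell ` K)"
      by (rule finite_subset[OF sub]) (use F in \<open>auto intro: finite_PiE\<close>)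
    moreover have "card (cell ` K) \<le> card F * k ^ n"
      using card_mono[OF _ sub] F by (auto simp: card_PiE finite_PiE card_cartesian_product)
    moreover have "\<bar>p j y - p j z\<bar> < D / real k"
      if yz: "y \<in> K" "z \<in> K" "cell y = cell z" and j: "j \<in> J" for y z j
    proof -
      define x where "x = ctr y"
      have x: "x \<in> F" "y \<in> B x" "z \<in> B x" "idx x y = idx x z"
        using ctr[OF yz(1)] ctr[OF yz(2)] yz(3) by (auto simp: x_def cell_def)
      have pos: "\<rho> x > 0" "L x \<ge> 0" using * F x(1) by auto
      have le: "\<bar>c x y i - c x z i\<bar> \<le> 2 * \<rho> x / real k" if i: "i < n" for i
      proof -
        have "idx x y i = idx x z i" using x(4) by simp
        then have "\<bar>(c x y i - c x x i) - (c x z i - c x x i)\<bar> \<le> 2 * \<rho> x / real k"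
          using i x(2,3) by (intro floor_cell(2)[OF pos(1) k]) (auto simp: idx_def B_def)
        then show ?thesis by simp
      qed
      have "\<bar>p j y - p j z\<bar> \<le> L x * coord_dist n (c x y) (c x z)"
        using * F x j by (auto simp: B_def)
      also have "\<dots> \<le> L x * (\<Sum>i<n. 2 * \<rho> x / real k)"
        using le pos by (intro mult_left_mono sum_mono) auto
      also have "\<dots> = L x * (real n * (2 * \<rho> x)) / real k" by simp
      also have "\<dots> < D / real k" using D[OF x(1)] k by (simp add: divide_strict_right_mono)
      finally show ?thesis .
    qed
    ultimately show "\<exists>cell::'x \<Rightarrow> 'x \<times> (nat \<Rightarrow> nat). finite (cell ` K) \<and> card (cell ` K) \<le> card F * k ^ n \<and>
      (\<forall>x\<in>K. \<forall>y\<in>K. cell x = cell y \<longrightarrow> (\<forall>j\<in>J. \<bar>p j x - p j y\<bar> < D / real k))"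
      by blast
  qed (use that in blast)
qed

end

section \<open>Invariant functions: averaging, bumps and Lipschitz approximation\<close>

lemma compactin_pos_lower_bound:
  fixes f :: "'x \<Rightarrow> real"
  assumes "compactin X K" "continuous_map X euclideanreal f" "\<And>x. x \<in> K \<Longrightarrow> f x > 0"
  obtains \<delta> where "\<delta> > 0" "\<And>x. x \<in> K \<Longrightarrow> f x \<ge> \<delta>"
proof (cases "K = {}")
  case True
  then show ?thesis using that[of 1] by simp
next
  case False
  have "compact (f ` K)" using image_compactin[OF assms(1,2)] by simp
  then obtain x where "x \<in> K" "\<And>y. y \<in> K \<Longrightarrow> f x \<le> f y"
    using compact_attains_inf[of "f ` K"] False by auto
  then show ?thesis using that[of "f x"] assms(3) by blast
qed

lemma compactin_bounded:
  fixes f :: "'x \<Rightarrow> 'a::real_normed_vector"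
  assumes "compactin X K" "continuous_map X euclidean f"
  obtains B where "B > 0" "\<And>x. x \<in> K \<Longrightarrow> norm (f x) \<le> B"
proof -
  have "compact (f ` K)" using image_compactin[OF assms(1,2)] by simp
  then have "bounded (f ` K)" by (rule compact_imp_bounded)
  then show ?thesis using that by (auto simp: bounded_pos)
qed

context smooth_G_manifold
begin

lemma act_comp: "\<lbrakk>g \<in> carrier G; h \<in> carrier G; x \<in> topspace X\<rbrakk> \<Longrightarrow> \<phi> g (\<phi> h x) = \<phi> (g \<otimes> h) x"
  using composition_rule by simp

lemma act_one: "x \<in> topspace X \<Longrightarrow> \<phi> \<one> x = x"
  by (simp flip: id_eq_one)

lemma act_inv: "\<lbrakk>g \<in> carrier G; x \<in> topspace X\<rbrakk> \<Longrightarrow> \<phi> (inv g) (\<phi> g x) = x"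
  by (simp add: act_comp act_one)

text \<open>Right translation permutes the group; this substitution is what makes averages over
  \<open>G\<close> invariant or equivariant.\<close>

lemma sum_translate:
  assumes "h \<in> carrier G"
  shows "(\<Sum>g\<in>carrier G. f (g \<otimes> h)) = (\<Sum>g\<in>carrier G. f g)"
  by (rule sum.reindex_bij_witness[where i = "\<lambda>k. k \<otimes> inv h" and j = "\<lambda>g. g \<otimes> h"])
    (use assms in \<open>auto simp: m_assoc\<close>)

text \<open>Stands in for a function on the orbit space, which need not be a manifold.\<close>

definition invariant :: "('x \<Rightarrow> 'b) \<Rightarrow> bool" where
  "invariant f \<longleftrightarrow> (\<forall>g\<in>carrier G. \<forall>x\<in>topspace X. f (\<phi> g x) = f x)"

lemma invariantD: "\<lbrakk>invariant f; g \<in> carrier G; x \<in> topspace X\<rbrakk> \<Longrightarrow> f (\<phi> g x) = f x"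
  by (simp add: invariant_def)

lemma invariant_sum_orbit: "invariant (\<lambda>x. \<Sum>g\<in>carrier G. f (\<phi> g x))"
  unfolding invariant_def
proof (intro ballI)
  fix h x assume h: "h \<in> carrier G" and x: "x \<in> topspace X"
  have "(\<Sum>g\<in>carrier G. f (\<phi> g (\<phi> h x))) = (\<Sum>g\<in>carrier G. f (\<phi> (g \<otimes> h) x))"
    using h x by (simp add: act_comp)
  then show "(\<Sum>g\<in>carrier G. f (\<phi> g (\<phi> h x))) = (\<Sum>g\<in>carrier G. f (\<phi> g x))"
    using sum_translate[OF h, of "\<lambda>g. f (\<phi> g x)"] by simp
qed

lemma compactin_orbit:
  assumes "compactin X K"
  shows "compactin X (\<Union>g\<in>carrier G. \<phi> g ` K)"
  using fin image_compactin[OF assms act_continuous] by (intro compactin_Union) auto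

lemma not_in_orbit:
  assumes "y \<in> topspace X" "y \<notin> (\<Union>g\<in>carrier G. \<phi> g ` K)" "g \<in> carrier G"
  shows "\<phi> g y \<notin> K"
proof
  assume "\<phi> g y \<in> K"
  then have "\<phi> (inv g) (\<phi> g y) \<in> (\<Union>g\<in>carrier G. \<phi> g ` K)" using assms(3) by blast
  then show False using assms by (simp add: act_inv)
qed

text \<open>A bump is summed over the group. The terms are nonnegative, so the value at
  \<open>x\<close> stays positive. The sum vanishes off the translates of \<open>K\<close>, whose
  union is compact since \<open>G\<close> is finite, and off \<open>N\<close>, since
  \<open>N\<close> is invariant.\<close>

lemma invariant_bump:
  assumes x: "x \<in> topspace X" and N: "openin X N" "x \<in> N"
    and inv: "\<And>g y. \<lbrakk>g \<in> carrier G; y \<in> N\<rbrakk> \<Longrightarrow> \<phi> g y \<in> N"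
  obtains \<kappa> C where "\<And>y. y \<in> topspace X \<Longrightarrow> Lipschitz_at \<kappa> y" "\<And>y. \<kappa> y \<ge> 0" "\<kappa> x > 0"
    "invariant \<kappa>" "\<And>y. \<lbrakk>y \<in> topspace X; y \<notin> N\<rbrakk> \<Longrightarrow> \<kappa> y = 0"
    "compactin X C" "\<And>y. \<lbrakk>y \<in> topspace X; y \<notin> C\<rbrakk> \<Longrightarrow> \<kappa> y = 0"
proof -
  obtain \<beta> K where \<beta>: "\<And>y. y \<in> topspace X \<Longrightarrow> Lipschitz_at \<beta> y" "\<And>y. \<beta> y \<ge> 0" "\<beta> x = 1"
    "compactin X K" "K \<subseteq> N" "\<And>y. y \<notin> K \<Longrightarrow> \<beta> y = 0"
    by (rule Lipschitz_bump[OF x N]) blast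
  define \<kappa> where "\<kappa> y = (\<Sum>g\<in>carrier G. \<beta> (\<phi> g y))" for y
  show ?thesis
  proof (rule that[of \<kappa> "\<Union>g\<in>carrier G. \<phi> g ` K"])
    show "compactin X (\<Union>g\<in>carrier G. \<phi> g ` K)" by (rule compactin_orbit) fact
    show "\<kappa> y = 0" if "y \<in> topspace X" "y \<notin> (\<Union>g\<in>carrier G. \<phi> g ` K)" for y
      unfolding \<kappa>_def using \<beta>(6) not_in_orbit[OF that] by (intro sum.neutral) blast
    show "Lipschitz_at \<kappa> y" if "y \<in> topspace X" for y
      unfolding \<kappa>_def using that act_in \<beta>(1) by (auto intro!: Lipschitz_at_sum Lipschitz_at_act)
    show "\<kappa> y \<ge> 0" for y unfolding \<kappa>_def using \<beta>(2) by (simp add: sum_nonneg)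
    have "\<beta> (\<phi> \<one> x) \<le> \<kappa> x"
      unfolding \<kappa>_def using \<beta>(2) fin by (intro member_le_sum) auto
    then show "\<kappa> x > 0" using x \<beta>(3) by (simp add: act_one)
    show "invariant \<kappa>" unfolding \<kappa>_def by (rule invariant_sum_orbit)
    show "\<kappa> y = 0" if y: "y \<in> topspace X" "y \<notin> N" for y
      unfolding \<kappa>_def
    proof (intro sum.neutral ballI)
      fix g assume g: "g \<in> carrier G"
      have "\<phi> g y \<notin> N"
        using inv[of "inv g" "\<phi> g y"] act_inv[OF g y(1)] g y(2) by auto
      then show "\<beta> (\<phi> g y) = 0" using \<beta>(5,6) by blast
    qed
  qed
qed

text \<open>A partition of unity argument: on \<open>K\<close>, \<open>p\<close> is a weighted mean
  of values \<open>f x\<close> at finitely many centres, and the weight of \<open>x\<close> vanishes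
  outside \<open>N x\<close>, where \<open>f\<close> is \<open>\<epsilon>\<close>-close to
  \<open>f x\<close>. The sets \<open>N x\<close> are unions of orbits because \<open>f\<close> is
  invariant, so invariant weights exist.\<close>

lemma invariant_Lipschitz_approximation:
  assumes f: "continuous_map X euclideanreal f" "invariant f" and K: "compactin X K" and \<epsilon>: "\<epsilon> > 0"
  obtains p where "\<And>y. y \<in> topspace X \<Longrightarrow> Lipschitz_at p y" "invariant p"
    "\<And>y. y \<in> K \<Longrightarrow> \<bar>p y - f y\<bar> \<le> \<epsilon>"
proof -
  have KX: "K \<subseteq> topspace X" using K compactin_subset_topspace by blast
  define N where "N x = {y \<in> topspace X. f y \<in> ball (f x) \<epsilon>}" for x
  have "\<forall>x. \<exists>\<kappa>. x \<in> K \<longrightarrow> (\<forall>y\<in>topspace X. Lipschitz_at \<kappa> y) \<and> (\<forall>y. \<kappa> y \<ge> 0) \<and> \<kappa> x > 0 \<and> invariant \<kappa> \<and>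
     (\<forall>y\<in>topspace X. y \<notin> N x \<longrightarrow> \<kappa> y = 0)" (is "\<forall>x. ?P x")
  proof
    fix x
    show "?P x"
    proof (cases "x \<in> K")
      case True
      then have x: "x \<in> topspace X" using KX by blast
      have "openin X (N x)"
        unfolding N_def by (rule openin_continuous_map_preimage[OF f(1)]) simp
      moreover have "x \<in> N x" using x \<epsilon> by (simp add: N_def)
      moreover have "\<phi> g y \<in> N x" if "g \<in> carrier G" "y \<in> N x" for g y
        using that f(2) act_in by (auto simp: N_def invariant_def)
      ultimately show ?thesis using invariant_bump[OF x, of "N x"] by metis
    qed auto
  qed
  then obtain \<kappa> where \<kappa>: "\<And>x y. \<lbrakk>x \<in> K; y \<in> topspace X\<rbrakk> \<Longrightarrow> Lipschitz_at (\<kappa> x) y"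
    "\<And>x y. x \<in> K \<Longrightarrow> \<kappa> x y \<ge> 0" "\<And>x. x \<in> K \<Longrightarrow> \<kappa> x x > 0" "\<And>x. x \<in> K \<Longrightarrow> invariant (\<kappa> x)"
    "\<And>x y. \<lbrakk>x \<in> K; y \<in> topspace X; y \<notin> N x\<rbrakk> \<Longrightarrow> \<kappa> x y = 0"
    unfolding choice_iff by blast
  define O' where "O' x = {y \<in> topspace X. \<kappa> x y \<in> {0<..}}" for x
  have \<kappa>cont: "continuous_map X euclideanreal (\<kappa> x)" if "x \<in> K" for x
    using \<kappa>(1)[OF that] by (rule Lipschitz_imp_continuous_map)
  have "openin X (O' x)" if "x \<in> K" for x
    unfolding O'_def by (rule openin_continuous_map_preimage[OF \<kappa>cont[OF that]]) simp
  then have "\<exists>\<F>. finite \<F> \<and> \<F> \<subseteq> O' ` K \<and> K \<subseteq> \<Union>\<F>"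
    using \<kappa>(3) KX by (intro compactinD[OF K]) (auto simp: O'_def)
  then obtain F where F: "F \<subseteq> K" "finite F" "K \<subseteq> (\<Union>x\<in>F. O' x)"
    using finite_subset_image by (metis (no_types, opaque_lifting))
  define S where "S y = (\<Sum>x\<in>F. \<kappa> x y)" for y
  have Spos: "S y > 0" if "y \<in> K" for y
  proof -
    have "\<exists>x\<in>F. \<kappa> x y > 0" using F(3) that by (auto simp: O'_def)
    then obtain x where x: "x \<in> F" "\<kappa> x y > 0" by blast
    then have "\<kappa> x y \<le> S y" unfolding S_def using F \<kappa>(2) by (intro member_le_sum) auto
    then show ?thesis using x by simp
  qed
  have "continuous_map X euclideanreal S"
    unfolding S_def using F \<kappa>cont by (intro continuous_map_sum) auto
  then obtain \<delta> where \<delta>: "\<delta> > 0" "\<And>y. y \<in> K \<Longrightarrow> S y \<ge> \<delta>"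
    using compactin_pos_lower_bound[where f = S, OF K _ Spos] by blast
  \<comment> \<open>On \<open>K\<close> the maximum is \<open>S y\<close>; elsewhere it keeps the
    denominator away from 0, so that \<open>p\<close> is locally Lipschitz on all of
    \<open>X\<close>.\<close>
  define p where "p y = (\<Sum>x\<in>F. \<kappa> x y * f x) * inverse (max \<delta> (S y))" for y
  show ?thesis
  proof (rule that[of p])
    show "Lipschitz_at p y" if "y \<in> topspace X" for y
      unfolding p_def S_def using that \<delta>(1) \<kappa>(1) F
      by (intro Lipschitz_at_mult Lipschitz_at_sum Lipschitz_at_inverse Lipschitz_at_max) auto
    show "invariant p"
      unfolding invariant_def p_def S_def using \<kappa>(4) F
      by (auto simp: invariantD subset_iff intro!: arg_cong2[where f = "(*)"] sum.cong
        arg_cong[where f = inverse] arg_cong[where f = "max \<delta>"])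
    fix y assume y: "y \<in> K"
    have "\<bar>\<Sum>x\<in>F. \<kappa> x y * (f x - f y)\<bar> \<le> (\<Sum>x\<in>F. \<kappa> x y * \<epsilon>)"
    proof (rule order_trans[OF sum_abs sum_mono])
      fix x assume x: "x \<in> F"
      show "\<bar>\<kappa> x y * (f x - f y)\<bar> \<le> \<kappa> x y * \<epsilon>"
      proof (cases "y \<in> N x")
        case True
        then have "\<bar>f x - f y\<bar> \<le> \<epsilon>" by (simp add: N_def dist_real_def)
        then show ?thesis using \<kappa>(2)[of x y] x F by (auto simp: abs_mult intro!: mult_left_mono)
      next
        case False
        moreover have "x \<in> K" "y \<in> topspace X" using x F(1) y KX by blast+
        ultimately have "\<kappa> x y = 0" using \<kappa>(5) by blast
        then show ?thesis by simp
      qed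
    qed
    then have le: "\<bar>\<Sum>x\<in>F. \<kappa> x y * (f x - f y)\<bar> \<le> \<epsilon> * S y"
      by (simp add: S_def mult.commute sum_distrib_left)
    have "(\<Sum>x\<in>F. \<kappa> x y * (f x - f y)) = (\<Sum>x\<in>F. \<kappa> x y * f x) - S y * f y"
      by (simp add: S_def right_diff_distrib sum_subtractf sum_distrib_right)
    then have "p y - f y = (\<Sum>x\<in>F. \<kappa> x y * (f x - f y)) / S y"
      using Spos[OF y] \<delta>(2)[OF y] by (simp add: p_def max_def field_simps)
    then show "\<bar>p y - f y\<bar> \<le> \<epsilon>"
      using le Spos[OF y] by (simp add: abs_divide pos_divide_le_eq)
  qed
qed

end

section \<open>Vectors, linear functionals and dual frames\<close>

lemma continuous_map_mult [continuous_intros]: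
  fixes f g :: "'x \<Rightarrow> 'a::real_normed_algebra"
  assumes "continuous_map X euclidean f" "continuous_map X euclidean g"
  shows "continuous_map X euclidean (\<lambda>x. f x * g x)"
  using assms by (simp add: continuous_map_atin tendsto_mult)

lemma continuous_map_divide_complex [continuous_intros]:
  fixes f g :: "'x \<Rightarrow> complex"
  assumes "continuous_map X euclidean f" "continuous_map X euclidean g"
    "\<And>x. x \<in> topspace X \<Longrightarrow> g x \<noteq> 0"
  shows "continuous_map X euclidean (\<lambda>x. f x / g x)"
  using assms by (simp add: continuous_map_atin tendsto_divide)

lemma continuous_map_of_real [continuous_intros]:
  assumes "continuous_map X euclideanreal f"
  shows "continuous_map X euclidean (\<lambda>x. complex_of_real (f x))"
  using assms by (simp add: continuous_map_atin tendsto_of_real)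

lemma continuous_map_Re [continuous_intros]:
  assumes "continuous_map X euclidean f"
  shows "continuous_map X euclideanreal (\<lambda>x. Re (f x))"
  using assms by (simp add: continuous_map_atin tendsto_Re)

lemma continuous_map_Im [continuous_intros]:
  assumes "continuous_map X euclidean f"
  shows "continuous_map X euclideanreal (\<lambda>x. Im (f x))"
  using assms by (simp add: continuous_map_atin tendsto_Im)

text \<open>Off \<open>N\<close> nothing is known about \<open>f\<close>, but there the factor
  \<open>\<beta>\<close> is 0. Pasting works because \<open>N\<close> and the complement of
  \<open>K\<close> are open and cover the space.\<close>

lemma continuous_map_extend_by_zero:
  fixes f \<beta> :: "'x \<Rightarrow> complex"
  assumes N: "openin X N" and f: "continuous_map (subtopology X N) euclidean f"
    and \<beta>: "continuous_map X euclidean \<beta>" and K: "closedin X K" "K \<subseteq> N"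
    and off: "\<And>x. x \<notin> K \<Longrightarrow> \<beta> x = 0"
  shows "continuous_map X euclidean (\<lambda>x. \<beta> x * f x)"
proof (rule pasting_lemma[where I = UNIV and T = "\<lambda>b. if b then N else topspace X - K"
      and f = "\<lambda>b x. if b then \<beta> x * f x else 0"])
  fix b
  show "openin X (if b then N else topspace X - K)" using N K(1) by auto
  show "continuous_map (subtopology X (if b then N else topspace X - K)) euclidean
     (\<lambda>x. if b then \<beta> x * f x else 0)"
    using f \<beta> by (cases b) (auto intro: continuous_map_mult continuous_map_from_subtopology)
next
  fix x assume "x \<in> topspace X"
  then show "\<exists>j. j \<in> UNIV \<and> x \<in> (if j then N else topspace X - K) \<and>
      \<beta> x * f x = (if j then \<beta> x * f x else 0)"
    using off[of x] by (cases "x \<in> N") (use K in auto)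
qed (use off in \<open>auto split: if_splits\<close>)


section \<open>Linear functionals and operators in coordinates\<close>

type_synonym cvector = "nat \<Rightarrow> complex"

definition cvec :: "nat \<Rightarrow> cvector set" where
  "cvec d = {v. \<forall>i\<ge>d. v i = 0}"

lemma topspace_complex_space: "topspace (complex_space d) = cvec d"
  by (auto simp: complex_space_def cvec_def)

definition unit_vec :: "nat \<Rightarrow> cvector" where
  "unit_vec j = (\<lambda>i. if i = j then 1 else 0)"

lemma unit_vec_cvec: "j < d \<Longrightarrow> unit_vec j \<in> cvec d"
  by (auto simp: unit_vec_def cvec_def)

text \<open>The identity is demanded for all sequences, so \<open>l\<close> reads only the first
  \<open>d\<close> coordinates and the linearity rules hold without membership in
  \<open>cvec d\<close>. The price is that operators have to truncate their arguments.\<close>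

definition linfun :: "nat \<Rightarrow> (cvector \<Rightarrow> complex) \<Rightarrow> bool" where
  "linfun d l \<longleftrightarrow> (\<forall>v. l v = (\<Sum>j<d. v j * l (unit_vec j)))"

definition linop :: "nat \<Rightarrow> (cvector \<Rightarrow> cvector) \<Rightarrow> bool" where
  "linop d L \<longleftrightarrow> (\<forall>v. L v \<in> cvec d) \<and> (\<forall>i. linfun d (\<lambda>v. L v i))"

lemma linfun_expand: "linfun d l \<Longrightarrow> l v = (\<Sum>j<d. v j * l (unit_vec j))"
  unfolding linfun_def by (drule spec[of _ v])

lemma linfun_sum:
  assumes "linfun d l"
  shows "l (\<lambda>i. \<Sum>k\<in>I. c k * u k i) = (\<Sum>k\<in>I. c k * l (u k))"
proof -
  have "l (\<lambda>i. \<Sum>k\<in>I. c k * u k i) = (\<Sum>j<d. \<Sum>k\<in>I. c k * u k j * l (unit_vec j))"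
    by (subst linfun_expand[OF assms]) (simp add: sum_distrib_right)
  also have "\<dots> = (\<Sum>k\<in>I. c k * (\<Sum>j<d. u k j * l (unit_vec j)))"
    by (subst sum.swap) (simp add: sum_distrib_left mult.assoc)
  finally show ?thesis unfolding linfun_expand[OF assms, symmetric] .
qed

lemma linfun_scale: "linfun d l \<Longrightarrow> l (\<lambda>i. c * v i) = c * l v"
  using linfun_sum[of d l "\<lambda>_. c" "\<lambda>_. v" "{0::nat}"] by simp

lemma linfun_add:
  assumes "linfun d l" shows "l (\<lambda>i. v i + w i) = l v + l w"
  unfolding linfun_expand[OF assms, of "\<lambda>i. v i + w i"] linfun_expand[OF assms, of v]
    linfun_expand[OF assms, of w]
  by (simp add: distrib_right sum.distrib)

lemma linfun_diff:
  assumes "linfun d l" shows "l (\<lambda>i. v i - w i) = l v - l w"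
  unfolding linfun_expand[OF assms, of "\<lambda>i. v i - w i"] linfun_expand[OF assms, of v]
    linfun_expand[OF assms, of w]
  by (simp add: left_diff_distrib sum_subtractf)

lemma linfun_zero: "linfun d l \<Longrightarrow> l (\<lambda>i. 0) = 0"
  by (subst linfun_expand) auto

lemma linfun_coord: "p < d \<Longrightarrow> linfun d (\<lambda>v. v p)"
  by (auto simp: linfun_def unit_vec_def if_distrib cong: if_cong)

lemma linfun_lincomb:
  assumes "\<And>k. k \<in> I \<Longrightarrow> linfun d (l k)"
  shows "linfun d (\<lambda>v. \<Sum>k\<in>I. c k * l k v)"
  unfolding linfun_def
proof
  fix v
  have "(\<Sum>k\<in>I. c k * l k v) = (\<Sum>k\<in>I. \<Sum>j<d. v j * (c k * l k (unit_vec j)))"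
    by (intro sum.cong refl, subst linfun_expand[OF assms]) (auto simp: sum_distrib_left mult_ac)
  then show "(\<Sum>k\<in>I. c k * l k v) = (\<Sum>j<d. v j * (\<Sum>k\<in>I. c k * l k (unit_vec j)))"
    by (subst (asm) sum.swap) (simp add: sum_distrib_left)
qed

lemma linfun_mult: "linfun d l \<Longrightarrow> linfun d (\<lambda>v. c * l v)"
  using linfun_lincomb[of "{0::nat}" d "\<lambda>_. l" "\<lambda>_. c"] by simp

lemma linfun_plus: "\<lbrakk>linfun d l; linfun d m\<rbrakk> \<Longrightarrow> linfun d (\<lambda>v. l v + m v)"
  using linfun_lincomb[of "UNIV :: bool set" d "\<lambda>b. if b then l else m" "\<lambda>_. 1"] by (simp add: UNIV_bool add.commute)

lemma linfun_minus: "\<lbrakk>linfun d l; linfun d m\<rbrakk> \<Longrightarrow> linfun d (\<lambda>v. l v - m v)"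
  using linfun_plus[OF _ linfun_mult[of d m "-1"], of l] by simp

lemma linop_linfun: "linop d L \<Longrightarrow> linfun d (\<lambda>v. L v i)"
  by (simp add: linop_def)

lemma linfun_linop: "\<lbrakk>linfun d l; linop d L\<rbrakk> \<Longrightarrow> linfun d (\<lambda>v. l (L v))"
  unfolding linfun_def[of d "\<lambda>v. l (L v)"]
proof
  fix v assume l: "linfun d l" and L: "linop d L"
  have "L v = (\<lambda>i. \<Sum>j<d. v j * L (unit_vec j) i)"
    by (rule ext) (rule linfun_expand[OF linop_linfun[OF L]])
  then show "l (L v) = (\<Sum>j<d. v j * l (L (unit_vec j)))"
    using linfun_sum[OF l, of "\<lambda>j. v j" "\<lambda>j. L (unit_vec j)"] by metis
qed

lemma linop_cvec: "linop d L \<Longrightarrow> L v \<in> cvec d"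
  by (simp add: linop_def)

lemma linop_scale: "linop d L \<Longrightarrow> L (\<lambda>i. c * v i) = (\<lambda>i. c * L v i)"
  using linfun_scale[OF linop_linfun] by blast

lemma linop_add: "linop d L \<Longrightarrow> L (\<lambda>i. v i + w i) = (\<lambda>i. L v i + L w i)"
  using linfun_add[OF linop_linfun] by blast

lemma linop_sum: "linop d L \<Longrightarrow> L (\<lambda>i. \<Sum>k\<in>I. c k * u k i) = (\<lambda>i. \<Sum>k\<in>I. c k * L (u k) i)"
  using linfun_sum[OF linop_linfun] by blast

lemma linop_comp: "\<lbrakk>linop d L; linop d M\<rbrakk> \<Longrightarrow> linop d (\<lambda>v. L (M v))"
  using linfun_linop[OF linop_linfun] by (auto simp: linop_def[of d "\<lambda>v. L (M v)"] linop_cvec)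

lemma cvec_add: "\<lbrakk>v \<in> cvec d; w \<in> cvec d\<rbrakk> \<Longrightarrow> (\<lambda>i. v i + w i) \<in> cvec d"
  and cvec_scale: "v \<in> cvec d \<Longrightarrow> (\<lambda>i. a * v i) \<in> cvec d"
  and cvec_diff: "\<lbrakk>v \<in> cvec d; w \<in> cvec d\<rbrakk> \<Longrightarrow> (\<lambda>i. v i - w i) \<in> cvec d"
  by (simp_all add: cvec_def)

lemma cvec_sum: "(\<And>k. k \<in> I \<Longrightarrow> u k \<in> cvec d) \<Longrightarrow> (\<lambda>i. \<Sum>k\<in>I. c k * u k i) \<in> cvec d"
  unfolding cvec_def by (auto intro!: sum.neutral)

section \<open>Independent sections and their local dual functionals\<close>

definition indep :: "nat \<Rightarrow> (nat \<Rightarrow> cvector) \<Rightarrow> bool" where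
  "indep k t \<longleftrightarrow> (\<forall>c. (\<forall>i. (\<Sum>j<k. c j * t j i) = 0) \<longrightarrow> (\<forall>j<k. c j = 0))"

definition csection :: "'x topology \<Rightarrow> nat \<Rightarrow> ('x \<Rightarrow> cvector) \<Rightarrow> bool" where
  "csection X d s \<longleftrightarrow> (\<forall>x\<in>topspace X. s x \<in> cvec d) \<and> (\<forall>i. continuous_map X euclidean (\<lambda>x. s x i))"

text \<open>A section of the dual bundle. Linearity is required at every \<open>x\<close>, also off
  the space; continuity is tested on unit vectors, whose values determine all others.\<close>

definition cfunctional :: "'x topology \<Rightarrow> nat \<Rightarrow> ('x \<Rightarrow> cvector \<Rightarrow> complex) \<Rightarrow> bool" where
  "cfunctional X d l \<longleftrightarrow> (\<forall>x. linfun d (l x)) \<and> (\<forall>j. continuous_map X euclidean (\<lambda>x. l x (unit_vec j)))"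

lemma cfunctional_section_continuous:
  assumes "cfunctional Y d l" "\<And>i. continuous_map Y euclidean (\<lambda>x. s x i)"
  shows "continuous_map Y euclidean (\<lambda>x. l x (s x))"
proof -
  have "l x (s x) = (\<Sum>j<d. s x j * l x (unit_vec j))" for x
    using assms(1) linfun_expand by (auto simp: cfunctional_def)
  then show ?thesis
    using assms by (simp add: cfunctional_def continuous_map_sum continuous_map_mult)
qed

text \<open>Gaussian elimination with a pivot chosen at \<open>x0\<close>: a coordinate in which the
  reduced vector of \<open>t k\<close> is nonzero at \<open>x0\<close> remains nonzero nearby, where
  dividing by it is continuous.\<close>

lemma local_dual_functionals:
  assumes "\<And>j. j < k \<Longrightarrow> csection X d (t j)" "x0 \<in> topspace X" "indep k (\<lambda>j. t j x0)"
  shows "\<exists>N l. openin X N \<and> x0 \<in> N \<and> (\<forall>i<k. cfunctional (subtopology X N) d (l i)) \<and>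
     (\<forall>y\<in>N. \<forall>i<k. \<forall>j<k. l i y (t j y) = (if i = j then 1 else 0))"
  using assms
proof (induction k)
  case 0
  then show ?case by auto
next
  case (Suc k)
  have "indep k (\<lambda>j. t j x0)"
    unfolding indep_def
  proof (intro allI impI)
    fix c j assume "\<forall>i. (\<Sum>j<k. c j * t j x0 i) = 0" "j < k"
    then show "c j = 0"
      using Suc.prems(3)[unfolded indep_def, rule_format, of "c(k := 0)" j] by simp
  qed
  then obtain N l where N: "openin X N" "x0 \<in> N"
    and l: "\<And>i. i < k \<Longrightarrow> cfunctional (subtopology X N) d (l i)"
    and dual: "\<And>y i j. \<lbrakk>y \<in> N; i < k; j < k\<rbrakk> \<Longrightarrow> l i y (t j y) = (if i = j then 1 else 0)"
    using Suc by (metis less_SucI)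
  \<comment> \<open>\<open>P y\<close> removes the part of \<open>v\<close> along the first
    \<open>k\<close> vectors; for \<open>y\<close> in \<open>N\<close> it kills each of
    these.\<close>
  define P where "P y v = (\<lambda>m. v m - (\<Sum>i<k. l i y v * t i y m))" for y v
  have tk: "csection X d (t j)" if "j \<le> k" for j using Suc.prems(1) that by simp
  have NX: "N \<subseteq> topspace X" using N openin_subset by blast
  have "\<exists>p. P x0 (t k x0) p \<noteq> 0"
  proof (rule ccontr)
    assume "\<not> ?thesis"
    then have "t k x0 m - (\<Sum>i<k. l i x0 (t k x0) * t i x0 m) = 0" for m by (simp add: P_def)
    then have "(\<Sum>j<Suc k. ((\<lambda>i. - l i x0 (t k x0))(k := 1)) j * t j x0 m) = 0" for m
      by (simp add: sum_negf)
    then have "((\<lambda>i. - l i x0 (t k x0))(k := 1)) k = 0"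
      using Suc.prems(3)[unfolded indep_def, rule_format, of "(\<lambda>i. - l i x0 (t k x0))(k := 1)" k]
      by blast
    then show False by simp
  qed
  then obtain p where p: "P x0 (t k x0) p \<noteq> 0" by blast
  have "P x0 (t k x0) \<in> cvec d"
    unfolding P_def using tk Suc.prems(2) by (intro cvec_diff cvec_sum) (auto simp: csection_def)
  then have pd: "p < d" using p by (metis (mono_tags, lifting) cvec_def mem_Collect_eq not_le)
  have lfin: "linfun d (l i y)" if "i < k" for i y using l[OF that] by (simp add: cfunctional_def)
  have Plin: "linfun d (\<lambda>v. P y v p)" for y
  proof -
    have "linfun d (\<lambda>v. \<Sum>i\<in>{..<k}. t i y p * l i y v)" using lfin by (intro linfun_lincomb) auto
    then show ?thesis
      unfolding P_def using linfun_minus[OF linfun_coord[OF pd]] by (simp add: mult.commute)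
  qed
  have Pcont: "continuous_map (subtopology X N) euclidean (\<lambda>y. P y (s y) p)"
    if "\<And>i. continuous_map (subtopology X N) euclidean (\<lambda>x. s x i)" for s
    unfolding P_def
    by (intro continuous_map_diff continuous_map_sum continuous_map_mult that
        cfunctional_section_continuous[OF l]) (use tk in \<open>auto simp: csection_def continuous_map_from_subtopology\<close>)
  have tcont: "continuous_map (subtopology X N) euclidean (\<lambda>x. t k x i)" for i
    using tk[of k] by (auto simp: csection_def continuous_map_from_subtopology)
  define q where "q y = P y (t k y) p" for y
  have qcont: "continuous_map (subtopology X N) euclidean q"
    unfolding q_def[abs_def] by (rule Pcont[OF tcont])
  define N' where "N' = {y \<in> topspace (subtopology X N). q y \<in> - {0}}"
  have "openin (subtopology X N) N'"
    unfolding N'_def by (rule openin_continuous_map_preimage[OF qcont]) auto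
  then have N': "openin X N'" using N(1) openin_trans_full by blast
  have N'N: "N' \<subseteq> N" by (auto simp: N'_def)
  have qne: "q y \<noteq> 0" if "y \<in> N'" for y using that by (simp add: N'_def)
  have x0N': "x0 \<in> N'" using p N NX by (auto simp: N'_def q_def)
  define lk where "lk y v = inverse (q y) * P y v p" for y v
  \<comment> \<open>On \<open>N'\<close>, \<open>lk\<close> is 1 on \<open>t k\<close> and 0 on the
    earlier vectors. The earlier functionals are corrected by the multiple of \<open>lk\<close> that
    makes them vanish on \<open>t k\<close>.\<close>
  define l' where "l' i y v = (if i = k then lk y v else l i y v - l i y (t k y) * lk y v)" for i y v
  have sub: "subtopology (subtopology X N) N' = subtopology X N'"
    using N'N by (simp add: subtopology_subtopology inf.absorb2)
  have qinv: "continuous_map (subtopology X N') euclidean (\<lambda>y. inverse (q y))"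
  proof -
    have "continuous_map (subtopology X N') euclidean (\<lambda>y. 1 / q y)"
      using qne qcont sub by (intro continuous_map_divide_complex) (auto, metis continuous_map_from_subtopology)
    then show ?thesis by (simp add: divide_inverse)
  qed
  have rest: "continuous_map (subtopology X N') euclidean f" if "continuous_map (subtopology X N) euclidean f"
    for f :: "'a \<Rightarrow> complex" using that sub by (metis continuous_map_from_subtopology)
  have lkfun: "linfun d (lk y)" for y unfolding lk_def by (rule linfun_mult[OF Plin])
  have lkcont: "continuous_map (subtopology X N') euclidean (\<lambda>y. lk y (unit_vec j))" for j
    unfolding lk_def by (intro continuous_map_mult qinv rest Pcont) auto
  have "cfunctional (subtopology X N') d (l' i)" if "i < Suc k" for i
  proof (cases "i = k")
    case True
    have "l' k = lk" by (intro ext) (simp add: l'_def)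
    then show ?thesis using lkfun lkcont True by (simp add: cfunctional_def)
  next
    case False
    then have i: "i < k" using that by simp
    have "linfun d (l' i y)" for y
      unfolding l'_def using False by (simp add: linfun_minus[OF lfin[OF i] linfun_mult[OF lkfun]])
    moreover have "continuous_map (subtopology X N') euclidean (\<lambda>y. l' i y (unit_vec j))" for j
    proof -
      have 1: "continuous_map (subtopology X N') euclidean (\<lambda>y. l i y (unit_vec j))"
        using l[OF i] by (intro rest) (simp add: cfunctional_def)
      have 2: "continuous_map (subtopology X N') euclidean (\<lambda>y. l i y (t k y))"
        by (intro rest cfunctional_section_continuous[OF l[OF i]] tcont)
      show ?thesis
        using continuous_map_diff[OF 1 continuous_map_mult[OF 2 lkcont]] False by (simp add: l'_def)
    qed
    ultimately show ?thesis by (simp add: cfunctional_def)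
  qed
  moreover have "l' i y (t j y) = (if i = j then 1 else 0)" if y: "y \<in> N'" and ij: "i < Suc k" "j < Suc k" for y i j
  proof -
    have yN: "y \<in> N" using y N'N by blast
    have lk0: "lk y (t j y) = 0" if "j < k" for j
    proof -
      have "(\<Sum>i<k. l i y (t j y) * t i y p) = (\<Sum>i<k. if i = j then t i y p else 0)"
        by (intro sum.cong) (auto simp: dual[OF yN _ that])
      then show ?thesis using that by (simp add: lk_def P_def)
    qed
    moreover have "lk y (t k y) = 1" using qne[OF y] by (simp add: lk_def q_def)
    ultimately show ?thesis using ij dual[OF yN] by (auto simp: l'_def less_Suc_eq)
  qed
  ultimately show ?case using N' x0N' by (intro exI[of _ N'] exI[of _ l']) auto
qed

lemma indep_extend_by_unit:
  assumes k: "k < d" and t: "\<And>j. j < k \<Longrightarrow> t j \<in> cvec d"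
    and l: "\<And>i. i < k \<Longrightarrow> linfun d (l i)"
    and dual: "\<And>i j. \<lbrakk>i < k; j < k\<rbrakk> \<Longrightarrow> l i (t j) = (if i = j then 1 else 0)"
  obtains p where "p < d" "\<And>c. unit_vec p \<noteq> (\<lambda>m. \<Sum>i<k. c i * t i m)"
proof -
  have "\<exists>p<d. unit_vec p \<noteq> (\<lambda>m. \<Sum>i<k. l i (unit_vec p) * t i m)"
  proof (rule ccontr)
    assume "\<not> ?thesis"
    then have eq: "unit_vec p p = (\<Sum>i<k. l i (unit_vec p) * t i p)" if "p < d" for p
      using that by metis
    \<comment> \<open>the trace of the projection onto the span, computed in two ways\<close>
    have "(of_nat d :: complex) = (\<Sum>p<d. unit_vec p p)" by (simp add: unit_vec_def)
    also have "\<dots> = (\<Sum>i<k. \<Sum>p<d. t i p * l i (unit_vec p))"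
      by (subst sum.swap) (simp add: eq mult.commute)
    also have "\<dots> = (\<Sum>i<k. l i (t i))"
      by (intro sum.cong refl linfun_expand[symmetric] l) simp
    also have "\<dots> = of_nat k" by (simp add: dual)
    finally show False using k by (simp only: of_nat_eq_iff)
  qed
  then obtain p where p: "p < d" "unit_vec p \<noteq> (\<lambda>m. \<Sum>i<k. l i (unit_vec p) * t i m)" by blast
  \<comment> \<open>The functionals \<open>l\<close> read off the coefficients of any combination,
    so excluding the single choice \<open>l i (unit_vec p)\<close> excludes all.\<close>
  have "unit_vec p \<noteq> (\<lambda>m. \<Sum>i<k. c i * t i m)" for c
  proof
    assume eq: "unit_vec p = (\<lambda>m. \<Sum>i<k. c i * t i m)"
    have "l i (unit_vec p) = c i" if "i < k" for i
    proof -
      have "l i (unit_vec p) = (\<Sum>j<k. c j * l i (t j))"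
        unfolding eq by (rule linfun_sum[OF l[OF that]])
      also have "\<dots> = (\<Sum>j<k. if j = i then c j else 0)"
        by (intro sum.cong) (auto simp: dual that)
      finally show ?thesis using that by simp
    qed
    then have "(\<lambda>m. \<Sum>i<k. l i (unit_vec p) * t i m) = unit_vec p" using eq by simp
    then show False using p(2) by simp
  qed
  with p(1) that show ?thesis by blast
qed

lemma indep_Suc:
  assumes "indep k t" "\<And>c. v \<noteq> (\<lambda>m. \<Sum>i<k. c i * t i m)"
  shows "indep (Suc k) (t(k := v))"
  unfolding indep_def
proof (intro allI impI)
  fix c j assume c: "\<forall>i. (\<Sum>j<Suc k. c j * (t(k := v)) j i) = 0" and j: "j < Suc k"
  then have sum: "(\<Sum>j<k. c j * t j i) + c k * v i = 0" for i by simp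
  have ck: "c k = 0"
  proof (rule ccontr)
    assume "c k \<noteq> 0"
    then have "v i = (\<Sum>j<k. (- c j / c k) * t j i)" for i
      using sum[of i] by (simp add: sum_negf sum_divide_distrib[symmetric] field_simps add_eq_0_iff)
    then show False using assms(2)[of "\<lambda>j. - c j / c k"] by blast
  qed
  then have "(\<Sum>j<k. c j * t j i) = 0" for i using sum[of i] by simp
  then show "c j = 0" using assms(1) ck j unfolding indep_def less_Suc_eq by blast
qed

section \<open>Equivariant sections and functionals\<close>

text \<open>The equivariant bundle in a trivialization: \<open>a g x\<close> maps the fibre over
  \<open>x\<close> to the fibre over \<open>\<phi> g x\<close>, and \<open>a_comp\<close> is the
  cocycle identity. \<open>a_stabilizer\<close> expresses the assumption on isotropy groups; it
  speaks of \<open>cvec d\<close> because \<open>a g x\<close> sends every sequence into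
  \<open>cvec d\<close>.\<close>

locale equivariant_family = smooth_G_manifold G n X A \<phi>
  for G :: "('g, 'z) monoid_scheme" (structure)
    and n :: nat and X :: "'x topology" and A :: "'x chart set" and \<phi> :: "'g \<Rightarrow> 'x \<Rightarrow> 'x" +
  fixes d :: nat and a :: "'g \<Rightarrow> 'x \<Rightarrow> cvector \<Rightarrow> cvector"
  assumes a_linop: "\<lbrakk>g \<in> carrier G; x \<in> topspace X\<rbrakk> \<Longrightarrow> linop d (a g x)"
    and a_continuous: "\<lbrakk>g \<in> carrier G; j < d\<rbrakk> \<Longrightarrow> continuous_map X euclidean (\<lambda>x. a g x (unit_vec j) i)"
    and a_comp: "\<lbrakk>g \<in> carrier G; h \<in> carrier G; x \<in> topspace X\<rbrakk> \<Longrightarrow> a (g \<otimes> h) x v = a g (\<phi> h x) (a h x v)"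
    and a_stabilizer: "\<lbrakk>g \<in> carrier G; x \<in> topspace X; \<phi> g x = x; v \<in> cvec d\<rbrakk> \<Longrightarrow> a g x v = v"
begin

definition sections :: "('x \<Rightarrow> cvector) set" where
  "sections = {s. csection X d s \<and> (\<forall>g\<in>carrier G. \<forall>x\<in>topspace X. s (\<phi> g x) = a g x (s x))}"

text \<open>Equivariant sections of the dual bundle. The condition makes the pairing with an
  equivariant section an invariant function.\<close>

definition functionals :: "('x \<Rightarrow> cvector \<Rightarrow> complex) set" where
  "functionals = {l. cfunctional X d l \<and>
     (\<forall>g\<in>carrier G. \<forall>x\<in>topspace X. \<forall>v. l (\<phi> g x) (a g x v) = l x v)}"

lemma sectionsD:
  assumes "s \<in> sections"
  shows sections_csection: "csection X d s"
    and sections_cvec: "x \<in> topspace X \<Longrightarrow> s x \<in> cvec d"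
    and sections_continuous: "continuous_map X euclidean (\<lambda>x. s x i)"
    and sections_equivariant: "\<lbrakk>g \<in> carrier G; x \<in> topspace X\<rbrakk> \<Longrightarrow> s (\<phi> g x) = a g x (s x)"
  using assms by (auto simp: sections_def csection_def)

lemma functionalsD:
  assumes "l \<in> functionals"
  shows functionals_cfunctional: "cfunctional X d l"
    and functionals_linfun: "linfun d (l x)"
    and functionals_continuous: "continuous_map X euclidean (\<lambda>x. l x (unit_vec j))"
    and functionals_equivariant: "\<lbrakk>g \<in> carrier G; x \<in> topspace X\<rbrakk> \<Longrightarrow> l (\<phi> g x) (a g x v) = l x v"
  using assms by (auto simp: functionals_def cfunctional_def)

lemma a_section_continuous:
  assumes "g \<in> carrier G" "\<And>i. continuous_map X euclidean (\<lambda>x. s x i)"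
  shows "continuous_map X euclidean (\<lambda>x. a g x (s x) i)"
proof -
  have "continuous_map X euclidean (\<lambda>x. \<Sum>j<d. s x j * a g x (unit_vec j) i)"
    using assms a_continuous by (intro continuous_map_sum continuous_map_mult) auto
  then show ?thesis
  proof (rule continuous_map_eq)
    fix x assume "x \<in> topspace X"
    then show "(\<Sum>j<d. s x j * a g x (unit_vec j) i) = a g x (s x) i"
      by (rule linfun_expand[OF linop_linfun[OF a_linop[OF assms(1)]], symmetric])
  qed
qed

lemma pairing_continuous:
  "\<lbrakk>l \<in> functionals; s \<in> sections\<rbrakk> \<Longrightarrow> continuous_map X euclidean (\<lambda>x. l x (s x))"
  by (rule cfunctional_section_continuous[OF functionals_cfunctional sections_continuous])

lemma pairing_invariant: "\<lbrakk>l \<in> functionals; s \<in> sections\<rbrakk> \<Longrightarrow> invariant (\<lambda>x. l x (s x))"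
  by (simp add: invariant_def functionals_equivariant sections_equivariant)

lemma sections_add:
  assumes "s \<in> sections" "t \<in> sections" shows "(\<lambda>x i. s x i + t x i) \<in> sections"
  using assms
  by (simp add: sections_def csection_def cvec_add continuous_map_add linop_add[OF a_linop])

lemma sections_mult:
  assumes q: "continuous_map X euclidean q" "invariant q" and s: "s \<in> sections"
  shows "(\<lambda>x i. q x * s x i) \<in> sections"
  using assms
  by (simp add: sections_def csection_def cvec_scale continuous_map_mult linop_scale[OF a_linop] invariantD)

lemma sections_zero: "(\<lambda>x i. 0) \<in> sections"
proof -
  have "a g x (\<lambda>i. 0) = (\<lambda>i. 0)" if "g \<in> carrier G" "x \<in> topspace X" for g x
    using linfun_zero[OF linop_linfun[OF a_linop[OF that]]] by auto
  then show ?thesis by (simp add: sections_def csection_def cvec_def)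
qed

lemma sections_sum:
  assumes "finite I" "\<And>k. k \<in> I \<Longrightarrow> s k \<in> sections"
  shows "(\<lambda>x i. \<Sum>k\<in>I. s k x i) \<in> sections"
  using assms by (induction I) (auto simp: sections_zero intro!: sections_add)

lemma functionals_add:
  assumes "l \<in> functionals" "m \<in> functionals" shows "(\<lambda>x v. l x v + m x v) \<in> functionals"
  using assms by (simp add: functionals_def cfunctional_def linfun_plus continuous_map_add)

lemma functionals_mult:
  assumes q: "continuous_map X euclidean q" "invariant q" and s: "l \<in> functionals"
  shows "(\<lambda>x v. q x * l x v) \<in> functionals"
  using assms
  by (simp add: functionals_def cfunctional_def linfun_mult continuous_map_mult invariantD)

text \<open>Averaging over the group; the value at \<open>x0\<close> survives because the isotropy group acts trivially
  on the fibre and the bump function separates \<open>x0\<close> from the rest of its orbit.\<close>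

lemma equivariant_section_through:
  assumes x0: "x0 \<in> topspace X" and v: "v \<in> cvec d"
  obtains t where "t \<in> sections" "t x0 = v"
proof -
  \<comment> \<open>The rest of the orbit is finite, hence closed in a Hausdorff space, and can be
    cut out of the neighbourhood.\<close>
  define N where "N = topspace X - {y. \<exists>g\<in>carrier G. y = \<phi> g x0 \<and> y \<noteq> x0}"
  have "finite {y. \<exists>g\<in>carrier G. y = \<phi> g x0 \<and> y \<noteq> x0}"
    by (rule finite_subset[of _ "(\<lambda>g. \<phi> g x0) ` carrier G"]) (use fin in auto)
  moreover have "{y. \<exists>g\<in>carrier G. y = \<phi> g x0 \<and> y \<noteq> x0} \<subseteq> topspace X" using act_in x0 by auto
  ultimately have "closedin X {y. \<exists>g\<in>carrier G. y = \<phi> g x0 \<and> y \<noteq> x0}"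
    using Hausdorff_imp_t1_space[OF Hausdorff] t1_space_closedin_finite by blast
  then have N: "openin X N" "x0 \<in> N" using x0 by (auto simp: N_def)
  obtain \<beta> K where \<beta>: "\<And>y. y \<in> topspace X \<Longrightarrow> Lipschitz_at \<beta> y" "\<And>y. \<beta> y \<ge> 0" "\<beta> x0 = 1"
    "compactin X K" "K \<subseteq> N" "\<And>y. y \<notin> K \<Longrightarrow> \<beta> y = 0"
    by (rule Lipschitz_bump[OF x0 N]) blast
  define t where "t w x = (\<lambda>i. \<Sum>g\<in>carrier G. complex_of_real (\<beta> (\<phi> g x)) * a (inv g) (\<phi> g x) w i)" for w x
  have t: "t w \<in> sections" if w: "w \<in> cvec d" for w
    unfolding sections_def csection_def
  proof (intro CollectI conjI ballI allI)
    fix x assume x: "x \<in> topspace X"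
    show "t w x \<in> cvec d"
      unfolding t_def by (intro cvec_sum linop_cvec a_linop) (auto simp: act_in x)
    fix h assume h: "h \<in> carrier G"
    have "t w (\<phi> h x) i = a h x (t w x) i" for i
    proof -
      \<comment> \<open>\<open>inv g\<close> is written as
        \<open>h \<otimes> inv (g \<otimes> h)\<close>, so that the summand depends on
        \<open>g\<close> only through \<open>g \<otimes> h\<close> and the sum can be
        translated.\<close>
      have "t w (\<phi> h x) i = (\<Sum>g\<in>carrier G. complex_of_real (\<beta> (\<phi> (g \<otimes> h) x)) * a (h \<otimes> inv (g \<otimes> h)) (\<phi> (g \<otimes> h) x) w i)"
        unfolding t_def using h x
        by (intro sum.cong) (auto simp: act_comp inv_mult_group simp flip: m_assoc)
      also have "\<dots> = (\<Sum>g\<in>carrier G. complex_of_real (\<beta> (\<phi> g x)) * a (h \<otimes> inv g) (\<phi> g x) w i)"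
        by (rule sum_translate[OF h])
      also have "\<dots> = (\<Sum>g\<in>carrier G. complex_of_real (\<beta> (\<phi> g x)) * a h x (a (inv g) (\<phi> g x) w) i)"
        using h x by (intro sum.cong) (auto simp: a_comp act_in act_inv)
      also have "\<dots> = a h x (t w x) i"
        unfolding t_def by (simp add: linop_sum[OF a_linop[OF h x]])
      finally show ?thesis .
    qed
    then show "t w (\<phi> h x) = a h x (t w x)" by auto
  next
    fix i
    have \<beta>c: "continuous_map X euclidean (\<lambda>x. complex_of_real (\<beta> x))"
      using \<beta>(1) by (intro continuous_map_of_real Lipschitz_imp_continuous_map)
    have "continuous_map X euclidean (\<lambda>x. complex_of_real (\<beta> x) * a (inv g) x w i)" if "g \<in> carrier G" for g
      using that by (intro continuous_map_mult \<beta>c a_section_continuous) auto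
    then have "continuous_map X euclidean (\<lambda>x. complex_of_real (\<beta> (\<phi> g x)) * a (inv g) (\<phi> g x) w i)"
      if "g \<in> carrier G" for g
      using continuous_map_compose[OF act_continuous[OF that]] that by (auto simp: o_def)
    then show "continuous_map X euclidean (\<lambda>x. t w x i)"
      unfolding t_def using fin by (intro continuous_map_sum) auto
  qed
  define H where "H = {g \<in> carrier G. \<phi> g x0 = x0}"
  have tx0: "t w x0 i = of_nat (card H) * w i" if w: "w \<in> cvec d" for w i
  proof -
    have "t w x0 i = (\<Sum>g\<in>carrier G. if g \<in> H then w i else 0)"
      unfolding t_def
    proof (intro sum.cong refl)
      fix g assume g: "g \<in> carrier G"
      show "complex_of_real (\<beta> (\<phi> g x0)) * a (inv g) (\<phi> g x0) w i = (if g \<in> H then w i else 0)"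
      proof (cases "\<phi> g x0 = x0")
        case True
        then have "\<phi> (inv g) x0 = x0" using act_inv[OF g x0] by simp
        then have "a (inv g) x0 w = w" using a_stabilizer[of "inv g"] g x0 w by simp
        then show ?thesis using True g \<beta>(3) by (simp add: H_def)
      next
        case False
        then have "\<phi> g x0 \<notin> N" using g by (auto simp: N_def)
        then have "\<beta> (\<phi> g x0) = 0" using \<beta>(5,6) by blast
        then show ?thesis using False by (simp add: H_def)
      qed
    qed
    also have "\<dots> = (\<Sum>g\<in>H. w i)"
      using fin by (simp add: sum.If_cases H_def Int_def)
    finally show ?thesis by simp
  qed
  have "\<one> \<in> H" using x0 by (simp add: H_def act_one)
  then have H: "card H > 0" using fin by (auto simp: H_def card_gt_0_iff)
  \<comment> \<open>At \<open>x0\<close> exactly the elements of the isotropy group contribute, each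
    of them the vector \<open>w\<close>.\<close>
  define w where "w = (\<lambda>i. (1 / of_nat (card H)) * v i)"
  have w: "w \<in> cvec d" unfolding w_def by (rule cvec_scale[OF v])
  have "t w x0 = v" using tx0[OF w] H by (auto simp: w_def)
  with t[OF w] that show ?thesis by blast
qed

text \<open>The missing vectors at \<open>x0\<close> can be taken among the unit vectors, and
  through each of them passes an equivariant section. Independence is claimed at \<open>x0\<close>,
  hence available nearby.\<close>

lemma extend_to_frame_at:
  assumes x0: "x0 \<in> topspace X" and t: "\<And>j. j < k \<Longrightarrow> t j \<in> sections"
    and ind: "indep k (\<lambda>j. t j x0)" and "k \<le> d"
  obtains t' where "\<And>j. j < k \<Longrightarrow> t' j = t j" "\<And>j. j < d \<Longrightarrow> t' j \<in> sections" "indep d (\<lambda>j. t' j x0)"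
proof -
  have "\<exists>t'. (\<forall>j<k. t' j = t j) \<and> (\<forall>j<k + m. t' j \<in> sections) \<and> indep (k + m) (\<lambda>j. t' j x0)"
    if "k + m \<le> d" for m
    using that
  proof (induction m)
    case 0
    then show ?case using t ind by auto
  next
    case (Suc m)
    then obtain t' where t': "\<And>j. j < k \<Longrightarrow> t' j = t j" "\<And>j. j < k + m \<Longrightarrow> t' j \<in> sections"
      "indep (k + m) (\<lambda>j. t' j x0)" by auto
    have "\<exists>N l. openin X N \<and> x0 \<in> N \<and> (\<forall>i<k+m. cfunctional (subtopology X N) d (l i)) \<and>
     (\<forall>y\<in>N. \<forall>i<k+m. \<forall>j<k+m. l i y (t' j y) = (if i = j then 1 else 0))"
      using t' x0 by (intro local_dual_functionals sections_csection) auto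
    then obtain N l where N: "x0 \<in> N" and l: "\<forall>i<k+m. cfunctional (subtopology X N) d (l i)"
      and dual: "\<forall>y\<in>N. \<forall>i<k+m. \<forall>j<k+m. l i y (t' j y) = (if i = j then 1 else 0)"
      by (elim exE conjE)
    obtain p where p: "p < d" "\<And>c. unit_vec p \<noteq> (\<lambda>q. \<Sum>i<k+m. c i * t' i x0 q)"
    proof (rule indep_extend_by_unit[of "k + m" d "\<lambda>j. t' j x0" "\<lambda>i. l i x0"])
      show "t' j x0 \<in> cvec d" if "j < k + m" for j using t'(2)[OF that] x0 by (rule sections_cvec)
      show "linfun d (l i x0)" if "i < k + m" for i using l that by (simp add: cfunctional_def)
    qed (use Suc.prems N dual that in auto)
    obtain s where s: "s \<in> sections" "s x0 = unit_vec p"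
      using equivariant_section_through[OF x0 unit_vec_cvec[OF p(1)]] by blast
    have "indep (Suc (k + m)) ((\<lambda>j. t' j x0)(k + m := unit_vec p))"
      by (rule indep_Suc[OF t'(3) p(2)])
    moreover have "(\<lambda>j. t' j x0)(k + m := unit_vec p) = (\<lambda>j. (t'(k + m := s)) j x0)"
      using s(2) by auto
    ultimately have "indep (k + Suc m) (\<lambda>j. (t'(k + m := s)) j x0)" by simp
    then show ?case using t' s
      by (intro exI[of _ "t'(k + m := s)"]) (auto simp: less_Suc_eq)
  qed
  from this[of "d - k"] \<open>k \<le> d\<close> that show ?thesis by auto
qed

text \<open>Dual functionals exist near \<open>x0\<close>; a bump and averaging make them global and
  equivariant, at the cost of turning the identity matrix into \<open>\<kappa>\<close> times it. No
  mixed terms arise: equivariance of the frame turns \<open>a g x (t' j x)\<close> into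
  \<open>t' j (\<phi> g x)\<close>, where duality holds before averaging.\<close>

lemma dual_frame_at:
  assumes x0: "x0 \<in> topspace X" and t: "\<And>j. j < k \<Longrightarrow> t j \<in> sections"
    and ind: "indep k (\<lambda>j. t j x0)" and "k \<le> d"
  obtains t' l \<kappa> C where "\<And>j. j < k \<Longrightarrow> t' j = t j" "\<And>j. j < d \<Longrightarrow> t' j \<in> sections"
    "\<And>i. i < d \<Longrightarrow> l i \<in> functionals"
    "continuous_map X euclideanreal \<kappa>" "invariant \<kappa>" "\<And>x. \<kappa> x \<ge> 0" "\<kappa> x0 > 0"
    "compactin X C" "\<And>x. \<lbrakk>x \<in> topspace X; x \<notin> C\<rbrakk> \<Longrightarrow> \<kappa> x = 0"
    "\<And>x i j. \<lbrakk>x \<in> topspace X; i < d; j < d\<rbrakk> \<Longrightarrow> l i x (t' j x) = (if i = j then complex_of_real (\<kappa> x) else 0)"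
proof -
  obtain t' where t': "\<And>j. j < k \<Longrightarrow> t' j = t j" "\<And>j. j < d \<Longrightarrow> t' j \<in> sections" "indep d (\<lambda>j. t' j x0)"
    using extend_to_frame_at[of x0 k t] assms by metis
  have "\<exists>N l. openin X N \<and> x0 \<in> N \<and> (\<forall>i<d. cfunctional (subtopology X N) d (l i)) \<and>
     (\<forall>y\<in>N. \<forall>i<d. \<forall>j<d. l i y (t' j y) = (if i = j then 1 else 0))"
    using t' x0 by (intro local_dual_functionals sections_csection) auto
  then obtain N l where N: "openin X N" "x0 \<in> N"
    and l': "\<forall>i<d. cfunctional (subtopology X N) d (l i)"
    and dual': "\<forall>y\<in>N. \<forall>i<d. \<forall>j<d. l i y (t' j y) = (if i = j then 1 else 0)"
    by (elim exE conjE)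
  have l: "cfunctional (subtopology X N) d (l i)" if "i < d" for i using l' that by simp
  have dual: "l i y (t' j y) = (if i = j then 1 else 0)" if "y \<in> N" "i < d" "j < d" for y i j
    using dual' that by simp
  obtain \<beta> K where \<beta>: "\<And>y. y \<in> topspace X \<Longrightarrow> Lipschitz_at \<beta> y" "\<And>y. \<beta> y \<ge> 0" "\<beta> x0 = 1"
    "compactin X K" "K \<subseteq> N" "\<And>y. y \<notin> K \<Longrightarrow> \<beta> y = 0"
    by (rule Lipschitz_bump[OF x0 N]) blast
  have \<beta>c: "continuous_map X euclideanreal \<beta>" using \<beta>(1) by (rule Lipschitz_imp_continuous_map)
  define \<kappa> where "\<kappa> x = (\<Sum>g\<in>carrier G. \<beta> (\<phi> g x))" for x
  define m where "m i x v = (\<Sum>g\<in>carrier G. complex_of_real (\<beta> (\<phi> g x)) * l i (\<phi> g x) (a g x v))" for i x v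
  \<comment> \<open>Off \<open>X\<close> nothing is known about \<open>a g x\<close>, while
    \<open>cfunctional\<close> asks for linearity at every \<open>x\<close>; hence the default
    0.\<close>
  define m' where "m' i x v = (if x \<in> topspace X then m i x v else 0)" for i x v
  have lin: "linfun d (l i y)" if "i < d" for i y using l[OF that] by (simp add: cfunctional_def)
  have Kc: "closedin X K" using compactin_imp_closedin[OF Hausdorff \<beta>(4)] .
  have term_cont: "continuous_map X euclidean (\<lambda>x. complex_of_real (\<beta> x) * l i x (unit_vec j))" if "i < d" for i j
    using l[OF that] \<beta>(6)
    by (intro continuous_map_extend_by_zero[OF N(1) _ _ Kc \<beta>(5)] continuous_map_of_real \<beta>c) (auto simp: cfunctional_def)
  have mf: "m' i \<in> functionals" if i: "i < d" for i
    unfolding functionals_def cfunctional_def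
  proof (intro CollectI conjI ballI allI)
    fix x
    show "linfun d (m' i x)"
    proof (cases "x \<in> topspace X")
      case True
      then have "linfun d (m i x)"
        unfolding m_def using i by (intro linfun_lincomb linfun_linop[OF lin a_linop]) auto
      then show ?thesis using True by (simp add: m'_def[abs_def])
    next
      case False
      then show ?thesis by (simp add: m'_def[abs_def] linfun_def)
    qed
  next
    fix j
    show "continuous_map X euclidean (\<lambda>x. m' i x (unit_vec j))"
    proof (cases "j < d")
      case False
      then have "a g x (unit_vec j) = (\<lambda>i. 0)" if "g \<in> carrier G" "x \<in> topspace X" for g x
        by (rule_tac ext, subst linfun_expand[OF linop_linfun[OF a_linop[OF that]]])
          (auto simp: unit_vec_def intro!: sum.neutral)
      then have "m' i x (unit_vec j) = 0" for x
        using linfun_zero[OF lin[OF i]] by (auto simp: m'_def m_def intro!: sum.neutral)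
      then show ?thesis by simp
    next
      case True
      have *: "continuous_map X euclidean (\<lambda>x. complex_of_real (\<beta> (\<phi> g x)) * l i (\<phi> g x) (unit_vec k))"
        if "g \<in> carrier G" for g k
        using continuous_map_compose[OF act_continuous[OF that] term_cont[OF i]] by (simp add: o_def)
      have "continuous_map X euclidean (\<lambda>x. \<Sum>g\<in>carrier G. \<Sum>k<d. a g x (unit_vec j) k *
          (complex_of_real (\<beta> (\<phi> g x)) * l i (\<phi> g x) (unit_vec k)))"
        using fin by (intro continuous_map_sum continuous_map_mult[OF a_continuous[OF _ True] *]) auto
      then show ?thesis
      proof (rule continuous_map_eq)
        fix x assume x: "x \<in> topspace X"
        have "l i (\<phi> g x) (a g x (unit_vec j)) = (\<Sum>k<d. a g x (unit_vec j) k * l i (\<phi> g x) (unit_vec k))" for g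
          by (rule linfun_expand[OF lin[OF i]])
        then show "(\<Sum>g\<in>carrier G. \<Sum>k<d. a g x (unit_vec j) k *
          (complex_of_real (\<beta> (\<phi> g x)) * l i (\<phi> g x) (unit_vec k))) = m' i x (unit_vec j)"
          using x by (simp add: m'_def m_def sum_distrib_left mult_ac)
      qed
    qed
  next
    fix h x v assume h: "h \<in> carrier G" and x: "x \<in> topspace X"
    have "m i (\<phi> h x) (a h x v) = (\<Sum>g\<in>carrier G. complex_of_real (\<beta> (\<phi> (g \<otimes> h) x)) * l i (\<phi> (g \<otimes> h) x) (a (g \<otimes> h) x v))"
      unfolding m_def using h x by (intro sum.cong) (auto simp: act_comp a_comp)
    also have "\<dots> = m i x v" unfolding m_def by (rule sum_translate[OF h])
    finally show "m' i (\<phi> h x) (a h x v) = m' i x v" using h x act_in by (simp add: m'_def)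
  qed
  have pair: "m' i x (t' j x) = (if i = j then complex_of_real (\<kappa> x) else 0)"
    if "x \<in> topspace X" "i < d" "j < d" for x i j
  proof -
    have "complex_of_real (\<beta> (\<phi> g x)) * l i (\<phi> g x) (a g x (t' j x))
        = (if i = j then complex_of_real (\<beta> (\<phi> g x)) else 0)" if g: "g \<in> carrier G" for g
    proof (cases "\<phi> g x \<in> N")
      case True
      have "a g x (t' j x) = t' j (\<phi> g x)"
        using sections_equivariant[OF t'(2)] g \<open>x \<in> topspace X\<close> \<open>j < d\<close> by simp
      then show ?thesis using dual[OF True] \<open>i < d\<close> \<open>j < d\<close> by simp
    next
      case False
      then have "\<beta> (\<phi> g x) = 0" using \<beta>(5,6) by blast
      then show ?thesis by simp
    qed
    then show ?thesis using that(1) by (simp add: m'_def m_def \<kappa>_def)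
  qed
  show ?thesis
  proof (rule that[of t' m' \<kappa> "\<Union>g\<in>carrier G. \<phi> g ` K"])
    show "continuous_map X euclideanreal \<kappa>"
      unfolding \<kappa>_def using fin continuous_map_compose[OF act_continuous \<beta>c]
      by (intro continuous_map_sum) (auto simp: o_def)
    show "invariant \<kappa>" unfolding \<kappa>_def by (rule invariant_sum_orbit)
    show "\<kappa> x \<ge> 0" for x unfolding \<kappa>_def using \<beta>(2) by (simp add: sum_nonneg)
    have "\<beta> (\<phi> \<one> x0) \<le> \<kappa> x0"
      unfolding \<kappa>_def using \<beta>(2) fin by (intro member_le_sum) auto
    then show "\<kappa> x0 > 0" using x0 \<beta>(3) by (simp add: act_one)
    show "compactin X (\<Union>g\<in>carrier G. \<phi> g ` K)" by (rule compactin_orbit[OF \<beta>(4)])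
    show "\<kappa> x = 0" if "x \<in> topspace X" "x \<notin> (\<Union>g\<in>carrier G. \<phi> g ` K)" for x
      unfolding \<kappa>_def using \<beta>(6) not_in_orbit[OF that] by (intro sum.neutral) blast
  qed (use t' mf pair in auto)
qed

end

section \<open>General position\<close>

text \<open>\<open>True\<close> selects the real and \<open>False\<close> the imaginary part, so
  that a pair of an index and a \<open>bool\<close> numbers the real coordinates of a complex
  vector. \<open>one_i\<close> is the real basis dual to these coordinates.\<close>

definition re_im :: "bool \<Rightarrow> complex \<Rightarrow> real" where
  "re_im b z = (if b then Re z else Im z)"

definition one_i :: "bool \<Rightarrow> complex" where
  "one_i b = (if b then 1 else \<i>)"

lemma re_im_one_i: "re_im b (complex_of_real x * one_i b') = (if b = b' then x else 0)"
  by (auto simp: re_im_def one_i_def)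

lemma re_im_add: "re_im b (z + w) = re_im b z + re_im b w"
  by (auto simp: re_im_def)

lemma re_im_sum: "re_im b (\<Sum>k\<in>I. f k) = (\<Sum>k\<in>I. re_im b (f k))"
  by (auto simp: re_im_def)

lemma re_im_le: "\<bar>re_im b z\<bar> \<le> norm z"
  by (auto simp: re_im_def abs_Re_le_cmod abs_Im_le_cmod)

lemma continuous_map_re_im:
  "continuous_map X euclidean f \<Longrightarrow> continuous_map X euclideanreal (\<lambda>x. re_im b (f x))"
  by (cases b) (auto simp: re_im_def continuous_map_Re continuous_map_Im)

lemma continuous_map_uniform_limit_complex:
  fixes f :: "nat \<Rightarrow> 'x \<Rightarrow> complex"
  assumes f: "\<And>k. continuous_map X euclidean (f k)"
    and lim: "uniform_limit (topspace X) f g sequentially"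
  shows "continuous_map X euclidean g"
proof -
  have "continuous_map X Met_TC.mtopology g"
    by (rule Met_TC.continuous_map_uniform_limit[where F = sequentially and f = f])
      (use f lim in \<open>auto simp: uniform_limit_iff mtopology_is_euclidean\<close>)
  then show ?thesis by (simp add: mtopology_is_euclidean)
qed

context equivariant_family
begin

text \<open>Uniform closeness as a relation, because sections may be unbounded on a noncompact
  \<open>X\<close>. The inequality is not strict, so that it passes to limits.\<close>

definition near :: "real \<Rightarrow> ('x \<Rightarrow> cvector) \<Rightarrow> ('x \<Rightarrow> cvector) \<Rightarrow> bool" where
  "near \<epsilon> s t \<longleftrightarrow> (\<forall>x\<in>topspace X. \<forall>i. norm (t x i - s x i) \<le> \<epsilon>)"

lemma near_mono: "\<lbrakk>near \<epsilon> s t; \<epsilon> \<le> \<delta>\<rbrakk> \<Longrightarrow> near \<delta> s t"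
  unfolding near_def by (blast intro: order_trans)

lemma near_trans:
  assumes "near \<epsilon> s t" "near \<delta> t u" shows "near (\<epsilon> + \<delta>) s u"
  unfolding near_def
proof (intro ballI allI)
  fix x i assume x: "x \<in> topspace X"
  have "norm (u x i - s x i) \<le> norm (u x i - t x i) + norm (t x i - s x i)"
    using norm_triangle_ineq[of "u x i - t x i" "t x i - s x i"] by simp
  also have "\<dots> \<le> \<delta> + \<epsilon>" using assms x unfolding near_def by (intro add_mono) auto
  finally show "norm (u x i - s x i) \<le> \<epsilon> + \<delta>" by simp
qed

text \<open>Equivariance passes to pointwise limits because \<open>a g x\<close> is a finite sum in
  coordinates; continuity is where uniformity matters.\<close>

lemma sections_uniform_limit:
  assumes s: "\<And>k. s k \<in> sections" and \<epsilon>: "\<epsilon> \<longlonglongrightarrow> 0" and near: "\<And>k. near (\<epsilon> k) (s k) t"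
  shows "t \<in> sections"
proof -
  have lim: "(\<lambda>k. s k x i) \<longlonglongrightarrow> t x i" if "x \<in> topspace X" for x i
  proof -
    have "(\<lambda>k. t x i - s k x i) \<longlonglongrightarrow> 0"
      by (rule Lim_null_comparison[OF _ \<epsilon>]) (use near that in \<open>auto simp: near_def\<close>)
    from tendsto_diff[OF tendsto_const[of "t x i"] this] show ?thesis by simp
  qed
  show ?thesis
    unfolding sections_def csection_def
  proof (intro CollectI conjI ballI allI)
    fix x assume x: "x \<in> topspace X"
    show "t x \<in> cvec d"
      unfolding cvec_def
    proof (intro CollectI allI impI)
      fix i assume "i \<ge> d"
      then have "s k x i = 0" for k using sections_cvec[OF s x] by (simp add: cvec_def)
      then show "t x i = 0" using lim[OF x, of i] by (simp add: LIMSEQ_const_iff)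
    qed
    fix g assume g: "g \<in> carrier G"
    have "t (\<phi> g x) i = a g x (t x) i" for i
    proof (rule LIMSEQ_unique)
      show "(\<lambda>k. s k (\<phi> g x) i) \<longlonglongrightarrow> t (\<phi> g x) i" by (rule lim[OF act_in[OF g x]])
      have exp: "a g x v i = (\<Sum>j<d. v j * a g x (unit_vec j) i)" for v
        by (rule linfun_expand[OF linop_linfun[OF a_linop[OF g x]]])
      have "(\<lambda>k. \<Sum>j<d. s k x j * a g x (unit_vec j) i) \<longlonglongrightarrow> (\<Sum>j<d. t x j * a g x (unit_vec j) i)"
        by (intro tendsto_sum tendsto_mult_right lim x)
      moreover have "s k (\<phi> g x) i = (\<Sum>j<d. s k x j * a g x (unit_vec j) i)" for k
        unfolding exp[symmetric] using sections_equivariant[OF s g x] by simp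
      ultimately show "(\<lambda>k. s k (\<phi> g x) i) \<longlonglongrightarrow> a g x (t x) i"
        unfolding exp[of "t x"] by presburger
    qed
    then show "t (\<phi> g x) = a g x (t x)" by blast
  next
    fix i
    have "uniform_limit (topspace X) (\<lambda>k x. s k x i) (\<lambda>x. t x i) sequentially"
    proof (rule uniform_limitI)
      fix e :: real assume "e > 0"
      then have "\<forall>\<^sub>F k in sequentially. \<epsilon> k < e" using \<epsilon> order_tendstoD(2) by blast
      then show "\<forall>\<^sub>F k in sequentially. \<forall>x\<in>topspace X. dist (s k x i) (t x i) < e"
        by (rule eventually_mono)
          (use near in \<open>auto simp: near_def dist_norm norm_minus_commute intro: le_less_trans\<close>)
    qed
    then show "continuous_map X euclidean (\<lambda>x. t x i)"
      by (rule continuous_map_uniform_limit_complex[OF sections_continuous[OF s]])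
  qed
qed

text \<open>The nested balls of the Baire category theorem. Each new centre lies within half of the
  old radius and each new radius is at most half of the old one, so the limit lies in all balls; the
  ball around centre \<open>k + 1\<close> guarantees condition \<open>k\<close>.\<close>

lemma sections_Baire:
  assumes P: "countable P"
    and dense: "\<And>p s \<epsilon>. \<lbrakk>p \<in> P; s \<in> sections; \<epsilon> > 0\<rbrakk> \<Longrightarrow> \<exists>s'\<in>sections. near \<epsilon> s s' \<and> p s'"
    and stable: "\<And>p s. \<lbrakk>p \<in> P; s \<in> sections; p s\<rbrakk> \<Longrightarrow> \<exists>\<delta>>0. \<forall>s'\<in>sections. near \<delta> s s' \<longrightarrow> p s'"
  obtains s where "s \<in> sections" "\<And>p. p \<in> P \<Longrightarrow> p s"
proof (cases "P = {}")
  case True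
  then show ?thesis using that[OF sections_zero] by auto
next
  case False
  define p where "p = from_nat_into P"
  have p: "p k \<in> P" for k unfolding p_def using False by (rule from_nat_into)
  have step: "\<exists>s' \<epsilon>'. s' \<in> sections \<and> \<epsilon>' > 0 \<and> \<epsilon>' \<le> \<epsilon> / 2 \<and> near (\<epsilon> / 2) s s' \<and>
      (\<forall>t\<in>sections. near \<epsilon>' s' t \<longrightarrow> p k t)" if s: "s \<in> sections" and \<epsilon>: "\<epsilon> > 0" for s \<epsilon> k
  proof -
    obtain s' where s': "s' \<in> sections" "near (\<epsilon> / 2) s s'" "p k s'"
      using dense[OF p s, of "\<epsilon> / 2"] \<epsilon> by auto
    obtain \<delta> where \<delta>: "\<delta> > 0" "\<forall>t\<in>sections. near \<delta> s' t \<longrightarrow> p k t"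
      using stable[OF p s'(1,3)] by blast
    show ?thesis
      using s' \<delta> \<epsilon> near_mono[of "min \<delta> (\<epsilon> / 2)" s' _ \<delta>]
      by (intro exI[of _ s'] exI[of _ "min \<delta> (\<epsilon> / 2)"]) auto
  qed
  define R where "R k q q' \<longleftrightarrow> snd q' \<le> snd q / 2 \<and> near (snd q / 2) (fst q) (fst q') \<and>
      (\<forall>t\<in>sections. near (snd q') (fst q') t \<longrightarrow> p k t)" for k q q'
  have "\<exists>f. \<forall>k. (fst (f k) \<in> sections \<and> snd (f k) > 0) \<and> R k (f k) (f (Suc k))"
  proof (rule dependent_nat_choice)
    show "\<exists>q. fst q \<in> sections \<and> snd q > (0::real)"
      using sections_zero by (intro exI[of _ "(\<lambda>x i. 0, 1)"]) simp
    fix q :: "('x \<Rightarrow> cvector) \<times> real" and k assume "fst q \<in> sections \<and> snd q > 0"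
    then show "\<exists>q'. (fst q' \<in> sections \<and> snd q' > 0) \<and> R k q q'"
      using step[of "fst q" "snd q" k] by (auto simp: R_def)
  qed
  then obtain f where f: "\<And>k. fst (f k) \<in> sections" "\<And>k. snd (f k) > 0" "\<And>k. R k (f k) (f (Suc k))"
    by blast
  define s \<epsilon> where "s k = fst (f k)" and "\<epsilon> k = snd (f k)" for k
  have s: "s k \<in> sections" and \<epsilon>: "\<epsilon> k > 0" for k using f by (auto simp: s_def \<epsilon>_def)
  have half: "\<epsilon> (Suc k) \<le> \<epsilon> k / 2" and next_near: "near (\<epsilon> k / 2) (s k) (s (Suc k))"
    and good: "\<And>t. \<lbrakk>t \<in> sections; near (\<epsilon> (Suc k)) (s (Suc k)) t\<rbrakk> \<Longrightarrow> p k t" for k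
    using f(3)[of k] by (auto simp: R_def s_def \<epsilon>_def)
  have "\<epsilon> k \<le> \<epsilon> 0 * (1/2) ^ k" for k
  proof (induction k)
    case (Suc k)
    then show ?case using half[of k] by simp
  qed simp
  moreover have "(\<lambda>k. \<epsilon> 0 * (1/2) ^ k) \<longlonglongrightarrow> \<epsilon> 0 * 0"
    by (intro tendsto_mult_left LIMSEQ_realpow_zero) auto
  ultimately have \<epsilon>0: "\<epsilon> \<longlonglongrightarrow> 0"
    by (intro Lim_null_comparison[of \<epsilon> "\<lambda>k. \<epsilon> 0 * (1/2) ^ k"])
      (use \<epsilon> in \<open>auto simp: less_imp_le\<close>)
  \<comment> \<open>The bound telescopes: one step moves by at most \<open>\<epsilon> k / 2\<close>,
    which is at most \<open>\<epsilon> k - \<epsilon> (Suc k)\<close>.\<close>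
  have near: "near (\<epsilon> k - \<epsilon> (k + m)) (s k) (s (k + m))" for k m
  proof (induction m)
    case (Suc m)
    show ?case
      using near_mono[OF near_trans[OF Suc next_near[of "k + m"]]] half[of "k + m"] by simp
  qed (simp add: near_def)
  have near': "near (\<epsilon> k) (s k) (s (k + m))" for k m
    using near_mono[OF near[of k m]] \<epsilon>[of "k + m"] by simp
  have conv: "\<exists>l. (\<lambda>k. s k x i) \<longlonglongrightarrow> l" if x: "x \<in> topspace X" for x i
  proof -
    have "Cauchy (\<lambda>k. s k x i)"
    proof (rule CauchyI')
      fix e :: real assume "e > 0"
      then obtain M where M: "\<And>k. k \<ge> M \<Longrightarrow> \<epsilon> k < e"
        using order_tendstoD(2)[OF \<epsilon>0] by (auto simp: eventually_sequentially)
      show "\<exists>M. \<forall>k\<ge>M. \<forall>m>k. dist (s k x i) (s m x i) < e"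
      proof (intro exI[of _ M] allI impI)
        fix k m assume "k \<ge> M" "m > k"
        then have "norm (s m x i - s k x i) \<le> \<epsilon> k"
          using near'[of k "m - k"] x by (simp add: near_def)
        then show "dist (s k x i) (s m x i) < e"
          using M[OF \<open>k \<ge> M\<close>] by (simp add: dist_norm norm_minus_commute)
      qed
    qed
    then show ?thesis by (simp add: Cauchy_convergent_iff convergent_def)
  qed
  define t where "t x i = lim (\<lambda>k. s k x i)" for x i
  have lim: "(\<lambda>k. s k x i) \<longlonglongrightarrow> t x i" if "x \<in> topspace X" for x i
    unfolding t_def using conv[OF that] by (simp add: convergent_LIMSEQ_iff[symmetric] convergent_def)
  have limnear: "near (\<epsilon> k) (s k) t" for k
    unfolding near_def
  proof (intro ballI allI)
    fix x i assume x: "x \<in> topspace X"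
    have "(\<lambda>m. norm (s m x i - s k x i)) \<longlonglongrightarrow> norm (t x i - s k x i)"
      by (intro tendsto_norm tendsto_diff lim x tendsto_const)
    moreover have "\<forall>\<^sub>F m in sequentially. norm (s m x i - s k x i) \<le> \<epsilon> k"
      unfolding eventually_sequentially
    proof (intro exI[of _ k] allI impI)
      fix m assume "k \<le> m"
      then show "norm (s m x i - s k x i) \<le> \<epsilon> k"
        using near'[of k "m - k"] x by (simp add: near_def)
    qed
    ultimately show "norm (t x i - s k x i) \<le> \<epsilon> k" by (rule tendsto_upperbound) simp
  qed
  have t: "t \<in> sections" by (rule sections_uniform_limit[OF s \<epsilon>0 limnear])
  have "q t" if q: "q \<in> P" for q
  proof -
    obtain k where "q = p k" using from_nat_into_surj[OF P q] by (metis p_def)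
    then show ?thesis using good[OF t limnear] by simp
  qed
  with t that show ?thesis by blast
qed

end

section \<open>Making finitely many real coordinates of a section avoid a common zero on a compact
  set\<close>

text \<open>Keeps a correction small on all of \<open>X\<close> without changing it where it is
  small already.\<close>

definition clamp_abs :: "real \<Rightarrow> real \<Rightarrow> real" where
  "clamp_abs \<epsilon> t = max (- \<epsilon>) (min \<epsilon> t)"

lemma abs_clamp_abs: "\<epsilon> \<ge> 0 \<Longrightarrow> \<bar>clamp_abs \<epsilon> t\<bar> \<le> \<epsilon>"
  and clamp_abs_id: "\<bar>t\<bar> \<le> \<epsilon> \<Longrightarrow> clamp_abs \<epsilon> t = t"
  by (auto simp: clamp_abs_def)

lemma continuous_map_clamp_abs:
  "continuous_map X euclideanreal f \<Longrightarrow> continuous_map X euclideanreal (\<lambda>x. clamp_abs \<epsilon> (f x))"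
  unfolding clamp_abs_def by (intro continuous_map_real_max continuous_map_real_min) auto

lemma norm_one_i [simp]: "norm (one_i b) = 1"
  by (simp add: one_i_def)

context equivariant_family
begin

abbreviation "coef l k x v \<equiv> re_im (snd k) (l (fst k) x v)"

text \<open>On \<open>K\<close> the corrections \<open>q\<close> replace the coordinates of \<open>s\<close>, divided by \<open>\<kappa>\<close>, by the locally Lipschitz
  map \<open>p - b\<close>, which has no zero; off \<open>K\<close> they are cut off by \<open>min 1 (\<kappa> / \<delta>)\<close>.\<close>

lemma avoid_dense:
  assumes J: "finite J" "card J > n" "J \<subseteq> {..<d} \<times> UNIV"
    and t: "\<And>j. j < d \<Longrightarrow> t j \<in> sections" and l: "\<And>i. i < d \<Longrightarrow> l i \<in> functionals"
    and \<kappa>: "continuous_map X euclideanreal \<kappa>" "invariant \<kappa>" "\<And>x. \<kappa> x \<ge> 0"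
    and C: "compactin X C" "\<And>x. \<lbrakk>x \<in> topspace X; x \<notin> C\<rbrakk> \<Longrightarrow> \<kappa> x = 0"
    and dual: "\<And>x i j. \<lbrakk>x \<in> topspace X; i < d; j < d\<rbrakk> \<Longrightarrow> l i x (t j x) = (if i = j then complex_of_real (\<kappa> x) else 0)"
    and K: "compactin X K" and \<delta>: "\<delta> > 0" "\<And>x. x \<in> K \<Longrightarrow> \<kappa> x \<ge> \<delta>"
    and s: "s \<in> sections" and \<epsilon>: "\<epsilon> > 0"
  shows "\<exists>s'\<in>sections. near \<epsilon> s s' \<and> (\<forall>x\<in>K. \<exists>k\<in>J. coef l k x (s' x) \<noteq> 0)"
proof -
  have KX: "K \<subseteq> topspace X" using K compactin_subset_topspace by blast
  have Jd: "fst k < d" if "k \<in> J" for k using J(3) that by auto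
  have tc: "continuous_map X euclidean (\<lambda>x. t i x m)" if "i < d" for i m
    using sections_continuous[OF t[OF that]] .
  have "continuous_map X euclidean (\<lambda>x. \<Sum>i<d. \<Sum>m<d. norm (t i x m))"
    using tc by (intro continuous_map_sum continuous_map_norm) auto
  then obtain B where B: "B > 0" "\<And>x. x \<in> C \<Longrightarrow> norm (\<Sum>i<d. \<Sum>m<d. norm (t i x m)) \<le> B"
    using compactin_bounded[OF C(1)] by blast
  have tB: "norm (t i x m) \<le> B" if x: "x \<in> C" and i: "i < d" for i x m
  proof (cases "m < d")
    case True
    have "norm (t i x m) \<le> (\<Sum>m<d. norm (t i x m))" using True by (intro member_le_sum) auto
    also have "\<dots> \<le> (\<Sum>i<d. \<Sum>m<d. norm (t i x m))"
      using i by (intro member_le_sum[of i "{..<d}" "\<lambda>i. \<Sum>m<d. norm (t i x m)"]) (auto intro: sum_nonneg)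
    also have "\<dots> \<le> B" using B(2)[OF x] by simp
    finally show ?thesis .
  next
    case False
    have "x \<in> topspace X" using x C(1) compactin_subset_topspace by blast
    then have "t i x m = 0" using sections_cvec[OF t[OF i]] False by (auto simp: cvec_def)
    then show ?thesis using B(1) by simp
  qed
  \<comment> \<open>The change of \<open>s\<close> will have \<open>card J\<close> terms, each at
    most \<open>e * B\<close> on \<open>C\<close> and 0 elsewhere; this \<open>e\<close> keeps their
    sum below \<open>\<epsilon>\<close>.\<close>
  define e where "e = \<epsilon> / (real (card J) * B + 1)"
  have den: "real (card J) * B + 1 > 0" using B(1) by (simp add: add_nonneg_pos)
  then have e: "e > 0" using \<epsilon> by (simp add: e_def)
  define F where "F k x = coef l k x (s x)" for k x
  define g where "g k x = F k x / max \<delta> (\<kappa> x)" for k x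
  have Fc: "continuous_map X euclideanreal (F k)" if "k \<in> J" for k
    unfolding F_def by (intro continuous_map_re_im pairing_continuous l Jd that s)
  have Fi: "invariant (F k)" if "k \<in> J" for k
    using pairing_invariant[OF l[OF Jd[OF that]] s] by (simp add: F_def invariant_def)
  have gc: "continuous_map X euclideanreal (g k)" if "k \<in> J" for k
    unfolding g_def using \<delta>(1) Fc[OF that] \<kappa>(1)
    by (intro continuous_map_real_divide continuous_map_real_max) auto
  have gi: "invariant (g k)" if "k \<in> J" for k
    using Fi[OF that] \<kappa>(2) by (simp add: g_def invariant_def)
  have "\<exists>p. (\<forall>y\<in>topspace X. Lipschitz_at p y) \<and> invariant p \<and> (\<forall>y\<in>K. \<bar>p y - g k y\<bar> \<le> e / 2)"
    if k: "k \<in> J" for k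
  proof -
    obtain p where "\<And>y. y \<in> topspace X \<Longrightarrow> Lipschitz_at p y" "invariant p"
      "\<And>y. y \<in> K \<Longrightarrow> \<bar>p y - g k y\<bar> \<le> e / 2"
      by (rule invariant_Lipschitz_approximation[OF gc[OF k] gi[OF k] K, of "e / 2"]) (use e in auto)
    then show ?thesis by blast
  qed
  then have "\<exists>p. \<forall>k\<in>J. (\<forall>y\<in>topspace X. Lipschitz_at (p k) y) \<and> invariant (p k) \<and>
      (\<forall>y\<in>K. \<bar>p k y - g k y\<bar> \<le> e / 2)"
    by (intro bchoice) blast
  then obtain p where p: "\<And>k y. \<lbrakk>k \<in> J; y \<in> topspace X\<rbrakk> \<Longrightarrow> Lipschitz_at (p k) y"
    "\<And>k. k \<in> J \<Longrightarrow> invariant (p k)" "\<And>k y. \<lbrakk>k \<in> J; y \<in> K\<rbrakk> \<Longrightarrow> \<bar>p k y - g k y\<bar> \<le> e / 2"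
    by blast
  \<comment> \<open>Approximation and shift take \<open>e / 2\<close> each, so that on
    \<open>K\<close> the difference \<open>p k x - b k - g k x\<close> stays within \<open>e\<close>
    and the clamp does not act.\<close>
  obtain b where b: "\<And>k. k \<in> J \<Longrightarrow> \<bar>b k\<bar> \<le> e / 2" "\<And>x. x \<in> K \<Longrightarrow> \<exists>k\<in>J. p k x \<noteq> b k"
    by (rule Lipschitz_avoids_value[where J = J and p = p and \<epsilon> = "e / 2", OF J(1,2) K])
      (use p(1) KX e in auto)
  define q where "q k x = min 1 (\<kappa> x / \<delta>) * clamp_abs e (p k x - b k - g k x)" for k x
  have qc: "continuous_map X euclideanreal (q k)" if "k \<in> J" for k
    unfolding q_def using \<delta>(1) \<kappa>(1) gc[OF that] Lipschitz_imp_continuous_map[OF p(1)[OF that]]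
    by (intro continuous_map_real_mult continuous_map_real_min continuous_map_clamp_abs
        continuous_map_diff continuous_map_real_divide) auto
  have qi: "invariant (q k)" if "k \<in> J" for k
    using gi[OF that] \<kappa>(2) p(2)[OF that] by (simp add: q_def invariant_def)
  have qle: "\<bar>q k x\<bar> \<le> e" for k x
  proof -
    have "\<bar>min 1 (\<kappa> x / \<delta>)\<bar> * \<bar>clamp_abs e (p k x - b k - g k x)\<bar> \<le> 1 * e"
      using abs_clamp_abs[of e] e \<kappa>(3)[of x] \<delta>(1) by (intro mult_mono) auto
    then show ?thesis by (simp add: q_def abs_mult)
  qed
  define c where "c k x = complex_of_real (q k x) * one_i (snd k)" for k x
  define s' where "s' x = (\<lambda>m. s x m + (\<Sum>k\<in>J. c k x * t (fst k) x m))" for x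
  have cs: "(\<lambda>x m. c k x * t (fst k) x m) \<in> sections" if k: "k \<in> J" for k
    using qc[OF k] qi[OF k] t[OF Jd[OF k]]
    by (intro sections_mult) (auto simp: c_def invariant_def intro!: continuous_map_mult continuous_map_of_real)
  have s': "s' \<in> sections"
    unfolding s'_def by (intro sections_add[OF s] sections_sum J(1) cs)
  have "near \<epsilon> s s'"
    unfolding near_def
  proof (intro ballI allI)
    fix x m assume x: "x \<in> topspace X"
    have diff: "s' x m - s x m = (\<Sum>k\<in>J. c k x * t (fst k) x m)" by (simp add: s'_def)
    show "norm (s' x m - s x m) \<le> \<epsilon>"
    proof (cases "x \<in> C")
      case True
      have "norm (\<Sum>k\<in>J. c k x * t (fst k) x m) \<le> (\<Sum>k\<in>J. e * B)"
      proof (rule sum_norm_le)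
        fix k assume k: "k \<in> J"
        show "norm (c k x * t (fst k) x m) \<le> e * B"
          unfolding c_def norm_mult using qle[of k x] tB[OF True Jd[OF k]] e
          by (intro mult_mono) auto
      qed
      also have "\<dots> \<le> e * (real (card J) * B + 1)" using e by (simp add: algebra_simps)
      also have "\<dots> = \<epsilon>" using den by (simp add: e_def)
      finally show ?thesis using diff by simp
    next
      case False
      then have "c k x = 0" for k using C(2)[OF x] by (simp add: c_def q_def)
      then show ?thesis using diff \<epsilon> by simp
    qed
  qed
  moreover have "\<exists>k\<in>J. coef l k x (s' x) \<noteq> 0" if x: "x \<in> K" for x
  proof -
    obtain k where k: "k \<in> J" "p k x \<noteq> b k" using b(2)[OF x] by blast
    have xX: "x \<in> topspace X" using x KX by blast
    have lf: "linfun d (l (fst k) x)" using functionals_linfun[OF l[OF Jd[OF k(1)]]] .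
    have "l (fst k) x (s' x) = l (fst k) x (s x) + (\<Sum>k'\<in>J. c k' x * l (fst k) x (t (fst k') x))"
      unfolding s'_def using linfun_add[OF lf, of "s x" "\<lambda>m. \<Sum>k\<in>J. c k x * t (fst k) x m"]
        linfun_sum[OF lf, of "\<lambda>k. c k x" "\<lambda>k. t (fst k) x" J] by simp
    also have "(\<Sum>k'\<in>J. c k' x * l (fst k) x (t (fst k') x)) =
        (\<Sum>k'\<in>J. if fst k = fst k' then complex_of_real (q k' x * \<kappa> x) * one_i (snd k') else 0)"
      by (intro sum.cong refl) (auto simp: dual[OF xX Jd[OF k(1)] Jd] c_def)
    finally have "coef l k x (s' x) = F k x +
       (\<Sum>k'\<in>J. re_im (snd k) (if fst k = fst k' then complex_of_real (q k' x * \<kappa> x) * one_i (snd k') else 0))"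
      by (simp add: re_im_add re_im_sum F_def)
    \<comment> \<open>The vectors \<open>t i\<close> and their multiples by \<open>\<i>\<close> form
      a real frame to which the coordinates are dual up to the factor \<open>\<kappa> x\<close>, so
      only \<open>k' = k\<close> survives.\<close>
    also have "(\<Sum>k'\<in>J. re_im (snd k) (if fst k = fst k' then complex_of_real (q k' x * \<kappa> x) * one_i (snd k') else 0))
       = (\<Sum>k'\<in>J. if k' = k then q k' x * \<kappa> x else 0)"
      by (intro sum.cong refl)
        (auto simp: re_im_one_i prod_eq_iff simp del: of_real_mult, simp_all add: re_im_def)
    also have "\<dots> = q k x * \<kappa> x" using J(1) k(1) by simp
    also have "q k x = p k x - b k - F k x / \<kappa> x"
    proof -
      have "\<bar>p k x - b k - g k x\<bar> \<le> e" using p(3)[OF k(1) x] b(1)[OF k(1)] by linarith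
      moreover have "min 1 (\<kappa> x / \<delta>) = 1" "max \<delta> (\<kappa> x) = \<kappa> x" using \<delta>(2)[OF x] \<delta>(1) by auto
      ultimately show ?thesis by (simp add: q_def clamp_abs_id g_def)
    qed
    also have "F k x + (p k x - b k - F k x / \<kappa> x) * \<kappa> x = (p k x - b k) * \<kappa> x"
      using \<delta>(1) \<delta>(2)[OF x] by (simp add: field_simps)
    finally have "coef l k x (s' x) \<noteq> 0" using k(2) \<delta>(1) \<delta>(2)[OF x] by simp
    with k(1) show ?thesis by blast
  qed
  ultimately show ?thesis using s' by blast
qed

text \<open>On the compact \<open>K\<close> the sum of the absolute coordinates of \<open>s\<close>
  is at least some \<open>\<eta> > 0\<close>, and the functionals are bounded by \<open>B\<close>.
  If all coordinates of \<open>s'\<close> vanished at a point, that sum would be at most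
  \<open>card J * \<delta> * B\<close>, which is less than \<open>\<eta>\<close>.\<close>

lemma avoid_stable:
  assumes J: "finite J" "J \<subseteq> {..<d} \<times> UNIV" and l: "\<And>i. i < d \<Longrightarrow> l i \<in> functionals"
    and K: "compactin X K" and s: "s \<in> sections"
    and avoid: "\<forall>x\<in>K. \<exists>k\<in>J. coef l k x (s x) \<noteq> 0"
  shows "\<exists>\<delta>>0. \<forall>s'\<in>sections. near \<delta> s s' \<longrightarrow> (\<forall>x\<in>K. \<exists>k\<in>J. coef l k x (s' x) \<noteq> 0)"
proof -
  have KX: "K \<subseteq> topspace X" using K compactin_subset_topspace by blast
  have Jd: "fst k < d" if "k \<in> J" for k using J(2) that by auto
  define f where "f x = (\<Sum>k\<in>J. \<bar>coef l k x (s x)\<bar>)" for x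
  have "continuous_map X euclideanreal f"
    unfolding f_def
    by (intro continuous_map_sum J(1) continuous_map_real_abs continuous_map_re_im pairing_continuous l Jd s)
  moreover have "f x > 0" if x: "x \<in> K" for x
  proof -
    obtain k where k: "k \<in> J" "coef l k x (s x) \<noteq> 0" using avoid x by blast
    then have "\<bar>coef l k x (s x)\<bar> \<le> f x"
      unfolding f_def using J(1)
      by (intro member_le_sum[of k J "\<lambda>k. \<bar>coef l k x (s x)\<bar>"]) auto
    then show ?thesis using k by simp
  qed
  ultimately obtain \<eta> where \<eta>: "\<eta> > 0" "\<And>x. x \<in> K \<Longrightarrow> f x \<ge> \<eta>"
    using compactin_pos_lower_bound[of X K f] K by blast
  have "continuous_map X euclidean (\<lambda>x. \<Sum>i<d. \<Sum>j<d. norm (l i x (unit_vec j)))"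
    using functionals_continuous[OF l] by (intro continuous_map_sum continuous_map_norm) auto
  then obtain B where B: "B > 0" "\<And>x. x \<in> K \<Longrightarrow> norm (\<Sum>i<d. \<Sum>j<d. norm (l i x (unit_vec j))) \<le> B"
    using compactin_bounded[OF K] by blast
  have lB: "(\<Sum>j<d. norm (l i x (unit_vec j))) \<le> B" if "x \<in> K" "i < d" for i x
  proof -
    have "(\<Sum>j<d. norm (l i x (unit_vec j))) \<le> (\<Sum>i<d. \<Sum>j<d. norm (l i x (unit_vec j)))"
      using that by (intro member_le_sum[of i "{..<d}" "\<lambda>i. \<Sum>j<d. norm (l i x (unit_vec j))"]) (auto intro: sum_nonneg)
    then show ?thesis using B(2)[OF that(1)] by simp
  qed
  define \<delta> where "\<delta> = \<eta> / (real (card J) * B + 1)"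
  have den: "real (card J) * B + 1 > 0" using B(1) by (simp add: add_nonneg_pos)
  then have \<delta>: "\<delta> > 0" using \<eta> by (simp add: \<delta>_def)
  have "\<exists>k\<in>J. coef l k x (s' x) \<noteq> 0"
    if s': "s' \<in> sections" "near \<delta> s s'" and x: "x \<in> K" for s' x
  proof (rule ccontr)
    assume "\<not> ?thesis"
    then have zero: "coef l k x (s' x) = 0" if "k \<in> J" for k using that by blast
    have "f x \<le> (\<Sum>k\<in>J. \<delta> * B)"
      unfolding f_def
    proof (rule sum_mono)
      fix k assume k: "k \<in> J"
      have lf: "linfun d (l (fst k) x)" using functionals_linfun[OF l[OF Jd[OF k]]] .
      have "l (fst k) x (s x) = l (fst k) x (s' x) + l (fst k) x (\<lambda>m. s x m - s' x m)"
        using linfun_diff[OF lf, of "s x" "s' x"] by simp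
      then have "coef l k x (s x) = re_im (snd k) (l (fst k) x (\<lambda>m. s x m - s' x m))"
        using zero[OF k] by (simp add: re_im_add)
      then have "\<bar>coef l k x (s x)\<bar> \<le> norm (l (fst k) x (\<lambda>m. s x m - s' x m))"
        using re_im_le by metis
      also have "\<dots> = norm (\<Sum>j<d. (s x j - s' x j) * l (fst k) x (unit_vec j))"
        by (subst linfun_expand[OF lf]) simp
      also have "\<dots> \<le> (\<Sum>j<d. \<delta> * norm (l (fst k) x (unit_vec j)))"
        using s'(2) x KX
        by (intro sum_norm_le) (auto simp: near_def norm_mult norm_minus_commute intro!: mult_right_mono)
      also have "\<dots> \<le> \<delta> * B"
        using lB[OF x Jd[OF k]] \<delta> by (simp flip: sum_distrib_left)
      finally show "\<bar>coef l k x (s x)\<bar> \<le> \<delta> * B" .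
    qed
    also have "\<dots> < \<delta> * (real (card J) * B + 1)" using \<delta> by (simp add: algebra_simps)
    also have "\<dots> = \<eta>" using den by (simp add: \<delta>_def)
    finally show False using \<eta>(2)[OF x] by simp
  qed
  with \<delta> show ?thesis by blast
qed

section \<open>Generic sections, locally and globally\<close>

definition dense_pred :: "(('x \<Rightarrow> cvector) \<Rightarrow> bool) \<Rightarrow> bool" where
  "dense_pred p \<longleftrightarrow> (\<forall>s\<in>sections. \<forall>\<epsilon>>0. \<exists>s'\<in>sections. near \<epsilon> s s' \<and> p s')"

definition stable_pred :: "(('x \<Rightarrow> cvector) \<Rightarrow> bool) \<Rightarrow> bool" where
  "stable_pred p \<longleftrightarrow> (\<forall>s\<in>sections. p s \<longrightarrow> (\<exists>\<delta>>0. \<forall>s'\<in>sections. near \<delta> s s' \<longrightarrow> p s'))"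

text \<open>Such a functional at every point is what the transvection from \<open>t r\<close> to \<open>s\<close> needs. Unlike
  the condition that \<open>l (t r)\<close> and \<open>l s\<close> do not vanish, positivity of the real parts is convex, so
  that local functionals can be summed.\<close>

definition pos_functional ::
    "nat \<Rightarrow> (nat \<Rightarrow> 'x \<Rightarrow> cvector) \<Rightarrow> ('x \<Rightarrow> cvector) \<Rightarrow> 'x \<Rightarrow> ('x \<Rightarrow> cvector \<Rightarrow> complex) \<Rightarrow> bool" where
  "pos_functional r t s x l \<longleftrightarrow> l \<in> functionals \<and> (\<forall>y\<in>topspace X. \<forall>j<r. l y (t j y) = 0) \<and>
     Re (l x (t r x)) > 0 \<and> Re (l x (s x)) > 0"

text \<open>The condition wanted on the open set \<open>W\<close> need not itself be stable under
  uniform perturbation, as \<open>W\<close> need not be compact; \<open>p\<close> is a sufficient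
  condition that is.\<close>

definition generic_near ::
    "nat \<Rightarrow> (nat \<Rightarrow> 'x \<Rightarrow> cvector) \<Rightarrow> (('x \<Rightarrow> cvector) \<Rightarrow> bool) \<Rightarrow> 'x set \<Rightarrow> bool" where
  "generic_near r t p W \<longleftrightarrow> dense_pred p \<and> stable_pred p \<and> openin X W \<and>
     (\<forall>s x. p s \<and> x \<in> W \<longrightarrow> (\<exists>m. pos_functional r t s x m))"

text \<open>In a dual frame extending \<open>t\<close>, the \<open>l i\<close> with
  \<open>i \<ge> r\<close> vanish on the first \<open>r\<close> columns, and \<open>l r\<close> has
  the positive value \<open>\<kappa>\<close> on \<open>t r\<close>. A nonzero coordinate of
  \<open>s\<close> transverse to the columns and to the real line of \<open>t r\<close> leaves the
  freedom to make both real parts positive: by a complex factor if it is the imaginary part of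
  \<open>l r\<close>, and by adding a multiple of another \<open>l i\<close> otherwise.\<close>

lemma local_general_position:
  assumes x0: "x0 \<in> topspace X" and t: "\<And>j. j < Suc r \<Longrightarrow> t j \<in> sections"
    and ind: "indep (Suc r) (\<lambda>j. t j x0)" and dim: "n + 2 * Suc r \<le> 2 * d"
  shows "\<exists>p W. x0 \<in> W \<and> generic_near r t p W"
proof -
  have rd: "Suc r \<le> d" using dim by simp
  obtain t' l \<kappa> C where t': "\<And>j. j < Suc r \<Longrightarrow> t' j = t j" "\<And>j. j < d \<Longrightarrow> t' j \<in> sections"
    and l: "\<And>i. i < d \<Longrightarrow> l i \<in> functionals"
    and \<kappa>: "continuous_map X euclideanreal \<kappa>" "invariant \<kappa>" "\<And>x. \<kappa> x \<ge> 0" "\<kappa> x0 > 0"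
    and C: "compactin X C" "\<And>x. \<lbrakk>x \<in> topspace X; x \<notin> C\<rbrakk> \<Longrightarrow> \<kappa> x = 0"
    and dual: "\<And>x i j. \<lbrakk>x \<in> topspace X; i < d; j < d\<rbrakk> \<Longrightarrow> l i x (t' j x) = (if i = j then complex_of_real (\<kappa> x) else 0)"
    by (rule dual_frame_at[OF x0 t ind rd]) (assumption, blast)
  \<comment> \<open>Strictly between 0 and \<open>\<kappa> x0\<close>: the open \<open>W\<close>
    then contains \<open>x0\<close>, and the closed \<open>K\<close> around it lies in
    \<open>C\<close> and is compact.\<close>
  define \<delta> where "\<delta> = \<kappa> x0 / 2"
  have \<delta>: "\<delta> > 0" using \<kappa>(4) by (simp add: \<delta>_def)
  define K where "K = {x \<in> topspace X. \<kappa> x \<in> {\<delta>..}}"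
  define W where "W = {x \<in> topspace X. \<kappa> x \<in> {\<delta><..}}"
  have "closedin X K" unfolding K_def by (rule closedin_continuous_map_preimage[OF \<kappa>(1)]) simp
  moreover have "K \<subseteq> C" using C(2) \<delta> by (force simp: K_def)
  ultimately have K: "compactin X K" using closed_compactin[OF C(1)] by blast
  have W: "openin X W" unfolding W_def by (rule openin_continuous_map_preimage[OF \<kappa>(1)]) simp
  \<comment> \<open>the real functionals \<open>coef l k\<close> with \<open>k \<in> J\<close> vanish on \<open>t 0, \<dots>, t (r - 1)\<close> and on the real line
    of \<open>t r\<close>; there are \<open>2 (d - r) - 1\<close> of them\<close>
  define J where "J = {r..<d} \<times> (UNIV :: bool set) - {(r, True)}"
  \<comment> \<open>Here \<open>r\<close> counts the columns before the last one, so
    \<open>dim\<close> says \<open>2 * (d - r) - 1 \<ge> n + 1\<close>.\<close>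
  have "card J = card ({r..<d} \<times> (UNIV :: bool set)) - 1"
    unfolding J_def using rd by (subst card_Diff_singleton) auto
  then have J: "finite J" "card J > n" "J \<subseteq> {..<d} \<times> UNIV"
    using dim by (auto simp: J_def card_cartesian_product)
  define p where "p s \<longleftrightarrow> (\<forall>x\<in>K. \<exists>k\<in>J. coef l k x (s x) \<noteq> 0)" for s
  have "dense_pred p"
    unfolding dense_pred_def p_def
    using avoid_dense[where t = t' and \<kappa> = \<kappa> and C = C and \<delta> = \<delta>, OF J t'(2) l \<kappa>(1-3) C dual K \<delta>]
    by (auto simp: K_def)
  moreover have "stable_pred p"
    unfolding stable_pred_def p_def using avoid_stable[where l = l, OF J(1,3) l K] by blast
  moreover have "\<exists>m. pos_functional r t s x m" if ps: "p s" and x: "x \<in> W" for s x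
  proof -
    have xX: "x \<in> topspace X" and \<kappa>x: "\<kappa> x > 0" using x \<delta> by (auto simp: W_def)
    have "x \<in> K" using x by (auto simp: W_def K_def)
    then obtain k where k: "k \<in> J" "coef l k x (s x) \<noteq> 0" using ps by (auto simp: p_def)
    have lt: "l i y (t j y) = (if i = j then complex_of_real (\<kappa> y) else 0)"
      if "y \<in> topspace X" "i < d" "j < Suc r" for y i j
      using dual[of y i j] t'(1)[OF that(3)] that rd by simp
    define z where "z = l r x (s x)"
    have const: "(\<lambda>y v. c * l i y v) \<in> functionals" if "i < d" for c i
      using functionals_mult[OF _ _ l[OF that], of "\<lambda>_. c"] by (simp add: invariant_def)
    show ?thesis
    proof (cases "fst k = r")
      case True
      then have "\<not> snd k" using k(1) by (cases k) (auto simp: J_def)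
      then have z: "Im z \<noteq> 0" using k(2) True by (simp add: re_im_def z_def)
      \<comment> \<open>The real part 1 keeps the value on \<open>t r\<close> positive; the
        imaginary part solves \<open>Re (\<zeta> * z) = 1\<close>.\<close>
      define \<zeta> where "\<zeta> = Complex 1 ((Re z - 1) / Im z)"
      have "pos_functional r t s x (\<lambda>y v. \<zeta> * l r y v)"
        unfolding pos_functional_def using const[of r] rd xX \<kappa>x z
        by (auto simp: lt z_def[symmetric] \<zeta>_def)
      then show ?thesis by blast
    next
      case False
      define i where "i = fst k"
      have i: "r < i" "i < d" using k(1) False by (auto simp: J_def i_def)
      have y: "l i x (s x) \<noteq> 0" using k(2) by (auto simp: re_im_def i_def split: if_splits)
      \<comment> \<open>This makes the value on \<open>s x\<close> equal to 1; the value on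
        \<open>t r\<close> stays \<open>\<kappa>\<close> because \<open>l i\<close> vanishes
        there.\<close>
      define \<gamma> where "\<gamma> = (1 - z) / l i x (s x)"
      have "(\<lambda>y v. l r y v + \<gamma> * l i y v) \<in> functionals"
        using functionals_add[OF l const[OF i(2)]] rd by simp
      then have "pos_functional r t s x (\<lambda>y v. l r y v + \<gamma> * l i y v)"
        unfolding pos_functional_def using rd xX \<kappa>x i y
        by (auto simp: lt z_def[symmetric] \<gamma>_def)
      then show ?thesis by blast
    qed
  qed
  moreover have "x0 \<in> W" using x0 \<delta> by (simp add: W_def \<delta>_def)
  ultimately show ?thesis using W unfolding generic_near_def by (intro exI[of _ p] exI[of _ W]) blast
qed

text \<open>Second countability enters here. The Baire argument and the series of functionals both
  rest on the countability of the cover.\<close>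

lemma countable_subcover:
  assumes "\<And>x. x \<in> topspace X \<Longrightarrow> openin X (W x) \<and> x \<in> W x"
  obtains Q where "countable Q" "Q \<subseteq> topspace X" "topspace X \<subseteq> (\<Union>x\<in>Q. W x)"
proof -
  have L: "Lindelof_space X" by (rule second_countable_imp_Lindelof_space[OF second_countable_X])
  have "\<Union>(W ` topspace X) = topspace X" using assms openin_subset by fast
  then obtain \<V> where \<V>: "countable \<V>" "\<V> \<subseteq> W ` topspace X" "\<Union>\<V> = topspace X"
    using L assms unfolding Lindelof_space_def by (metis (no_types, lifting) imageE)
  then obtain Q where "Q \<subseteq> topspace X" "countable Q" "\<V> = W ` Q"
    using countable_subset_image by metis
  with \<V> that show ?thesis by auto
qed

text \<open>Several tuples are treated at once because the same \<open>s\<close> has to serve both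
  last columns; the Baire argument runs over the union of their countable sets of
  conditions.\<close>

lemma general_position:
  fixes t :: "'i \<Rightarrow> nat \<Rightarrow> 'x \<Rightarrow> cvector"
  assumes I: "finite I" and t: "\<And>\<iota> j. \<lbrakk>\<iota> \<in> I; j < Suc r\<rbrakk> \<Longrightarrow> t \<iota> j \<in> sections"
    and ind: "\<And>\<iota> x. \<lbrakk>\<iota> \<in> I; x \<in> topspace X\<rbrakk> \<Longrightarrow> indep (Suc r) (\<lambda>j. t \<iota> j x)"
    and dim: "n + 2 * Suc r \<le> 2 * d"
  obtains s where "s \<in> sections"
    "\<And>\<iota> x. \<lbrakk>\<iota> \<in> I; x \<in> topspace X\<rbrakk> \<Longrightarrow> \<exists>m. pos_functional r (t \<iota>) s x m"
proof -
  define covers where "covers \<iota> P \<longleftrightarrow> countable P \<and> (\<forall>p\<in>P. dense_pred p \<and> stable_pred p) \<and>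
      (\<forall>s x. (\<forall>p\<in>P. p s) \<and> x \<in> topspace X \<longrightarrow> (\<exists>m. pos_functional r (t \<iota>) s x m))" for \<iota> P
  have "\<exists>P. covers \<iota> P" if \<iota>: "\<iota> \<in> I" for \<iota>
  proof -
    have *: "\<forall>x0\<in>topspace X. \<exists>p W. x0 \<in> W \<and> generic_near r (t \<iota>) p W"
      using local_general_position[OF _ t[OF \<iota>] ind[OF \<iota>] dim] by blast
    obtain p where p: "\<forall>x0\<in>topspace X. \<exists>W. x0 \<in> W \<and> generic_near r (t \<iota>) (p x0) W"
      using bchoice[OF *] by (elim exE)
    obtain W where W: "\<forall>x0\<in>topspace X. x0 \<in> W x0 \<and> generic_near r (t \<iota>) (p x0) (W x0)"
      using bchoice[OF p] by (elim exE)
    obtain Q where Q: "countable Q" "Q \<subseteq> topspace X" "topspace X \<subseteq> (\<Union>x\<in>Q. W x)"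
      by (rule countable_subcover[of W]) (use W in \<open>auto simp: generic_near_def\<close>)
    have "\<exists>m. pos_functional r (t \<iota>) s x m"
      if "\<forall>q\<in>p ` Q. q s" and x: "x \<in> topspace X" for s x
    proof -
      obtain x0 where x0: "x0 \<in> Q" "x \<in> W x0" using Q(3) x by blast
      then have "p x0 s" using that(1) by blast
      then show ?thesis using W x0 Q(2) unfolding generic_near_def by blast
    qed
    then have "covers \<iota> (p ` Q)" using Q(1,2) W by (auto simp: covers_def generic_near_def)
    then show ?thesis by blast
  qed
  then have "\<forall>\<iota>\<in>I. \<exists>P. covers \<iota> P" by (rule ballI)
  from bchoice[OF this] obtain P where P': "\<forall>\<iota>\<in>I. covers \<iota> (P \<iota>)" by (elim exE)
  note P = P'[unfolded covers_def]
  obtain s where s: "s \<in> sections" "\<And>p. p \<in> (\<Union>\<iota>\<in>I. P \<iota>) \<Longrightarrow> p s"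
  proof (rule sections_Baire[of "\<Union>\<iota>\<in>I. P \<iota>"])
    show "countable (\<Union>\<iota>\<in>I. P \<iota>)" using P I by (intro countable_UN) (auto simp: countable_finite)
  qed (use P in \<open>auto simp: dense_pred_def stable_pred_def\<close>)
  show ?thesis
  proof (rule that[OF s(1)])
    fix \<iota> x assume "\<iota> \<in> I" "x \<in> topspace X"
    then show "\<exists>m. pos_functional r (t \<iota>) s x m" using P s(2) by blast
  qed
qed

end

section \<open>Transvections\<close>

context equivariant_family
begin

lemma pairing_pos_open:
  assumes "l \<in> functionals" "s \<in> sections"
  shows "openin X {x \<in> topspace X. Re (l x (s x)) > 0}"
proof -
  have "openin X {x \<in> topspace X. Re (l x (s x)) \<in> {0<..}}"
    by (rule openin_continuous_map_preimage[OF continuous_map_Re[OF pairing_continuous[OF assms]]]) simp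
  then show ?thesis by simp
qed

text \<open>\<open>m\<close> is multiplied by an invariant bump living where both real parts are
  positive; this set is a union of orbits since pairings are invariant. The factor is real and
  nonnegative, so no sign is spoilt, and its compact support allows scaling to norm at most
  1.\<close>

lemma localize_pos_functional:
  assumes t: "t r \<in> sections" and s: "s \<in> sections" and x0: "x0 \<in> topspace X"
    and m: "pos_functional r t s x0 m"
  shows "\<exists>l. pos_functional r t s x0 l \<and> (\<forall>x\<in>topspace X. Re (l x (t r x)) \<ge> 0 \<and> Re (l x (s x)) \<ge> 0 \<and>
     (\<forall>j. norm (l x (unit_vec j)) \<le> 1))"
proof -
  have mf: "m \<in> functionals" and m0: "\<And>y j. \<lbrakk>y \<in> topspace X; j < r\<rbrakk> \<Longrightarrow> m y (t j y) = 0"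
    and mpos: "Re (m x0 (t r x0)) > 0" "Re (m x0 (s x0)) > 0"
    using m by (auto simp: pos_functional_def)
  define N where "N = {x \<in> topspace X. Re (m x (t r x)) > 0} \<inter> {x \<in> topspace X. Re (m x (s x)) > 0}"
  have N: "openin X N" "x0 \<in> N"
    unfolding N_def using openin_Int[OF pairing_pos_open[OF mf t] pairing_pos_open[OF mf s]] mpos x0 by auto
  have Ninv: "\<phi> g y \<in> N" if "g \<in> carrier G" "y \<in> N" for g y
    using that invariantD[OF pairing_invariant[OF mf t]] invariantD[OF pairing_invariant[OF mf s]] act_in
    by (auto simp: N_def)
  obtain \<kappa> C where \<kappa>: "\<And>y. y \<in> topspace X \<Longrightarrow> Lipschitz_at \<kappa> y" "\<And>y. \<kappa> y \<ge> 0" "\<kappa> x0 > 0"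
    "invariant \<kappa>" "\<And>y. \<lbrakk>y \<in> topspace X; y \<notin> N\<rbrakk> \<Longrightarrow> \<kappa> y = 0"
    and C: "compactin X C" "\<And>y. \<lbrakk>y \<in> topspace X; y \<notin> C\<rbrakk> \<Longrightarrow> \<kappa> y = 0"
    by (rule invariant_bump[OF x0 N Ninv]) (assumption, assumption, blast)
  have \<kappa>c: "continuous_map X euclideanreal \<kappa>" using \<kappa>(1) by (rule Lipschitz_imp_continuous_map)
  have "continuous_map X euclidean (\<lambda>x. \<Sum>j<d. norm (complex_of_real (\<kappa> x) * m x (unit_vec j)))"
    using functionals_continuous[OF mf]
    by (intro continuous_map_sum continuous_map_norm continuous_map_mult continuous_map_of_real \<kappa>c) auto
  then obtain B where B: "B > 0" "\<And>x. x \<in> C \<Longrightarrow> norm (\<Sum>j<d. norm (complex_of_real (\<kappa> x) * m x (unit_vec j))) \<le> B"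
    using compactin_bounded[OF C(1)] by blast
  define q where "q x = complex_of_real (\<kappa> x / B)" for x
  define l where "l x v = q x * m x v" for x v
  have bound: "norm (l x (unit_vec j)) \<le> 1" if x: "x \<in> topspace X" for x j
  proof (cases "x \<in> C \<and> j < d")
    case True
    then have "norm (complex_of_real (\<kappa> x) * m x (unit_vec j)) \<le> (\<Sum>j<d. norm (complex_of_real (\<kappa> x) * m x (unit_vec j)))"
      by (intro member_le_sum[of j "{..<d}" "\<lambda>j. norm (complex_of_real (\<kappa> x) * m x (unit_vec j))"]) auto
    also have "\<dots> \<le> B" using B(2)[of x] True by (simp only: real_norm_def abs_le_iff)
    finally show ?thesis using B(1) by (simp add: l_def q_def norm_mult norm_divide field_simps)
  next
    case False
    moreover have "m x (unit_vec j) = 0" if "j \<ge> d"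
    proof -
      have "m x (unit_vec j) = (\<Sum>i<d. unit_vec j i * m x (unit_vec i))"
        by (rule linfun_expand[OF functionals_linfun[OF mf]])
      also have "\<dots> = 0" using that by (intro sum.neutral) (auto simp: unit_vec_def)
      finally show ?thesis .
    qed
    ultimately show ?thesis using C(2)[OF x] by (auto simp: l_def q_def not_less)
  qed
  have lf: "l \<in> functionals"
    unfolding l_def using \<kappa>(4) \<kappa>c B(1) mf
    by (intro functionals_mult) (auto simp: q_def invariant_def simp del: of_real_divide intro!: continuous_map_of_real continuous_map_real_divide)
  have pos: "Re (l x (t r x)) \<ge> 0 \<and> Re (l x (s x)) \<ge> 0" if x: "x \<in> topspace X" for x
  proof (cases "x \<in> N")
    case True
    then show ?thesis using \<kappa>(2)[of x] B(1) by (simp add: l_def q_def N_def)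
  next
    case False
    then show ?thesis using \<kappa>(5)[OF x] by (simp add: l_def q_def)
  qed
  have "pos_functional r t s x0 l"
    unfolding pos_functional_def using lf m0 mpos \<kappa>(3) B(1) by (simp add: l_def q_def)
  with bound pos show ?thesis by blast
qed

lemma zero_functional: "(\<lambda>x v. 0) \<in> functionals"
  by (simp add: functionals_def cfunctional_def linfun_def)

text \<open>Does the work of a partition of unity without local finiteness: the weights
  \<open>(1/2) ^ k\<close> and the bound 1 give uniform convergence on unit vectors by the
  Weierstrass test.\<close>

lemma functional_series:
  assumes l: "\<And>k. l k \<in> functionals" and bound: "\<And>k x j. x \<in> topspace X \<Longrightarrow> norm (l k x (unit_vec j)) \<le> 1"
  obtains L where "L \<in> functionals"
    "\<And>x v. x \<in> topspace X \<Longrightarrow> (\<lambda>k. (1/2) ^ k * l k x v) sums L x v"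
proof -
  define c where "c j x = (\<Sum>k. (1/2) ^ k * l k x (unit_vec j))" for j x
  have le: "norm ((1/2) ^ k * l k x (unit_vec j)) \<le> (1/2) ^ k" if "x \<in> topspace X" for k x j
    using mult_left_mono[OF bound[OF that, of k j], of "(1/2) ^ k"] by (simp add: norm_mult norm_power)
  have geo: "summable (\<lambda>k. (1/2 :: real) ^ k)" by (rule summable_geometric) simp
  have csum: "(\<lambda>k. (1/2) ^ k * l k x (unit_vec j)) sums c j x" if "x \<in> topspace X" for x j
    unfolding c_def
    by (rule summable_sums, rule summable_comparison_test'[OF geo, of 0]) (use le[OF that] in auto)
  have ccont: "continuous_map X euclidean (c j)" for j
  proof (rule continuous_map_uniform_limit_complex)
    show "uniform_limit (topspace X) (\<lambda>K x. \<Sum>k<K. (1/2) ^ k * l k x (unit_vec j)) (c j) sequentially"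
      unfolding c_def by (rule Weierstrass_m_test[OF _ geo]) (use le in auto)
    show "continuous_map X euclidean (\<lambda>x. \<Sum>k<K. (1/2) ^ k * l k x (unit_vec j))" for K
      using functionals_continuous[OF l] by (intro continuous_map_sum continuous_map_mult) auto
  qed
  define L where "L x v = (\<Sum>j<d. v j * c j x)" for x v
  have Lunit: "L x (unit_vec j) = (if j < d then c j x else 0)" for x j
  proof -
    have "L x (unit_vec j) = (\<Sum>i<d. if i = j then c i x else 0)"
      unfolding L_def unit_vec_def by (intro sum.cong) auto
    then show ?thesis by simp
  qed
  have sums: "(\<lambda>k. (1/2) ^ k * l k x v) sums L x v" if x: "x \<in> topspace X" for x v
  proof -
    have "(\<lambda>k. \<Sum>j<d. v j * ((1/2) ^ k * l k x (unit_vec j))) sums L x v"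
      unfolding L_def by (intro sums_sum sums_mult csum x)
    moreover have "(\<Sum>j<d. v j * ((1/2) ^ k * l k x (unit_vec j))) = (1/2) ^ k * l k x v" for k
    proof -
      have "l k x v = (\<Sum>j<d. v j * l k x (unit_vec j))"
        by (rule linfun_expand[OF functionals_linfun[OF l]])
      then show ?thesis by (simp only: sum_distrib_left mult.left_commute)
    qed
    ultimately show ?thesis by (simp only:)
  qed
  have "L \<in> functionals"
    unfolding functionals_def cfunctional_def
  proof (intro CollectI conjI allI ballI)
    show "linfun d (L x)" for x
      unfolding linfun_def Lunit by (simp add: L_def)
    show "continuous_map X euclidean (\<lambda>x. L x (unit_vec j))" for j
      using ccont by (simp add: Lunit)
    fix g x v assume g: "g \<in> carrier G" and x: "x \<in> topspace X"
    have "(\<lambda>k. (1/2) ^ k * l k x v) sums L (\<phi> g x) (a g x v)"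
      using sums[OF act_in[OF g x], of "a g x v"] functionals_equivariant[OF l g x] by simp
    then show "L (\<phi> g x) (a g x v) = L x v" using sums_unique2 sums[OF x] by blast
  qed
  with sums that show ?thesis by blast
qed

text \<open>All terms of the series have nonnegative real part on both sections, and at every point
  one term is positive on both, so the real parts of the sum cannot vanish.\<close>

lemma global_pos_functional:
  assumes t: "t r \<in> sections" and s: "s \<in> sections"
    and loc: "\<And>x. x \<in> topspace X \<Longrightarrow> \<exists>m. pos_functional r t s x m"
  obtains L where "L \<in> functionals" "\<And>x j. \<lbrakk>x \<in> topspace X; j < r\<rbrakk> \<Longrightarrow> L x (t j x) = 0"
    "\<And>x. x \<in> topspace X \<Longrightarrow> L x (t r x) \<noteq> 0" "\<And>x. x \<in> topspace X \<Longrightarrow> L x (s x) \<noteq> 0"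
proof (cases "topspace X = {}")
  case True
  then show ?thesis using that[OF zero_functional] by blast
next
  case False
  have "\<forall>x0\<in>topspace X. \<exists>l. pos_functional r t s x0 l \<and> (\<forall>x\<in>topspace X. Re (l x (t r x)) \<ge> 0 \<and> Re (l x (s x)) \<ge> 0 \<and>
     (\<forall>j. norm (l x (unit_vec j)) \<le> 1))"
    using loc localize_pos_functional[of t r s, OF t s] by blast
  from bchoice[OF this] obtain l where l: "\<forall>x0\<in>topspace X. pos_functional r t s x0 (l x0) \<and>
     (\<forall>x\<in>topspace X. Re (l x0 x (t r x)) \<ge> 0 \<and> Re (l x0 x (s x)) \<ge> 0 \<and> (\<forall>j. norm (l x0 x (unit_vec j)) \<le> 1))"
    by (elim exE)
  define W where "W x0 = {x \<in> topspace X. Re (l x0 x (t r x)) > 0} \<inter> {x \<in> topspace X. Re (l x0 x (s x)) > 0}" for x0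
  obtain Q where Q: "countable Q" "Q \<subseteq> topspace X" "topspace X \<subseteq> (\<Union>x\<in>Q. W x)"
  proof (rule countable_subcover[of W])
    fix x assume "x \<in> topspace X"
    then have "pos_functional r t s x (l x)" using l by blast
    then show "openin X (W x) \<and> x \<in> W x"
      using openin_Int[OF pairing_pos_open[of "l x", OF _ t] pairing_pos_open[of "l x", OF _ s]] \<open>x \<in> topspace X\<close>
      by (auto simp: W_def pos_functional_def)
  qed
  have "Q \<noteq> {}" using False Q(3) by auto
  \<comment> \<open>The enumeration repeats elements when \<open>Q\<close> is finite, which is
    harmless for a sum of nonnegative terms.\<close>
  define m where "m k = l (from_nat_into Q k)" for k
  have mQ: "from_nat_into Q k \<in> topspace X" for k using from_nat_into[OF \<open>Q \<noteq> {}\<close>] Q(2) by blast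
  have mf: "m k \<in> functionals" for k using l mQ by (auto simp: m_def pos_functional_def)
  have mb: "norm (m k x (unit_vec j)) \<le> 1" if "x \<in> topspace X" for k x j
    using l mQ that by (auto simp: m_def)
  obtain L where L: "L \<in> functionals" "\<And>x v. x \<in> topspace X \<Longrightarrow> (\<lambda>k. (1/2) ^ k * m k x v) sums L x v"
    by (rule functional_series[where l = m, OF mf mb]) (assumption, blast)
  have pos: "Re (L x v) > 0" if x: "x \<in> topspace X" and ge: "\<And>k. Re (m k x v) \<ge> 0" and "Re (m k x v) > 0" for x v k
  proof -
    have "(\<lambda>k. (1/2) ^ k * Re (m k x v)) sums Re (L x v)"
      using sums_Re[OF L(2)[OF x, of v]] by (simp add: Re_power_real flip: of_real_power complex_of_real_def)
    then show ?thesis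
      using suminf_pos2[of "\<lambda>k. (1/2) ^ k * Re (m k x v)" k] ge that(3)
      by (simp add: sums_iff)
  qed
  have ex: "\<exists>k. Re (m k x (t r x)) > 0 \<and> Re (m k x (s x)) > 0" if "x \<in> topspace X" for x
  proof -
    have "x \<in> (\<Union>x\<in>Q. W x)" using that Q(3) by blast
    then obtain x0 where x0: "x0 \<in> Q" "x \<in> W x0" by blast
    obtain k where "from_nat_into Q k = x0" using from_nat_into_surj[OF Q(1) x0(1)] by blast
    then show ?thesis using x0(2) by (auto simp: m_def W_def)
  qed
  have ge: "Re (m k x (t r x)) \<ge> 0" "Re (m k x (s x)) \<ge> 0" if "x \<in> topspace X" for k x
    using l mQ that by (auto simp: m_def)
  show ?thesis
  proof (rule that[OF L(1)])
    show "L x (t j x) = 0" if "x \<in> topspace X" "j < r" for x j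
    proof -
      have "m k x (t j x) = 0" for k using l mQ that by (auto simp: m_def pos_functional_def)
      then show ?thesis using L(2)[OF that(1), of "t j x"] by (simp add: sums_iff)
    qed
    show "L x (t r x) \<noteq> 0" "L x (s x) \<noteq> 0" if x: "x \<in> topspace X" for x
      using pos[OF x] ge[OF x] ex[OF x] by fastforce+
  qed
qed

section \<open>Equivariant automorphisms and transvections\<close>

definition automorphism :: "('x \<Rightarrow> cvector \<Rightarrow> cvector) \<Rightarrow> bool" where
  "automorphism S \<longleftrightarrow> (\<forall>x\<in>topspace X. linop d (S x)) \<and>
     (\<forall>i. \<forall>j<d. continuous_map X euclidean (\<lambda>x. S x (unit_vec j) i)) \<and>
     (\<forall>g\<in>carrier G. \<forall>x\<in>topspace X. \<forall>v\<in>cvec d. S (\<phi> g x) (a g x v) = a g x (S x v))"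

text \<open>The inverse is carried along as a second automorphism, which spares a proof that
  inversion preserves continuity and equivariance.\<close>

definition inverse_automorphisms ::
    "('x \<Rightarrow> cvector \<Rightarrow> cvector) \<Rightarrow> ('x \<Rightarrow> cvector \<Rightarrow> cvector) \<Rightarrow> bool" where
  "inverse_automorphisms S T \<longleftrightarrow> automorphism S \<and> automorphism T \<and>
     (\<forall>x\<in>topspace X. \<forall>v\<in>cvec d. S x (T x v) = v \<and> T x (S x v) = v)"

lemma automorphismD:
  assumes "automorphism S"
  shows automorphism_linop: "x \<in> topspace X \<Longrightarrow> linop d (S x)"
    and automorphism_continuous: "j < d \<Longrightarrow> continuous_map X euclidean (\<lambda>x. S x (unit_vec j) i)"
    and automorphism_equivariant:
      "\<lbrakk>g \<in> carrier G; x \<in> topspace X; v \<in> cvec d\<rbrakk> \<Longrightarrow> S (\<phi> g x) (a g x v) = a g x (S x v)"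
  using assms by (auto simp: automorphism_def)

lemma automorphism_apply_continuous:
  assumes "automorphism S" "\<And>i. continuous_map X euclidean (\<lambda>x. s x i)"
  shows "continuous_map X euclidean (\<lambda>x. S x (s x) i)"
proof -
  have "continuous_map X euclidean (\<lambda>x. \<Sum>j<d. s x j * S x (unit_vec j) i)"
    using assms automorphism_continuous by (intro continuous_map_sum continuous_map_mult) auto
  then show ?thesis
  proof (rule continuous_map_eq)
    fix x assume "x \<in> topspace X"
    then show "(\<Sum>j<d. s x j * S x (unit_vec j) i) = S x (s x) i"
      by (rule linfun_expand[OF linop_linfun[OF automorphism_linop[OF assms(1)]], symmetric])
  qed
qed

lemma automorphism_section:
  assumes "automorphism S" "s \<in> sections"
  shows "(\<lambda>x. S x (s x)) \<in> sections"
  using assms automorphism_apply_continuous[OF assms(1) sections_continuous[OF assms(2)]]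
  by (auto simp: sections_def csection_def automorphism_equivariant linop_cvec[OF automorphism_linop])

lemma automorphism_comp:
  assumes "automorphism S" "automorphism T"
  shows "automorphism (\<lambda>x v. S x (T x v))"
  unfolding automorphism_def
proof (intro conjI ballI allI impI)
  show "linop d (\<lambda>v. S x (T x v))" if "x \<in> topspace X" for x
    by (rule linop_comp[OF automorphism_linop[OF assms(1) that] automorphism_linop[OF assms(2) that]])
  show "continuous_map X euclidean (\<lambda>x. S x (T x (unit_vec j)) i)" if "j < d" for i j
    by (rule automorphism_apply_continuous[OF assms(1) automorphism_continuous[OF assms(2) that]])
  fix g x v assume "g \<in> carrier G" "x \<in> topspace X" "v \<in> cvec d"
  then show "S (\<phi> g x) (T (\<phi> g x) (a g x v)) = a g x (S x (T x v))"
    using linop_cvec[OF automorphism_linop[OF assms(2)]] assms by (simp add: automorphism_equivariant)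
qed

lemma inverse_automorphisms_comp:
  assumes "inverse_automorphisms S S'" "inverse_automorphisms T T'"
  shows "inverse_automorphisms (\<lambda>x v. S x (T x v)) (\<lambda>x v. T' x (S' x v))"
proof -
  have aut: "automorphism S" "automorphism S'" "automorphism T" "automorphism T'"
    using assms by (auto simp: inverse_automorphisms_def)
  have "S x (T x (T' x (S' x v))) = v \<and> T' x (S' x (S x (T x v))) = v"
    if x: "x \<in> topspace X" and v: "v \<in> cvec d" for x v
    using assms v x linop_cvec[OF automorphism_linop[OF aut(2) x], of v]
      linop_cvec[OF automorphism_linop[OF aut(3) x], of v]
    by (simp add: inverse_automorphisms_def)
  then show ?thesis
    unfolding inverse_automorphisms_def using automorphism_comp[OF aut(1,3)] automorphism_comp[OF aut(4,2)]
    by blast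
qed

lemma inverse_automorphisms_sym: "inverse_automorphisms S T \<Longrightarrow> inverse_automorphisms T S"
  by (auto simp: inverse_automorphisms_def)

text \<open>The truncation of \<open>v\<close> serves \<open>linop\<close>, which speaks of all
  sequences. In contrast to a transvection in the strict sense, \<open>l x (c x)\<close> need not be
  0; on \<open>cvec d\<close> the determinant is \<open>1 + l x (c x)\<close>.\<close>

definition transvection ::
    "('x \<Rightarrow> cvector \<Rightarrow> complex) \<Rightarrow> ('x \<Rightarrow> cvector) \<Rightarrow> 'x \<Rightarrow> cvector \<Rightarrow> cvector" where
  "transvection l c x v = (\<lambda>i. (if i < d then v i else 0) + l x v * c x i)"

lemma transvection_apply: "v \<in> cvec d \<Longrightarrow> transvection l c x v = (\<lambda>i. v i + l x v * c x i)"
  by (auto simp: transvection_def cvec_def fun_eq_iff)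

lemma transvection_automorphism:
  assumes l: "l \<in> functionals" and c: "c \<in> sections"
  shows "automorphism (transvection l c)"
  unfolding automorphism_def
proof (intro conjI ballI allI impI)
  fix x assume x: "x \<in> topspace X"
  show "linop d (transvection l c x)"
    unfolding linop_def
  proof (intro conjI allI)
    show "transvection l c x v \<in> cvec d" for v
      using sections_cvec[OF c x] by (auto simp: transvection_def cvec_def)
    fix i
    have lc: "linfun d (\<lambda>v. c x i * l x v)" by (rule linfun_mult[OF functionals_linfun[OF l]])
    show "linfun d (\<lambda>v. transvection l c x v i)"
    proof (cases "i < d")
      case True
      then show ?thesis
        using linfun_plus[OF linfun_coord[OF True] lc] by (simp add: transvection_def mult.commute)
    next
      case False
      then show ?thesis using lc by (simp add: transvection_def mult.commute)
    qed
  qed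
next
  fix i j
  show "continuous_map X euclidean (\<lambda>x. transvection l c x (unit_vec j) i)"
    unfolding transvection_def
    by (intro continuous_map_add continuous_map_mult functionals_continuous[OF l] sections_continuous[OF c]) auto
next
  fix g x v assume g: "g \<in> carrier G" and x: "x \<in> topspace X" and v: "v \<in> cvec d"
  have "transvection l c (\<phi> g x) (a g x v) = (\<lambda>i. a g x v i + l x v * a g x (c x) i)"
    using linop_cvec[OF a_linop[OF g x]]
    by (simp add: transvection_apply functionals_equivariant[OF l g x] sections_equivariant[OF c g x])
  also have "\<dots> = a g x (transvection l c x v)"
    using linop_add[OF a_linop[OF g x], of v "\<lambda>i. l x v * c x i"] linop_scale[OF a_linop[OF g x], of "l x v" "c x"]
    by (simp add: transvection_apply[OF v])
  finally show "transvection l c (\<phi> g x) (a g x v) = a g x (transvection l c x v)" .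
qed

text \<open>With a common functional the composite has the same form again; its vector is the left
  side of \<open>inv\<close>.\<close>

lemma transvection_comp:
  assumes l: "l \<in> functionals" and c: "c \<in> sections" and x: "x \<in> topspace X" and v: "v \<in> cvec d"
    and inv: "\<And>i. c x i + e x i + l x (c x) * e x i = 0"
  shows "transvection l e x (transvection l c x v) = v"
proof -
  have mem: "(\<lambda>i. v i + l x v * c x i) \<in> cvec d"
    by (intro cvec_add cvec_scale v sections_cvec[OF c x])
  have "l x (\<lambda>i. v i + l x v * c x i) = l x v + l x v * l x (c x)"
    using linfun_add[OF functionals_linfun[OF l, of x], of v "\<lambda>i. l x v * c x i"]
      linfun_scale[OF functionals_linfun[OF l, of x], of "l x v" "c x"] by simp
  then have "transvection l e x (transvection l c x v) i
      = v i + l x v * c x i + (l x v + l x v * l x (c x)) * e x i" for i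
    by (simp only: transvection_apply[OF v] transvection_apply[OF mem])
  then have "transvection l e x (transvection l c x v) i = v i + l x v * (c x i + e x i + l x (c x) * e x i)" for i
    by (simp add: algebra_simps)
  then show ?thesis using inv by auto
qed

text \<open>The vector \<open>c\<close> is forced by \<open>b + l(b) c = w\<close>. The inverse
  arises by exchanging \<open>b\<close> and \<open>w\<close>, which is why \<open>l\<close> must
  vanish on neither of them.\<close>

lemma moving_transvection:
  assumes l: "l \<in> functionals" and b: "b \<in> sections" and w: "w \<in> sections"
    and lb: "\<And>x. x \<in> topspace X \<Longrightarrow> l x (b x) \<noteq> 0" and lw: "\<And>x. x \<in> topspace X \<Longrightarrow> l x (w x) \<noteq> 0"
  obtains S S' where "inverse_automorphisms S S'" "\<And>x. x \<in> topspace X \<Longrightarrow> S x (b x) = w x"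
    "\<And>x v. \<lbrakk>x \<in> topspace X; v \<in> cvec d; l x v = 0\<rbrakk> \<Longrightarrow> S x v = v"
proof -
  define e where "e x = (\<lambda>i. w x i + (-1) * b x i)" for x
  define c where "c x = (\<lambda>i. (1 / l x (b x)) * e x i)" for x
  define c' where "c' x = (\<lambda>i. (- 1 / l x (w x)) * e x i)" for x
  have e: "e \<in> sections"
    unfolding e_def by (intro sections_add w sections_mult b) (auto simp: invariant_def)
  have "c \<in> sections"
    unfolding c_def using pairing_invariant[OF l b]
    by (intro sections_mult[OF continuous_map_divide_complex[OF _ pairing_continuous[OF l b] lb] _ e])
      (auto simp: invariant_def)
  moreover have "c' \<in> sections"
    unfolding c'_def using pairing_invariant[OF l w]
    by (intro sections_mult[OF continuous_map_divide_complex[OF _ pairing_continuous[OF l w] lw] _ e])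
      (auto simp: invariant_def)
  ultimately have c: "c \<in> sections" "c' \<in> sections" by auto
  have le: "l x (e x) = l x (w x) - l x (b x)" for x
    using linfun_add[OF functionals_linfun[OF l], of x "w x" "\<lambda>i. (-1) * b x i"]
      linfun_scale[OF functionals_linfun[OF l], of x "-1" "b x"] by (simp add: e_def)
  have lc: "l x (c x) = (l x (w x) - l x (b x)) / l x (b x)" for x
    using linfun_scale[OF functionals_linfun[OF l], of x "1 / l x (b x)" "e x"] by (simp add: c_def le)
  have lc': "l x (c' x) = (l x (b x) - l x (w x)) / l x (w x)" for x
    using linfun_scale[OF functionals_linfun[OF l], of x "- 1 / l x (w x)" "e x"] by (simp add: c'_def le diff_divide_distrib)
  show ?thesis
  proof (rule that[of "transvection l c" "transvection l c'"])
    have "c x i + c' x i + l x (c x) * c' x i = 0" "c' x i + c x i + l x (c' x) * c x i = 0"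
      if "x \<in> topspace X" for x i
      using lb[OF that] lw[OF that] unfolding lc lc' by (simp_all add: c_def c'_def field_simps)
    then show "inverse_automorphisms (transvection l c) (transvection l c')"
      using c l by (auto simp: inverse_automorphisms_def transvection_automorphism transvection_comp)
    show "transvection l c x (b x) = w x" if x: "x \<in> topspace X" for x
      using lb[OF x] sections_cvec[OF b x] by (simp add: transvection_apply c_def e_def)
    show "transvection l c x v = v" if "x \<in> topspace X" "v \<in> cvec d" "l x v = 0" for x v
      using that by (simp add: transvection_apply)
  qed
qed

text \<open>Once \<open>S\<close> matches the first \<open>r\<close> columns, \<open>R True\<close>
  and \<open>R False\<close> fix these and carry the two last columns to the same \<open>w\<close>;
  following one by the inverse of the other completes the induction step.\<close>

theorem frames_conjugate:
  assumes "\<And>j. j < r \<Longrightarrow> u j \<in> sections" "\<And>j. j < r \<Longrightarrow> u' j \<in> sections"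
    and "\<And>x. x \<in> topspace X \<Longrightarrow> indep r (\<lambda>j. u j x)" "\<And>x. x \<in> topspace X \<Longrightarrow> indep r (\<lambda>j. u' j x)"
    and "n + 2 * r \<le> 2 * d"
  shows "\<exists>S S'. inverse_automorphisms S S' \<and> (\<forall>x\<in>topspace X. \<forall>j<r. S x (u' j x) = u j x)"
  using assms
proof (induction r)
  case 0
  \<comment> \<open>This is the identity of \<open>cvec d\<close> in the truncated form that
    \<open>linop\<close> requires.\<close>
  have "automorphism (transvection (\<lambda>x v. 0) (\<lambda>x i. 0))"
    by (rule transvection_automorphism[OF zero_functional sections_zero])
  then have "inverse_automorphisms (transvection (\<lambda>x v. 0) (\<lambda>x i. 0)) (transvection (\<lambda>x v. 0) (\<lambda>x i. 0))"
    by (simp add: inverse_automorphisms_def transvection_apply)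
  then show ?case by auto
next
  case (Suc r)
  have restrict: "indep r v" if "indep (Suc r) v" for v
    unfolding indep_def
  proof (intro allI impI)
    fix c j assume "\<forall>i. (\<Sum>j<r. c j * v j i) = 0" "j < r"
    then show "c j = 0" using that[unfolded indep_def, rule_format, of "c(r := 0)" j] by simp
  qed
  have "\<exists>S S'. inverse_automorphisms S S' \<and> (\<forall>x\<in>topspace X. \<forall>j<r. S x (u' j x) = u j x)"
    using Suc.prems restrict by (intro Suc.IH) auto
  then obtain S S' where S: "inverse_automorphisms S S'"
    and Su: "\<And>x j. \<lbrakk>x \<in> topspace X; j < r\<rbrakk> \<Longrightarrow> S x (u' j x) = u j x" by blast
  have Saut: "automorphism S" "automorphism S'" and S'S: "\<And>x v. \<lbrakk>x \<in> topspace X; v \<in> cvec d\<rbrakk> \<Longrightarrow> S' x (S x v) = v"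
    using S by (auto simp: inverse_automorphisms_def)
  define b where "b x = S x (u' r x)" for x
  have b: "b \<in> sections" unfolding b_def by (rule automorphism_section[OF Saut(1) Suc.prems(2)]) simp
  \<comment> \<open>Over \<open>X\<close>, \<open>T True\<close> is the image of \<open>u'\<close>
    under \<open>S\<close> and \<open>T False\<close> is \<open>u\<close>; only column
    \<open>r\<close> can differ, so both have the same \<open>F\<close>.\<close>
  define T where "T q = (if q then u(r := b) else u)" for q
  have Tsec: "T q j \<in> sections" if "j < Suc r" for q j
    using that Suc.prems(1) b by (auto simp: T_def)
  have Tind: "indep (Suc r) (\<lambda>j. T q j x)" if x: "x \<in> topspace X" for q x
  proof (cases q)
    case True
    show ?thesis
      unfolding indep_def
    proof (intro allI impI)
      fix c j assume c: "\<forall>i. (\<Sum>j<Suc r. c j * T q j x i) = 0" and j: "j < Suc r"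
      have TS: "T q j x = S x (u' j x)" if "j < Suc r" for j
        using that True Su[OF x] by (auto simp: T_def b_def less_Suc_eq)
      have v: "(\<lambda>i. \<Sum>j<Suc r. c j * u' j x i) \<in> cvec d"
        using Suc.prems(2) x by (intro cvec_sum sections_cvec) auto
      have "S x (\<lambda>i. \<Sum>j<Suc r. c j * u' j x i) = (\<lambda>i. \<Sum>j<Suc r. c j * S x (u' j x) i)"
        by (rule linop_sum[OF automorphism_linop[OF Saut(1) x]])
      also have "\<dots> = (\<lambda>i. \<Sum>j<Suc r. c j * T q j x i)"
        by (intro ext sum.cong refl) (simp add: TS)
      also have "\<dots> = (\<lambda>i. 0)" using c by simp
      finally have "(\<lambda>i. \<Sum>j<Suc r. c j * u' j x i) = S' x (\<lambda>i. 0)"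
        using S'S[OF x v] by simp
      also have "\<dots> = (\<lambda>i. 0)"
        using linfun_zero[OF linop_linfun[OF automorphism_linop[OF Saut(2) x]]] by auto
      finally show "c j = 0"
        using Suc.prems(4)[OF x] j unfolding indep_def fun_eq_iff by blast
    qed
  qed (use Suc.prems(3)[OF x] in \<open>simp add: T_def\<close>)
  obtain w where w: "w \<in> sections" "\<And>q x. x \<in> topspace X \<Longrightarrow> \<exists>m. pos_functional r (T q) w x m"
    by (rule general_position[of "UNIV :: bool set" r T]) (use Tsec Tind Suc.prems(5) in auto)
  have "\<exists>R R'. inverse_automorphisms R R' \<and> (\<forall>x\<in>topspace X. R x (T q r x) = w x \<and> (\<forall>j<r. R x (u j x) = u j x))" for q
  proof -
    have Tr: "T q r \<in> sections" by (rule Tsec) simp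
    obtain L where L: "L \<in> functionals" "\<And>x j. \<lbrakk>x \<in> topspace X; j < r\<rbrakk> \<Longrightarrow> L x (T q j x) = 0"
      "\<And>x. x \<in> topspace X \<Longrightarrow> L x (T q r x) \<noteq> 0" "\<And>x. x \<in> topspace X \<Longrightarrow> L x (w x) \<noteq> 0"
      by (rule global_pos_functional[OF Tr w]) (assumption, blast)
    obtain R R' where R: "inverse_automorphisms R R'" "\<And>x. x \<in> topspace X \<Longrightarrow> R x (T q r x) = w x"
      "\<And>x v. \<lbrakk>x \<in> topspace X; v \<in> cvec d; L x v = 0\<rbrakk> \<Longrightarrow> R x v = v"
      by (rule moving_transvection[OF L(1) Tr w(1) L(3,4)]) (assumption, assumption, blast)
    have "R x (u j x) = u j x" if "x \<in> topspace X" "j < r" for x j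
      using that L(2)[OF that] Suc.prems(1)[of j]
      by (intro R(3)) (auto simp: T_def sections_cvec split: if_splits)
    with R(1,2) show ?thesis by blast
  qed
  then obtain R R' where R: "\<And>q. inverse_automorphisms (R q) (R' q)"
    "\<And>q x. x \<in> topspace X \<Longrightarrow> R q x (T q r x) = w x"
    "\<And>q x j. \<lbrakk>x \<in> topspace X; j < r\<rbrakk> \<Longrightarrow> R q x (u j x) = u j x"
    by metis
  have cancel: "R' False x (R False x v) = v" if "x \<in> topspace X" "v \<in> cvec d" for x v
    using R(1)[of False] that by (auto simp: inverse_automorphisms_def)
  have u: "u j x \<in> cvec d" if "x \<in> topspace X" "j < Suc r" for x j
    using Suc.prems(1) that by (auto intro: sections_cvec)
  have "inverse_automorphisms (\<lambda>x v. R' False x (R True x (S x v))) (\<lambda>x v. S' x (R' True x (R False x v)))"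
    using inverse_automorphisms_comp[OF inverse_automorphisms_sym[OF R(1)[of False]]
        inverse_automorphisms_comp[OF R(1)[of True] S]] .
  moreover have "R' False x (R True x (S x (u' j x))) = u j x" if x: "x \<in> topspace X" and j: "j < Suc r" for x j
  proof (cases "j = r")
    case True
    then show ?thesis
      using R(2)[OF x, of True] R(2)[OF x, of False] cancel[OF x u[OF x j]] by (simp add: T_def b_def)
  next
    case False
    then have "j < r" using j by simp
    then show ?thesis
      using R(3)[OF x] Su[OF x] cancel[OF x u[OF x j]] by metis
  qed
  ultimately show ?case by blast
qed

end

section \<open>Trivialized bundles\<close>

definition truncate :: "nat \<Rightarrow> cvector \<Rightarrow> cvector" where
  "truncate d v = (\<lambda>i. if i < d then v i else 0)"

lemma truncate_cvec: "truncate d v \<in> cvec d"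
  and truncate_id: "v \<in> cvec d \<Longrightarrow> truncate d v = v"
  by (auto simp: truncate_def cvec_def fun_eq_iff)

lemma linear_between_comp:
  "\<lbrakk>linear_between M N f; linear_between N K g\<rbrakk> \<Longrightarrow> linear_between M K (g \<circ> f)"
  unfolding linear_between_def by (auto simp: Pi_iff)

lemma product_bundle_simps [simp]:
  "total_space (product_bundle X d) = prod_topology X (complex_space d)"
  "proj (product_bundle X d) = fst"
  "carrier (fibre (product_bundle X d) x) = {x} \<times> cvec d"
  "(y, v) \<oplus>\<^bsub>fibre (product_bundle X d) x\<^esub> (z, w) = (x, \<lambda>i. v i + w i)"
  "c \<odot>\<^bsub>fibre (product_bundle X d) x\<^esub> (y, v) = (x, \<lambda>i. c * v i)"
  by (auto simp: product_bundle_def topspace_complex_space)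

text \<open>\<open>linear_between\<close> provides additivity for two vectors, so the expansion is
  built up by adding one coordinate of \<open>v\<close> at a time.\<close>

lemma linear_between_product_bundles_expand:
  assumes f: "linear_between (fibre (product_bundle X r) x) (fibre (product_bundle Y d) y) f"
    and v: "v \<in> cvec r"
  shows "f (x, v) = (y, \<lambda>i. \<Sum>j<r. v j * snd (f (x, unit_vec j)) i)"
proof -
  have val: "f (x, w) \<in> {y} \<times> cvec d" if "w \<in> cvec r" for w
    using f that unfolding linear_between_def by (auto simp: Pi_iff)
  have add: "f (x, \<lambda>i. w i + w' i) = (y, \<lambda>i. snd (f (x, w)) i + snd (f (x, w')) i)"
    if "w \<in> cvec r" "w' \<in> cvec r" for w w'
  proof -
    have "f ((x, w) \<oplus>\<^bsub>fibre (product_bundle X r) x\<^esub> (x, w'))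
        = f (x, w) \<oplus>\<^bsub>fibre (product_bundle Y d) y\<^esub> f (x, w')"
      using f that unfolding linear_between_def by auto
    then show ?thesis by (cases "f (x, w)"; cases "f (x, w')") simp
  qed
  have scale: "f (x, \<lambda>i. c * w i) = (y, \<lambda>i. c * snd (f (x, w)) i)" if "w \<in> cvec r" for c w
  proof -
    have "f (c \<odot>\<^bsub>fibre (product_bundle X r) x\<^esub> (x, w)) = c \<odot>\<^bsub>fibre (product_bundle Y d) y\<^esub> f (x, w)"
      using f that unfolding linear_between_def by auto
    then show ?thesis by (cases "f (x, w)") simp
  qed
  have "f (x, \<lambda>i. if i < m then v i else 0) = (y, \<lambda>i. \<Sum>j<m. v j * snd (f (x, unit_vec j)) i)" if "m \<le> r" for m
    using that
  proof (induction m)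
    case 0
    show ?case using scale[OF v, of 0] by simp
  next
    case (Suc m)
    have e: "unit_vec m \<in> cvec r" using Suc.prems by (simp add: unit_vec_cvec)
    have w: "(\<lambda>i. if i < m then v i else 0) \<in> cvec r" using Suc.prems by (auto simp: cvec_def)
    have "(\<lambda>i. if i < Suc m then v i else 0) = (\<lambda>i. (if i < m then v i else 0) + v m * unit_vec m i)"
      by (auto simp: unit_vec_def less_Suc_eq)
    then show ?case
      using add[OF w cvec_scale[OF e, of "v m"]] scale[OF e, of "v m"] Suc by simp
  qed
  from this[of r] show ?thesis using truncate_id[OF v] by (simp add: truncate_def)
qed

lemma complex_space_coordinate_continuous: "continuous_map (complex_space d) euclidean (\<lambda>v. v i)"
  unfolding complex_space_def
  by (intro continuous_map_from_subtopology continuous_map_product_projection) simp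

lemma continuous_map_into_complex_space:
  assumes "\<And>i. continuous_map Y euclidean (\<lambda>y. f y i)" "\<And>y. y \<in> topspace Y \<Longrightarrow> f y \<in> cvec d"
  shows "continuous_map Y (complex_space d) f"
  using assms unfolding complex_space_def continuous_map_in_subtopology
  by (auto simp: continuous_map_componentwise_UNIV cvec_def)

locale trivialized_bundle = smooth_G_manifold G n X A \<phi>
  for G :: "('g, 'z) monoid_scheme" (structure)
    and n :: nat and X :: "'x topology" and A :: "'x chart set" and \<phi> :: "'g \<Rightarrow> 'x \<Rightarrow> 'x" +
  fixes \<xi> :: "('x, 'e) vbundle" and \<psi> :: "'g \<Rightarrow> 'e \<Rightarrow> 'e" and d :: nat
    and h :: "'e \<Rightarrow> 'x \<times> cvector" and k :: "'x \<times> cvector \<Rightarrow> 'e"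
  assumes eqv: "equivariant_vector_bundle G X \<phi> \<xi> \<psi>"
    and h_map: "bundle_map X \<xi> (product_bundle X d) h" and k_map: "bundle_map X (product_bundle X d) \<xi> k"
    and hk: "homeomorphic_maps (total_space \<xi>) (total_space (product_bundle X d)) h k"
    and stab: "\<lbrakk>x \<in> topspace X; g \<in> stabilizer G \<phi> x; e \<in> carrier (fibre \<xi> x)\<rbrakk> \<Longrightarrow> \<psi> g e = e"
begin

abbreviation "E \<equiv> topspace (total_space \<xi>)"

text \<open>The action of \<open>g\<close> read through the trivialization. Truncating first gives a
  map on all sequences, although \<open>k\<close> is controlled on \<open>cvec d\<close>
  only.\<close>

definition a :: "'g \<Rightarrow> 'x \<Rightarrow> cvector \<Rightarrow> cvector" where
  "a g x v = snd (h (\<psi> g (k (x, truncate d v))))"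

lemma k_h: "e \<in> E \<Longrightarrow> k (h e) = e"
  and h_k: "\<lbrakk>x \<in> topspace X; v \<in> cvec d\<rbrakk> \<Longrightarrow> h (k (x, v)) = (x, v)"
  using hk by (auto simp: homeomorphic_maps_def topspace_complex_space)

lemma h_continuous: "continuous_map (total_space \<xi>) (prod_topology X (complex_space d)) h"
  and k_continuous: "continuous_map (prod_topology X (complex_space d)) (total_space \<xi>) k"
  using h_map k_map by (auto simp: bundle_map_def)

lemma proj_in: "e \<in> E \<Longrightarrow> proj \<xi> e \<in> topspace X"
  using eqv by (auto simp: equivariant_vector_bundle_def vector_bundle_def continuous_map_def)

lemma fibre_carrier: "x \<in> topspace X \<Longrightarrow> carrier (fibre \<xi> x) = {e \<in> E. proj \<xi> e = x}"
  using eqv by (auto simp: equivariant_vector_bundle_def vector_bundle_def)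

lemma h_eq: "e \<in> E \<Longrightarrow> h e = (proj \<xi> e, snd (h e))"
  using h_map by (auto simp: bundle_map_def prod_eq_iff)

lemma h_in: "e \<in> E \<Longrightarrow> snd (h e) \<in> cvec d"
  using continuous_map_image_subset_topspace[OF h_continuous] by (auto simp: topspace_complex_space)

lemma k_in: "\<lbrakk>x \<in> topspace X; v \<in> cvec d\<rbrakk> \<Longrightarrow> k (x, v) \<in> E"
  using continuous_map_image_subset_topspace[OF k_continuous] by (auto simp: topspace_complex_space)

lemma proj_k: "\<lbrakk>x \<in> topspace X; v \<in> cvec d\<rbrakk> \<Longrightarrow> proj \<xi> (k (x, v)) = x"
  using k_map by (auto simp: bundle_map_def topspace_complex_space)

lemma \<psi>_continuous: "g \<in> carrier G \<Longrightarrow> continuous_map (total_space \<xi>) (total_space \<xi>) (\<psi> g)"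
  using eqv by (auto simp: equivariant_vector_bundle_def continuous_action_def)

lemma \<psi>_in: "\<lbrakk>g \<in> carrier G; e \<in> E\<rbrakk> \<Longrightarrow> \<psi> g e \<in> E"
  using continuous_map_image_subset_topspace[OF \<psi>_continuous] by auto

lemma proj_\<psi>: "\<lbrakk>g \<in> carrier G; e \<in> E\<rbrakk> \<Longrightarrow> proj \<xi> (\<psi> g e) = \<phi> g (proj \<xi> e)"
  using eqv by (auto simp: equivariant_vector_bundle_def)

lemma \<psi>_comp: "\<lbrakk>g \<in> carrier G; g' \<in> carrier G; e \<in> E\<rbrakk> \<Longrightarrow> \<psi> (g \<otimes> g') e = \<psi> g (\<psi> g' e)"
  using eqv group_action.composition_rule[of G E \<psi>]
  by (auto simp: equivariant_vector_bundle_def continuous_action_def)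

lemma h_\<psi>_k:
  assumes "g \<in> carrier G" "x \<in> topspace X" "v \<in> cvec d"
  shows "h (\<psi> g (k (x, v))) = (\<phi> g x, a g x v)"
proof -
  have e: "k (x, v) \<in> E" using k_in assms by blast
  show ?thesis
    using h_eq[OF \<psi>_in[OF assms(1) e]] proj_\<psi>[OF assms(1) e] proj_k[OF assms(2,3)]
    by (simp add: a_def truncate_id[OF assms(3)])
qed

lemma h_\<psi>: "\<lbrakk>g \<in> carrier G; e \<in> E\<rbrakk> \<Longrightarrow> h (\<psi> g e) = (\<phi> g (proj \<xi> e), a g (proj \<xi> e) (snd (h e)))"
  using h_\<psi>_k[of g "proj \<xi> e" "snd (h e)"] k_h h_eq[of e] h_in proj_in by simp

lemma h_linear: "x \<in> topspace X \<Longrightarrow> linear_between (fibre \<xi> x) (fibre (product_bundle X d) x) h"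
  and k_linear: "x \<in> topspace X \<Longrightarrow> linear_between (fibre (product_bundle X d) x) (fibre \<xi> x) k"
  using h_map k_map by (auto simp: bundle_map_def)

lemma fibre_continuous:
  assumes "continuous_map (prod_topology X (complex_space m)) (prod_topology X (complex_space d)) f" "j < m"
  shows "continuous_map X euclidean (\<lambda>x. snd (f (x, unit_vec j)) i)"
proof -
  have "continuous_map X (prod_topology X (complex_space m)) (\<lambda>x. (x, unit_vec j))"
    using unit_vec_cvec[OF assms(2)] by (intro continuous_map_pairedI) (auto simp: topspace_complex_space)
  from continuous_map_compose[OF this assms(1)]
  have "continuous_map X (prod_topology X (complex_space d)) (\<lambda>x. f (x, unit_vec j))"
    by (simp add: o_def)
  from continuous_map_compose[OF continuous_map_compose[OF this continuous_map_snd]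
      complex_space_coordinate_continuous]
  show ?thesis by (simp add: o_def)
qed

lemma a_is_linop:
  assumes g: "g \<in> carrier G" and x: "x \<in> topspace X"
  shows "linop d (a g x)"
proof -
  have "linear_between (fibre \<xi> x) (fibre \<xi> (\<phi> g x)) (\<psi> g)"
    using eqv g x by (auto simp: equivariant_vector_bundle_def)
  then have lin: "linear_between (fibre (product_bundle X d) x) (fibre (product_bundle X d) (\<phi> g x)) (h \<circ> (\<psi> g \<circ> k))"
    by (intro linear_between_comp[OF linear_between_comp[OF k_linear[OF x]] h_linear[OF act_in[OF g x]]])
  have "a g x v i = (\<Sum>j<d. v j * a g x (unit_vec j) i)" for v i
  proof -
    have "a g x v i = (\<Sum>j<d. truncate d v j * snd (h (\<psi> g (k (x, unit_vec j)))) i)"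
      unfolding a_def using linear_between_product_bundles_expand[OF lin truncate_cvec[of d v]] by simp
    also have "\<dots> = (\<Sum>j<d. v j * a g x (unit_vec j) i)"
      by (intro sum.cong refl) (simp add: a_def truncate_id unit_vec_cvec, simp add: truncate_def)
    finally show ?thesis .
  qed
  moreover have "a g x v \<in> cvec d" for v
    unfolding a_def by (intro h_in \<psi>_in g k_in x truncate_cvec)
  ultimately show ?thesis unfolding linop_def linfun_def by blast
qed

text \<open>The cocycle identity is the composition rule of \<open>\<psi>\<close> read through
  \<open>h\<close> and \<open>k\<close>; triviality on isotropy groups is
  \<open>stab\<close>.\<close>

sublocale equivariant_family G n X A \<phi> d a
proof
  show "linop d (a g x)" if "g \<in> carrier G" "x \<in> topspace X" for g x
    using that by (rule a_is_linop)
  show "continuous_map X euclidean (\<lambda>x. a g x (unit_vec j) i)" if g: "g \<in> carrier G" and j: "j < d" for g j i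
    using fibre_continuous[OF continuous_map_compose[OF k_continuous continuous_map_compose[OF \<psi>_continuous[OF g] h_continuous]] j, of i]
    by (simp add: a_def truncate_id[OF unit_vec_cvec[OF j]])
  show "a (g \<otimes> g') x v = a g (\<phi> g' x) (a g' x v)"
    if g: "g \<in> carrier G" "g' \<in> carrier G" and x: "x \<in> topspace X" for g g' x v
  proof -
    have e: "k (x, truncate d v) \<in> E" by (rule k_in[OF x truncate_cvec])
    have "a (g \<otimes> g') x v = snd (h (\<psi> g (\<psi> g' (k (x, truncate d v)))))"
      by (simp add: a_def \<psi>_comp[OF g e])
    also have "\<psi> g' (k (x, truncate d v)) = k (\<phi> g' x, a g' x (truncate d v))"
      using k_h[OF \<psi>_in[OF g(2) e]] h_\<psi>_k[OF g(2) x truncate_cvec] by simp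
    \<comment> \<open>The argument is truncated in the definition of \<open>a\<close> anyway, and
      the values already lie in \<open>cvec d\<close>.\<close>
    also have "a g' x (truncate d v) = truncate d (a g' x v)"
      using linop_cvec[OF a_is_linop[OF g(2) x]]
      by (simp add: truncate_id) (simp add: a_def truncate_id truncate_cvec)
    finally show ?thesis by (simp add: a_def)
  qed
  show "a g x v = v" if "g \<in> carrier G" "x \<in> topspace X" "\<phi> g x = x" "v \<in> cvec d" for g x v
  proof -
    have "\<psi> g (k (x, v)) = k (x, v)"
      using that k_in proj_k by (intro stab[of x]) (auto simp: stabilizer_def fibre_carrier)
    then show ?thesis using h_k[of x v] that by (simp add: a_def truncate_id)
  qed
qed

section \<open>Columns of an equivariant bundle monomorphism\<close>

definition column :: "('x \<times> cvector \<Rightarrow> 'e) \<Rightarrow> nat \<Rightarrow> 'x \<Rightarrow> cvector" where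
  "column u j x = snd (h (u (x, unit_vec j)))"

context
  fixes u :: "'x \<times> cvector \<Rightarrow> 'e" and r :: nat
  assumes u: "bundle_map X (product_bundle X r) \<xi> u"
begin

lemma u_in: "\<lbrakk>x \<in> topspace X; v \<in> cvec r\<rbrakk> \<Longrightarrow> u (x, v) \<in> E"
  using u continuous_map_image_subset_topspace[of "total_space (product_bundle X r)" "total_space \<xi>" u]
  by (auto simp: bundle_map_def topspace_complex_space)

lemma proj_u: "\<lbrakk>x \<in> topspace X; v \<in> cvec r\<rbrakk> \<Longrightarrow> proj \<xi> (u (x, v)) = x"
  using u by (auto simp: bundle_map_def topspace_complex_space)

lemma h_u:
  assumes x: "x \<in> topspace X" and v: "v \<in> cvec r"
  shows "h (u (x, v)) = (x, \<lambda>i. \<Sum>j<r. v j * column u j x i)"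
proof -
  have "linear_between (fibre (product_bundle X r) x) (fibre (product_bundle X d) x) (h \<circ> u)"
    using u x by (intro linear_between_comp[OF _ h_linear[OF x]]) (auto simp: bundle_map_def)
  from linear_between_product_bundles_expand[OF this v] show ?thesis by (simp add: column_def)
qed

text \<open>The action on the product bundle leaves the vector component alone, so the constant unit
  vector is an equivariant section, and \<open>u\<close> maps it to one.\<close>

lemma column_section:
  assumes eq: "equivariant G (total_space (product_bundle X r)) (product_action X r \<phi>) \<psi> u" and j: "j < r"
  shows "column u j \<in> sections"
  unfolding sections_def csection_def
proof (intro CollectI conjI ballI allI)
  fix x assume x: "x \<in> topspace X"
  note e = unit_vec_cvec[OF j]
  show "column u j x \<in> cvec d" unfolding column_def by (intro h_in u_in x e)
  fix g assume g: "g \<in> carrier G"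
  have "u (\<phi> g x, unit_vec j) = \<psi> g (u (x, unit_vec j))"
    using eq g x e by (auto simp: equivariant_def product_action_def topspace_complex_space)
  then show "column u j (\<phi> g x) = a g x (column u j x)"
    using h_\<psi>[OF g u_in[OF x e]] proj_u[OF x e] by (simp add: column_def)
next
  fix i
  have "continuous_map (prod_topology X (complex_space r)) (prod_topology X (complex_space d)) (h \<circ> u)"
    using u h_continuous by (auto simp: bundle_map_def intro: continuous_map_compose)
  from fibre_continuous[OF this j, of i]
  show "continuous_map X euclidean (\<lambda>x. column u j x i)" by (simp add: column_def)
qed

text \<open>A vanishing combination gives a vector with the same image under \<open>u\<close> as 0.
  The coefficients are truncated because \<open>indep\<close> leaves those from \<open>r\<close> on
  free, while the fibre is \<open>cvec r\<close>.\<close>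

lemma column_indep:
  assumes inj: "inj_on u (topspace (total_space (product_bundle X r)))" and x: "x \<in> topspace X"
  shows "indep r (\<lambda>j. column u j x)"
  unfolding indep_def
proof (intro allI impI)
  fix c j assume c: "\<forall>i. (\<Sum>j<r. c j * column u j x i) = 0" and j: "j < r"
  have zero: "(\<lambda>i. 0) \<in> cvec r" by (simp add: cvec_def)
  have "(\<Sum>j<r. truncate r c j * column u j x i) = 0" for i
    using c by (simp add: truncate_def)
  then have "h (u (x, truncate r c)) = h (u (x, \<lambda>i. 0))"
    using h_u[OF x truncate_cvec] h_u[OF x zero] by simp
  then have "u (x, truncate r c) = u (x, \<lambda>i. 0)"
    using k_h u_in[OF x truncate_cvec] u_in[OF x zero] by metis
  then have "truncate r c = (\<lambda>i. 0)"
    using inj x zero truncate_cvec[of r c] by (auto simp: inj_on_def topspace_complex_space)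
  then show "c j = 0" using j by (auto simp: truncate_def fun_eq_iff split: if_splits)
qed

end

section \<open>From families of linear maps back to bundle automorphisms\<close>

definition induced :: "('x \<Rightarrow> cvector \<Rightarrow> cvector) \<Rightarrow> 'x \<times> cvector \<Rightarrow> 'x \<times> cvector" where
  "induced S p = (fst p, S (fst p) (snd p))"

abbreviation "lift S \<equiv> k \<circ> (induced S \<circ> h)"

text \<open>\<open>automorphism\<close> gives continuity on unit vectors; joint continuity in the
  point and the vector follows by expanding \<open>S x v\<close> as a finite sum.\<close>

lemma induced_bundle_map:
  assumes S: "automorphism S"
  shows "bundle_map X \<xi> \<xi> (lift S)"
  unfolding bundle_map_def
proof (intro conjI ballI)
  let ?P = "prod_topology X (complex_space d)"
  have snd_cvec: "snd p \<in> cvec d" and fst_in: "fst p \<in> topspace X" if "p \<in> topspace ?P" for p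
    using that by (auto simp: topspace_complex_space)
  have "continuous_map ?P (complex_space d) (\<lambda>p. S (fst p) (snd p))"
  proof (rule continuous_map_into_complex_space)
    fix i
    have coord: "continuous_map ?P euclidean (\<lambda>p. snd p j)" for j
      using continuous_map_compose[OF continuous_map_snd complex_space_coordinate_continuous] by (simp add: o_def)
    have "continuous_map ?P euclidean (\<lambda>p. S (fst p) (unit_vec j) i)" if "j < d" for j
      using continuous_map_compose[OF continuous_map_fst automorphism_continuous[OF S that]] by (simp add: o_def)
    then have "continuous_map ?P euclidean (\<lambda>p. \<Sum>j<d. snd p j * S (fst p) (unit_vec j) i)"
      by (intro continuous_map_sum continuous_map_mult coord) auto
    then show "continuous_map ?P euclidean (\<lambda>p. S (fst p) (snd p) i)"
    proof (rule continuous_map_eq)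
      fix p assume "p \<in> topspace ?P"
      then show "(\<Sum>j<d. snd p j * S (fst p) (unit_vec j) i) = S (fst p) (snd p) i"
        by (intro linfun_expand[OF linop_linfun[OF automorphism_linop[OF S]], symmetric] fst_in)
    qed
    show "S (fst p) (snd p) \<in> cvec d" if "p \<in> topspace ?P" for p
      by (rule linop_cvec[OF automorphism_linop[OF S fst_in[OF that]]])
  qed
  then have "continuous_map ?P ?P (induced S)"
    unfolding induced_def by (intro continuous_map_pairedI continuous_map_fst)
  then show "continuous_map (total_space \<xi>) (total_space \<xi>) (lift S)"
    by (intro continuous_map_compose[OF continuous_map_compose[OF h_continuous] k_continuous])
  show "proj \<xi> ((lift S) e) = proj \<xi> e" if e: "e \<in> E" for e
    using proj_k[OF proj_in[OF e] linop_cvec[OF automorphism_linop[OF S proj_in[OF e]]]] h_eq[OF e]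
    by (metis comp_apply fst_conv induced_def)
  fix x assume x: "x \<in> topspace X"
  have "linear_between (fibre (product_bundle X d) x) (fibre (product_bundle X d) x) (induced S)"
    unfolding linear_between_def
    using linop_cvec[OF automorphism_linop[OF S x]] linop_add[OF automorphism_linop[OF S x]]
      linop_scale[OF automorphism_linop[OF S x]]
    by (auto simp: induced_def)
  then show "linear_between (fibre \<xi> x) (fibre \<xi> x) (lift S)"
    by (intro linear_between_comp[OF linear_between_comp[OF h_linear[OF x]] k_linear[OF x]])
qed

lemma induced_inverse:
  assumes "inverse_automorphisms S T" and e: "e \<in> E"
  shows "(lift T) ((lift S) e) = e"
proof -
  have S: "automorphism S" and TS: "T (proj \<xi> e) (S (proj \<xi> e) (snd (h e))) = snd (h e)"
    using assms proj_in[OF e] h_in[OF e] by (auto simp: inverse_automorphisms_def)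
  have "(lift S) e = k (proj \<xi> e, S (proj \<xi> e) (snd (h e)))"
    using h_eq[OF e] by (metis comp_apply fst_conv induced_def)
  moreover have "h (k (proj \<xi> e, S (proj \<xi> e) (snd (h e)))) = (proj \<xi> e, S (proj \<xi> e) (snd (h e)))"
    by (intro h_k proj_in e linop_cvec[OF automorphism_linop[OF S]])
  ultimately have "(lift T) ((lift S) e) = k (proj \<xi> e, snd (h e))"
    using TS by (simp add: induced_def)
  then show ?thesis using k_h[OF e] h_eq[OF e] by simp
qed

lemma induced_bundle_automorphism:
  assumes "inverse_automorphisms S T"
  shows "bundle_automorphism X \<xi> (lift S)"
proof -
  have ST: "automorphism S" "automorphism T" using assms by (auto simp: inverse_automorphisms_def)
  note maps = induced_bundle_map[OF ST(1)] induced_bundle_map[OF ST(2)]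
  have "homeomorphic_maps (total_space \<xi>) (total_space \<xi>) (lift S) (lift T)"
    unfolding homeomorphic_maps_def
    using maps induced_inverse[OF assms] induced_inverse[OF inverse_automorphisms_sym[OF assms]]
    unfolding bundle_map_def by blast
  with maps show ?thesis unfolding bundle_iso_def by blast
qed

lemma induced_equivariant:
  assumes S: "automorphism S"
  shows "equivariant G (total_space \<xi>) \<psi> \<psi> (lift S)"
  unfolding equivariant_def
proof (intro ballI)
  fix g e assume g: "g \<in> carrier G" and e: "e \<in> E"
  note x = proj_in[OF e] and v = h_in[OF e]
  have Sv: "S (proj \<xi> e) (snd (h e)) \<in> cvec d" by (rule linop_cvec[OF automorphism_linop[OF S x]])
  have "(lift S) (\<psi> g e) = k (\<phi> g (proj \<xi> e), a g (proj \<xi> e) (S (proj \<xi> e) (snd (h e))))"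
    by (simp add: h_\<psi>[OF g e] induced_def automorphism_equivariant[OF S g x v])
  also have "\<dots> = k (h (\<psi> g (k (proj \<xi> e, S (proj \<xi> e) (snd (h e))))))"
    by (simp add: h_\<psi>_k[OF g x Sv])
  also have "\<dots> = \<psi> g (k (proj \<xi> e, S (proj \<xi> e) (snd (h e))))"
    by (rule k_h[OF \<psi>_in[OF g k_in[OF x Sv]]])
  also have "k (proj \<xi> e, S (proj \<xi> e) (snd (h e))) = (lift S) e"
    using h_eq[OF e] by (metis comp_apply fst_conv induced_def)
  finally show "(lift S) (\<psi> g e) = \<psi> g ((lift S) e)" .
qed

text \<open>By linearity both maps are determined by their columns, so an automorphism conjugating
  the columns conjugates the maps.\<close>

lemma monomorphisms_conjugate:
  assumes u0: "bundle_map X (product_bundle X r) \<xi> u0" "inj_on u0 (topspace (total_space (product_bundle X r)))"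
      "equivariant G (total_space (product_bundle X r)) (product_action X r \<phi>) \<psi> u0"
    and u1: "bundle_map X (product_bundle X r) \<xi> u1" "inj_on u1 (topspace (total_space (product_bundle X r)))"
      "equivariant G (total_space (product_bundle X r)) (product_action X r \<phi>) \<psi> u1"
    and dim: "n + 2 * r \<le> 2 * d"
  shows "\<exists>s. bundle_automorphism X \<xi> s \<and> equivariant G (total_space \<xi>) \<psi> \<psi> s \<and>
             (\<forall>e\<in>topspace (total_space (product_bundle X r)). u0 e = s (u1 e))"
proof -
  have "\<exists>S S'. inverse_automorphisms S S' \<and> (\<forall>x\<in>topspace X. \<forall>j<r. S x (column u1 j x) = column u0 j x)"
    by (intro frames_conjugate column_section[OF u0(1,3)] column_section[OF u1(1,3)]
        column_indep[OF u0(1,2)] column_indep[OF u1(1,2)] dim)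
  then obtain S S' where S: "inverse_automorphisms S S'"
    and Su: "\<And>x j. \<lbrakk>x \<in> topspace X; j < r\<rbrakk> \<Longrightarrow> S x (column u1 j x) = column u0 j x"
    by blast
  have aut: "automorphism S" using S by (simp add: inverse_automorphisms_def)
  have "u0 (x, v) = (lift S) (u1 (x, v))" if x: "x \<in> topspace X" and v: "v \<in> cvec r" for x v
  proof -
    have "S x (\<lambda>i. \<Sum>j<r. v j * column u1 j x i) = (\<lambda>i. \<Sum>j<r. v j * S x (column u1 j x) i)"
      by (rule linop_sum[OF automorphism_linop[OF aut x]])
    also have "\<dots> = (\<lambda>i. \<Sum>j<r. v j * column u0 j x i)"
      by (intro ext sum.cong refl) (simp add: Su[OF x])
    finally have "(lift S) (u1 (x, v)) = k (h (u0 (x, v)))"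
      by (simp add: h_u[OF u1(1) x v] h_u[OF u0(1) x v] induced_def)
    then show ?thesis using k_h[OF u_in[OF u0(1) x v]] by simp
  qed
  then show ?thesis
    using induced_bundle_automorphism[OF S] induced_equivariant[OF aut]
    by (intro exI[of _ "lift S"]) (auto simp: topspace_complex_space)
qed

end

theorem proposition3p1:
  fixes G :: "('g, 'z) monoid_scheme"
    and X :: "'x topology" and A :: "'x chart set" and \<phi> :: "'g \<Rightarrow> 'x \<Rightarrow> 'x"
    and \<xi> :: "('x, 'e) vbundle" and \<psi> :: "'g \<Rightarrow> 'e \<Rightarrow> 'e"
    and u\<^sub>0 u\<^sub>1 :: "'x \<times> (nat \<Rightarrow> complex) \<Rightarrow> 'e"
    and n d r :: nat
  defines "\<theta> \<equiv> product_bundle X r" and "\<tau> \<equiv> product_action X r \<phi>"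
  assumes "smooth_manifold n X A"
    and "group G" and "finite (carrier G)"
    and "smooth_action G n X A \<phi>"
    and "equivariant_vector_bundle G X \<phi> \<xi> \<psi>"
    and "trivial_bundle X d \<xi>"
    and "\<And>x h e. \<lbrakk>x \<in> topspace X; h \<in> stabilizer G \<phi> x; e \<in> carrier (fibre \<xi> x)\<rbrakk> \<Longrightarrow> \<psi> h e = e"
    and "bundle_map X \<theta> \<xi> u\<^sub>0" and "inj_on u\<^sub>0 (topspace (total_space \<theta>))"
    and "equivariant G (total_space \<theta>) \<tau> \<psi> u\<^sub>0"
    and "bundle_map X \<theta> \<xi> u\<^sub>1" and "inj_on u\<^sub>1 (topspace (total_space \<theta>))"
    and "equivariant G (total_space \<theta>) \<tau> \<psi> u\<^sub>1"
    and "real d \<ge> real n / 2 + real r"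
  shows "\<exists>s. bundle_automorphism X \<xi> s \<and> equivariant G (total_space \<xi>) \<psi> \<psi> s \<and>
             (\<forall>e\<in>topspace (total_space \<theta>). u\<^sub>0 e = s (u\<^sub>1 e))"
proof -
  obtain h k where "bundle_map X \<xi> (product_bundle X d) h" "bundle_map X (product_bundle X d) \<xi> k"
    "homeomorphic_maps (total_space \<xi>) (total_space (product_bundle X d)) h k"
    using assms(8) unfolding trivial_bundle_def bundle_iso_def by blast
  then interpret trivialized_bundle G n X A \<phi> \<xi> \<psi> d h k
    using assms(3-7,9) unfolding trivialized_bundle_def smooth_G_manifold_def trivialized_bundle_axioms_def
    by blast
  \<comment> \<open>Doubling keeps the inequality within the natural numbers, also for odd
    \<open>n\<close>.\<close>
  have "n + 2 * r \<le> 2 * d" using assms(16) by linarith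
  then show ?thesis
    using monomorphisms_conjugate assms(10-15) unfolding \<theta>_def \<tau>_def by blast
qed

end
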